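(* Let $n \in \mathbb N$ (a positive integer), let $k_1,\dots,k_n \in \mathbb N \cup \{0\}$, and let $T^n, T^{k_1(1)},\dots,T^{k_n(n)}$ be $n$-, $k_1$-, $\dots$, $k_n$-punctured ball tangle diagrams, respectively. If $$F^{k_j}(T^{k_j(j)})=\left[\begin{matrix} b_{11}^j & \cdots & b_{1\,2^{k_j}}^j \\ b_{21}^j & \cdots & b_{2\,2^{k_j}}^j\end{matrix}\right]\qquad (j=1,\dots,n),$$ then $$F^{k_1+\cdots+k_n}\bigl(T^n(T^{k_1(1)},\dots,T^{k_n(n)})\bigr)=F^n(T^n)\,[\eta^n]\bigl(F^{k_1}(T^{k_1(1)}),\dots,F^{k_n}(T^{k_n(n)})\bigr),$$ where $[\eta^n](F^{k_1}(T^{k_1(1)}),\dots,F^{k_n}(T^{k_n(n)}))$ is the class modulo $\pm1$ of the $2^n\times 2^{k_1+\cdots+k_n}$ matrix whose $i$-th row, for $1\le i\le 2^n$, is $$\xi^{n,2^{k_1},\dots,2^{k_n}}\bigl((b^1_{\alpha^n_{i1}1},\dots,b^1_{\alpha^n_{i1}2^{k_1}}),\dots,(b^n_{\alpha^n_{in}1},\dots,b^n_{\alpha^n_{in}2^{k_n}})\bigr),$$ i.e. whose $(i,l)$-entry is $\prod_{j=1}^n b^j_{\alpha^n_{ij}\,\alpha^{n,2^{k_1},\dots,2^{k_n}}_{lj}}$ for $1\le i\le 2^n$, $1\le l\le 2^{k_1+\cdots+k_n}$.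
   Context: Punctured ball tangles. For $n\ge 0$ let $H_0$ be a closed 3-ball and $H_1,\dots,H_n$ pairwise disjoint closed 3-balls in the interior of $H_0$, with four distinct marked points on each $\partial H_k$ ($0\le k\le n$). An $n$-punctured ball tangle is a 1-dimensional proper submanifold $T$ of $H_0-\bigcup_{i=1}^n \mathrm{Int}(H_i)$ with $\partial T$ equal to the set of all marked points. It is represented by a diagram (with over/under crossings) in a disc with $n$ ordered holes, where each of the $n+1$ boundary circles carries four marked points in the positions NW, NE, SW, SE. A ball tangle is a 0-punctured ball tangle. The first (numbered $1$) fundamental ball tangle is the crossingless diagram with two arcs joining NW to SW and NE to SE; the second (numbered $2$) is the crossingless diagram with two arcs joining NW to NE and SW to SE. The numerator closure of a ball tangle diagram joins, outside the disc and without crossings, NW to NE and SW to SE; the denominator closure joins NW to SW and NE to SE. Composition. $T^n(X_1,\dots,X_n)$ denotes the diagram obtained by filling the $j$-th hole of $T^n$ with the punctured ball tangle diagram $X_j$, for each $j$ (matching marked points NW, NE, SW, SE). If $X_j$ is $k_j$-punctured, the result is $(k_1+\cdots+k_n)$-punctured, its holes being ordered as: the holes of $X_1$ in order, then those of $X_2$, and so on. Kauffman bracket. Let $A=e^{i\pi/4}$. For a link diagram $L$, $\langle L\rangle=\sum_\sigma A^{\alpha(\sigma)-\beta(\sigma)}(-A^2-A^{-2})^{d(\sigma)-1}$, where $\sigma$ runs over all states (a choice of $A$-type or $B$-type splitting at every crossing; the $A$-type splitting joins the two regions swept out by rotating the overcrossing strand counterclockwise, the $B$-type splitting joins the other two),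 $\alpha(\sigma),\beta(\sigma)$ are the numbers of $A$- and $B$-splittings, and $d(\sigma)$ is the number of circles of the resulting crossingless diagram. Since $-A^2-A^{-2}=0$, only states with $d(\sigma)=1$ contribute (convention $0^0=1$). Dictionary order. For positive integers $m_1,\dots,m_n$, let $\alpha_1^{n,m_1,\dots,m_n}<\cdots<\alpha_{m_1\cdots m_n}^{n,m_1,\dots,m_n}$ be the elements of $\prod_{j=1}^n\{1,\dots,m_j\}$ in lexicographic order, and let $\alpha_{lj}^{n,m_1,\dots,m_n}$ be the $j$-th coordinate of $\alpha_l^{n,m_1,\dots,m_n}$. When $m_1=\cdots=m_n=2$ write $\alpha_l^n$ and $\alpha_{lj}^n$. Define $\xi^{n,m_1,\dots,m_n}:\mathbb C^{m_1}\times\cdots\times\mathbb C^{m_n}\to\mathbb C^{m_1\cdots m_n}$ by letting the $l$-th coordinate of $\xi^{n,m_1,\dots,m_n}(v^1,\dots,v^n)$ be $\prod_{j=1}^n v^j_{\alpha_{lj}^{n,m_1,\dots,m_n}}$, where $v^j=(v^j_1,\dots,v^j_{m_j})$. The invariant. $PM_{m\times l}(\mathbb Z)$ is the set of $m\times l$ integer matrices modulo multiplication by $\pm1$; $[M]=\{M,-M\}$ is the class of $M$, and products of classes are defined by $[M][N]=[MN]$. Let $\Phi=\{z\in\mathbb C: z^8=1\}$. For an $n$-punctured ball tangle diagram $T^n$, $\epsilon\in\{1,2\}$ and $1\le l\le 2^n$, let $T^n_{\epsilon\alpha^n_l}$ be the link diagram obtained by filling the $j$-th hole of $T^n$ with fundamental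 ball tangle number $\alpha^n_{lj}$ for each $j$ and then taking the numerator closure if $\epsilon=1$, the denominator closure if $\epsilon=2$. Let $t_l$ be the number of coordinates of $\alpha^n_l$ equal to $2$. Then $$F^n(T^n)=\left\{\begin{pmatrix}(-i)^{t_1}z\langle T^n_{1\alpha^n_1}\rangle&\cdots&(-i)^{t_{2^n}}z\langle T^n_{1\alpha^n_{2^n}}\rangle\\(-i)^{t_1}iz\langle T^n_{2\alpha^n_1}\rangle&\cdots&(-i)^{t_{2^n}}iz\langle T^n_{2\alpha^n_{2^n}}\rangle\end{pmatrix}: z\in\Phi\right\}\cap M_{2\times 2^n}(\mathbb Z),$$ which is an element of $PM_{2\times2^n}(\mathbb Z)$. For $n=0$ there are no holes and one column with $t_1=0$, so $F^0(B)$ is the class of a column $(z\langle B_1\rangle, iz\langle B_2\rangle)^{T}$, where $B_1,B_2$ are the numerator and denominator closures of $B$. *)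

theory Defs
  imports Complex_Main "Jordan_Normal_Form.Matrix"
begin

section \<open>Diagrams\<close>

text \<open>
  Diagrams are encoded combinatorially, as planar maps.  The elements of \<open>'d\<close> are the two ends
  ("darts") of the arcs into which the vertices cut the diagram; \<open>opp\<close> sends an end of an arc to the
  other end of this arc.  A crossing \<open>(a, b, c, d)\<close> lists the four arc ends at a double point
  counterclockwise, beginning with an end of the undercrossing strand: the undercrossing strand is
  \<open>a c\<close> and the overcrossing strand is \<open>b d\<close>.  A joint \<open>(a, b)\<close> is a point in the interior of a strand
  which is not a double point.  Joints record the points along which diagrams are glued, and every
  closed curve without crossings carries at least one joint.  In which region of one component of a
  disconnected diagram another component lies is not recorded; neither composition nor closures nor
  the bracket depend on it.
\<close>

record 'd link_diagram =
  crossings :: "('d \<times> 'd \<times> 'd \<times> 'd) list"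
  joints :: "('d \<times> 'd) list"
  opp :: "'d \<Rightarrow> 'd"

datatype corner = NW | NE | SW | SE

text \<open>
  \<open>holes T ! j\<close> and \<open>outer T\<close> give the arc ends at the four marked points of the \<open>j\<close>-th hole
  (counting from 0) and of the outer circle.
\<close>

record 'd tangle_diagram = "'d link_diagram" +
  holes :: "(corner \<Rightarrow> 'd) list"
  outer :: "corner \<Rightarrow> 'd"

definition strand_vertices :: "('d, 'm) link_diagram_scheme \<Rightarrow> 'd list list" where
  "strand_vertices L =
     map (\<lambda>(a, b, c, d). [a, b, c, d]) (crossings L) @ map (\<lambda>(a, b). [a, b]) (joints L)"

definition link_darts :: "('d, 'm) link_diagram_scheme \<Rightarrow> 'd set" where
  "link_darts L = set (concat (strand_vertices L))"

text \<open>
  Collapsing the inside of every hole and the outside of the disc to points turns a tangle diagram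
  into a graph on the sphere.  Each vertex is given by the arc ends at it in counterclockwise order;
  for the outer circle, seen from the point at infinity, this is the clockwise order in the plane.
\<close>

definition tangle_vertices :: "'d tangle_diagram \<Rightarrow> 'd list list" where
  "tangle_vertices T = strand_vertices T
     @ map (\<lambda>h. [h NW, h SW, h SE, h NE]) (holes T)
     @ [[outer T NW, outer T NE, outer T SE, outer T SW]]"

definition darts :: "'d tangle_diagram \<Rightarrow> 'd set" where
  "darts T = set (concat (tangle_vertices T))"

definition arcs :: "('d, 'm) link_diagram_scheme \<Rightarrow> 'd set \<Rightarrow> ('d \<times> 'd) set" where
  "arcs L D = {(x, opp L x) | x. x \<in> D}"

definition num_components :: "'d set \<Rightarrow> ('d \<times> 'd) set \<Rightarrow> nat" where
  "num_components D R = card (D // (R \<union> R\<inverse>)\<^sup>*)"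

definition next_dart :: "'d tangle_diagram \<Rightarrow> ('d \<times> 'd) set" where
  "next_dart T = (\<Union>v \<in> set (tangle_vertices T). set (zip v (rotate1 v)))"

text \<open>
  The regions correspond to the orbits of the permutation \<open>arcs T (darts T) O next_dart T\<close>, which
  runs along an arc and then turns to the next arc at the vertex reached.  Euler's formula
  \<open>V - E + F = 2 C\<close>, where \<open>C\<close> is the number of components of the graph, says that each component
  of the graph is a map on the sphere (every component satisfies \<open>V - E + F \<le> 2\<close>).
\<close>

definition planar :: "'d tangle_diagram \<Rightarrow> bool" where
  "planar T \<longleftrightarrow>
     length (tangle_vertices T) + num_components (darts T) (arcs T (darts T) O next_dart T)
       = card ((\<lambda>x. {x, opp T x}) ` darts T)
         + 2 * num_components (darts T) (arcs T (darts T) \<union> next_dart T)"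

definition punctured_ball_tangle_diagram :: "nat \<Rightarrow> 'd tangle_diagram \<Rightarrow> bool" where
  "punctured_ball_tangle_diagram n T \<longleftrightarrow>
     length (holes T) = n \<and>
     distinct (concat (tangle_vertices T)) \<and>
     (\<forall>x \<in> darts T. opp T x \<in> darts T \<and> opp T x \<noteq> x \<and> opp T (opp T x) = x) \<and>
     planar T"

text \<open>
  \<open>fundamental_tangle 0\<close> and \<open>fundamental_tangle 1\<close> are the first and the second fundamental ball
  tangle.
\<close>

definition fundamental_tangle :: "nat \<Rightarrow> corner tangle_diagram" where
  "fundamental_tangle i =
     \<lparr> crossings = [], joints = [],
       opp = (if i = 0 then (\<lambda>p. case p of NW \<Rightarrow> SW | SW \<Rightarrow> NW | NE \<Rightarrow> SE | SE \<Rightarrow> NE)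
              else (\<lambda>p. case p of NW \<Rightarrow> NE | NE \<Rightarrow> NW | SW \<Rightarrow> SE | SE \<Rightarrow> SW)),
       holes = [], outer = id \<rparr>"

text \<open>\<open>closure 0\<close> is the numerator closure and \<open>closure 1\<close> the denominator closure.\<close>

definition closure :: "nat \<Rightarrow> 'd tangle_diagram \<Rightarrow> 'd link_diagram" where
  "closure e T =
     \<lparr> crossings = crossings T,
       joints = (if e = 0 then [(outer T NW, outer T NE), (outer T SW, outer T SE)]
                 else [(outer T NW, outer T SW), (outer T NE, outer T SE)]) @ joints T,
       opp = opp T \<rparr>"

text \<open>
  In \<open>compose T Xs\<close> the arc ends of \<open>T\<close> are tagged with \<open>Inl\<close>, those of \<open>Xs ! j\<close> with \<open>Inr\<close> and \<open>j\<close>,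
  and each marked point of the \<open>j\<close>-th hole of \<open>T\<close> is joined to the corresponding outer marked point
  of \<open>Xs ! j\<close>.
\<close>

definition compose ::
  "'a tangle_diagram \<Rightarrow> 'b tangle_diagram list \<Rightarrow> ('a + nat \<times> 'b) tangle_diagram" where
  "compose T Xs =
     \<lparr> crossings =
         map (\<lambda>(a, b, c, d). (Inl a, Inl b, Inl c, Inl d)) (crossings T)
         @ concat (map (\<lambda>j. map (\<lambda>(a, b, c, d). (Inr (j, a), Inr (j, b), Inr (j, c), Inr (j, d)))
                               (crossings (Xs ! j))) [0..<length Xs]),
       joints =
         map (\<lambda>(a, b). (Inl a, Inl b)) (joints T)
         @ concat (map (\<lambda>j. map (\<lambda>(a, b). (Inr (j, a), Inr (j, b))) (joints (Xs ! j)))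
                    [0..<length Xs])
         @ concat (map (\<lambda>j. map (\<lambda>p. (Inl ((holes T ! j) p), Inr (j, outer (Xs ! j) p)))
                               [NW, NE, SW, SE]) [0..<length Xs]),
       opp = (\<lambda>x. case x of Inl a \<Rightarrow> Inl (opp T a) | Inr (j, b) \<Rightarrow> Inr (j, opp (Xs ! j) b)),
       holes = concat (map (\<lambda>j. map (\<lambda>h p. Inr (j, h p)) (holes (Xs ! j))) [0..<length Xs]),
       outer = (\<lambda>p. Inl (outer T p)) \<rparr>"

section \<open>The Kauffman bracket\<close>

text \<open>
  A state is the set of the crossings that get the \<open>A\<close>-type splitting.  At a crossing
  \<open>(a, b, c, d)\<close> the overcrossing strand \<open>b d\<close>, rotated counterclockwise, sweeps out the regions
  between \<open>b\<close> and \<open>c\<close> and between \<open>d\<close> and \<open>a\<close>; joining these two regions leaves the strands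
  \<open>a b\<close> and \<open>c d\<close>.
\<close>

definition splitting_arcs ::
  "'d link_diagram \<Rightarrow> ('d \<times> 'd \<times> 'd \<times> 'd) set \<Rightarrow> ('d \<times> 'd) set" where
  "splitting_arcs L \<sigma> =
     (\<Union>(a, b, c, d) \<in> set (crossings L).
        if (a, b, c, d) \<in> \<sigma> then {(a, b), (c, d)} else {(b, c), (d, a)}) \<union> set (joints L)"

definition num_circles :: "'d link_diagram \<Rightarrow> ('d \<times> 'd \<times> 'd \<times> 'd) set \<Rightarrow> nat" where
  "num_circles L \<sigma> = num_components (link_darts L) (arcs L (link_darts L) \<union> splitting_arcs L \<sigma>)"

definition bracket_A :: complex where
  "bracket_A = exp (\<i> * of_real (pi / 4))"

definition bracket :: "'d link_diagram \<Rightarrow> complex" where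
  "bracket L =
     (\<Sum>\<sigma> \<in> Pow (set (crossings L)).
        bracket_A powi (int (card \<sigma>) - int (card (set (crossings L) - \<sigma>)))
        * (- (bracket_A powi 2) - bracket_A powi (- 2)) ^ (num_circles L \<sigma> - 1))"

section \<open>Dictionary order\<close>

text \<open>
  All indices and coordinates are counted from 0: \<open>dict [m\<^sub>1, \<dots>, m\<^sub>n] ! l ! j\<close> is
  \<open>\<alpha>\<^bsub>l+1, j+1\<^esub> - 1\<close> in terms of the usual tuples with coordinates in \<open>{1..m\<^sub>j}\<close>.
\<close>

definition dict :: "nat list \<Rightarrow> nat list list" where
  "dict ms = product_lists (map (\<lambda>m. [0..<m]) ms)"

lemma set_dict: "set (dict ms) = {xs. list_all2 (<) xs ms}"
proof -
  have "set (dict ms) = {xs. list_all2 (\<lambda>x m. x \<in> set [0..<m]) xs ms}"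
    by (simp only: dict_def product_lists_set list_all2_map2)
  then show ?thesis
    by simp
qed

lemma sorted_dict: "sorted_wrt (\<lambda>xs ys. (xs, ys) \<in> lexord {(x, y). x < y}) (dict ms)"
proof (induction ms)
  case Nil
  then show ?case
    by (simp add: dict_def)
next
  case (Cons m ms)
  have "sorted_wrt (\<lambda>xs ys. (xs, ys) \<in> lexord {(x, y). x < y})
          (concat (map (\<lambda>x. map ((#) x) (dict ms)) [0..<k]))" for k :: nat
  proof (induction k)
    case 0
    then show ?case
      by simp
  next
    case (Suc k)
    then show ?case
      using Cons.IH by (auto simp: sorted_wrt_append sorted_wrt_map)
  qed
  then show ?case
    by (simp add: dict_def)
qed

definition xi :: "nat list \<Rightarrow> 'a::comm_semiring_1 vec list \<Rightarrow> 'a vec" where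
  "xi ms vs = vec (prod_list ms) (\<lambda>l. \<Prod>j<length ms. vs ! j $ (dict ms ! l ! j))"

section \<open>The invariant\<close>

definition pm_class :: "int mat \<Rightarrow> int mat set" where
  "pm_class M = {M, - M}"

definition pm_mult :: "int mat set \<Rightarrow> int mat set \<Rightarrow> int mat set" where
  "pm_mult P Q = {M * N | M N. M \<in> P \<and> N \<in> Q}"

lemma pm_mult_class:
  assumes "M \<in> carrier_mat r s" "N \<in> carrier_mat s t"
  shows "pm_mult (pm_class M) (pm_class N) = pm_class (M * N)"
proof -
  have eq: "- M * N = - (M * N)" "M * - N = - (M * N)" "- M * - N = M * N"
    using assms by simp_all
  have "pm_mult (pm_class M) (pm_class N) = {M * N, M * - N, - M * N, - M * - N}"
    unfolding pm_mult_def pm_class_def by blast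
  then show ?thesis
    unfolding eq by (auto simp: pm_class_def)
qed

definition invariant_mat :: "nat \<Rightarrow> 'd tangle_diagram \<Rightarrow> complex \<Rightarrow> complex mat" where
  "invariant_mat n T z = mat 2 (2 ^ n) (\<lambda>(e, l).
     let \<alpha> = dict (replicate n 2) ! l
     in (- \<i>) ^ count_list \<alpha> 1 * (if e = 0 then 1 else \<i>) * z
        * bracket (closure e (compose T (map fundamental_tangle \<alpha>))))"

definition invariant :: "nat \<Rightarrow> 'd tangle_diagram \<Rightarrow> int mat set" where
  "invariant n T = {M. \<exists>z. z ^ 8 = 1 \<and> map_mat of_int M = invariant_mat n T z}"

definition eta :: "nat \<Rightarrow> (nat \<Rightarrow> nat) \<Rightarrow> (nat \<Rightarrow> int mat) \<Rightarrow> int mat" where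
  "eta n k b = mat_of_rows (2 ^ (\<Sum>j<n. k j))
     (map (\<lambda>i. xi (map (\<lambda>j. 2 ^ k j) [0..<n])
                  (map (\<lambda>j. row (b j) (dict (replicate n 2) ! i ! j)) [0..<n]))
          [0..<2 ^ n])"

end

theory Submission
  imports Defs "HOL-Library.FuncSet"
begin

text \<open>
  For \<open>A = e\<^sup>i\<^sup>\<pi>\<^sup>/\<^sup>4\<close> the value \<open>- A\<^sup>2 - A\<^sup>-\<^sup>2\<close> of a circle is zero, so the bracket is
  the sum of the weights of the states that consist of a single circle.  Consider a state of
  the composite diagram.  Inside the \<open>j\<close>-th hole of \<open>T\<close> it joins the four marked points in pairs,
  and it does so like one of the two fundamental tangles, say number \<open>t\<^sub>j\<close>, because the diagram is
  planar.  The whole state is a single circle if and only if two things happen: the state of \<open>T\<close>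
  becomes a single circle when the holes are filled with the fundamental tangles \<open>t\<^sub>j\<close>, and no part
  contains a closed curve, which means that closure number \<open>t\<^sub>j\<close> turns the \<open>j\<close>-th part into a single
  circle (\<open>closed_connected_compose\<close>).  The other closure of this part never gives a single circle
  (\<open>closed_connected_type\<close>).  Weights multiply, so the bracket of the composite is the sum, over all
  words \<open>t\<close>, of the bracket of \<open>T\<close> filled with \<open>t\<close> times the brackets of the parts with closures \<open>t\<^sub>j\<close>
  (\<open>state_sum_compose\<close>).  Up to the normalizing factors this is the matrix product: in the sum over
  \<open>t\<close> the factor \<open>-\<i>\<close>, which a column of \<open>T\<close> has for each second fundamental tangle, cancels the
  factor \<open>\<i>\<close> of the second row of the corresponding part.

  Planarity enters through a checkerboard colouring.  Euler's formula says that the map has no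
  homology modulo 2, hence the arc ends can be coloured with two colours that alternate around
  every vertex and differ at the two ends of every arc (\<open>checkerboard_colouring\<close>).  All strands of
  all states then run from one colour to the other.  This forbids a strand between opposite marked
  points (\<open>four_ends_joined_in_adjacent_pairs\<close>), and it implies that a change of one splitting
  changes the parity of the number of circles (\<open>smoothing_change\<close>).  By the latter, the states
  with a single circle have weights that agree up to sign once the factors \<open>-\<i>\<close> and \<open>\<i>\<close> are
  included, so a common eighth root of unity makes all entries of the matrix integral
  (\<open>integral_normalization\<close>).  Two admissible roots of unity have a rational quotient unless the
  matrix is zero; therefore the invariant is a full class \<open>{M, -M}\<close> (\<open>invariant_eq_pm_class\<close>), and
  it suffices to exhibit one product of integer matrices in the invariant of the composite.
\<close>

section \<open>Components of a relation\<close>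

text \<open>
  The unions of components.  There are two to the power of the number of components of them, and
  they are closed under symmetric difference; so counting components becomes linear algebra
  modulo 2.
\<close>

definition saturated :: "'a set \<Rightarrow> ('a \<times> 'a) set \<Rightarrow> 'a set set" where
  "saturated D R = {A. A \<subseteq> D \<and> (\<forall>(x, y) \<in> R. x \<in> A \<longleftrightarrow> y \<in> A)}"

lemma saturatedD: "A \<in> saturated D R \<Longrightarrow> (x, y) \<in> R \<Longrightarrow> x \<in> A \<longleftrightarrow> y \<in> A"
  by (auto simp: saturated_def)

abbreviation linked :: "('a \<times> 'a) set \<Rightarrow> ('a \<times> 'a) set" where
  "linked R \<equiv> (R \<union> R\<inverse>)\<^sup>*"

lemma linked_invariant:
  assumes "(x, y) \<in> linked R" "\<And>u v. (u, v) \<in> R \<Longrightarrow> P u = P v"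
  shows "P x = P y"
  using assms(1) by (induction rule: rtrancl_induct) (auto dest: assms(2))

lemma equiv_linked: "equiv UNIV (linked R)"
  by (auto simp: equiv_def sym_rtrancl sym_Un_converse trans_rtrancl intro: refl_rtrancl)

lemma linked_sym: "(x, y) \<in> linked R \<Longrightarrow> (y, x) \<in> linked R"
  using equiv_linked[of R] by (meson equiv_def symE)

lemma linked_trans: "(x, y) \<in> linked R \<Longrightarrow> (y, z) \<in> linked R \<Longrightarrow> (x, z) \<in> linked R"
  by (rule rtrancl_trans)

lemma linked_step: "(x, y) \<in> R \<Longrightarrow> (x, y) \<in> linked R"
  by auto

lemma linked_closed:
  assumes "R \<subseteq> D \<times> D" "x \<in> D" "(x, y) \<in> linked R"
  shows "y \<in> D"
proof -
  have "(x \<in> D) = (y \<in> D)"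
    using assms(3) by (rule linked_invariant) (use assms(1) in auto)
  then show ?thesis
    using assms(2) by simp
qed

lemma num_components_partition:
  assumes "\<Union>\<P> = D"
    and "\<And>C. C \<in> \<P> \<Longrightarrow> C \<noteq> {}"
    and "\<And>C x y. C \<in> \<P> \<Longrightarrow> x \<in> C \<Longrightarrow> y \<in> C \<Longrightarrow> (x, y) \<in> linked R"
    and "\<And>C x y. C \<in> \<P> \<Longrightarrow> (x, y) \<in> R \<Longrightarrow> x \<in> C \<longleftrightarrow> y \<in> C"
  shows "num_components D R = card \<P>"
proof -
  have cls: "linked R `` {x} = C" if "C \<in> \<P>" "x \<in> C" for C x
  proof -
    have "y \<in> C" if "(x, y) \<in> linked R" for y
      using linked_invariant[OF that, of "\<lambda>z. z \<in> C"] assms(4) \<open>C \<in> \<P>\<close> \<open>x \<in> C\<close> by blast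
    then show ?thesis
      using assms(3) that by blast
  qed
  have "D // linked R = \<P>"
  proof
    show "D // linked R \<subseteq> \<P>"
      using cls assms(1) by (auto simp: quotient_def)
    show "\<P> \<subseteq> D // linked R"
    proof
      fix C assume C: "C \<in> \<P>"
      then obtain x where x: "x \<in> C" using assms(2) by blast
      then have "x \<in> D" using C assms(1) by blast
      then show "C \<in> D // linked R"
        using cls[OF C x] by (auto simp: quotient_def)
    qed
  qed
  then show ?thesis
    by (simp add: num_components_def)
qed

lemma card_saturated:
  assumes "finite D" "R \<subseteq> D \<times> D"
  shows "card (saturated D R) = 2 ^ num_components D R"
proof -
  let ?Q = "D // linked R"
  have sub: "C \<subseteq> D" and ne: "C \<noteq> {}" if "C \<in> ?Q" for C
    using that linked_closed[OF assms(2)] by (auto simp: quotient_def)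
  have disj: "C = C'" if "C \<in> ?Q" "C' \<in> ?Q" "x \<in> C" "x \<in> C'" for C C' x
    using that quotient_disj[OF equiv_linked, of C R C'] by (auto simp: quotient_def)
  have "bij_betw Union (Pow ?Q) (saturated D R)"
  proof (rule bij_betw_imageI)
    have key: "S \<subseteq> S'" if S: "S \<subseteq> ?Q" "S' \<subseteq> ?Q" "\<Union>S \<subseteq> \<Union>S'" for S S'
    proof
      fix C assume C: "C \<in> S"
      then obtain x where x: "x \<in> C" using ne S by blast
      then obtain C' where C': "C' \<in> S'" "x \<in> C'" using C S by blast
      then have "C = C'" using disj C x S by blast
      then show "C \<in> S'" using C' by simp
    qed
    show "inj_on Union (Pow ?Q)"
    proof (rule inj_onI)
      fix S S' assume "S \<in> Pow ?Q" "S' \<in> Pow ?Q" "\<Union>S = \<Union>S'"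
      then show "S = S'" using key[of S S'] key[of S' S] by blast
    qed
    show "Union ` Pow ?Q = saturated D R"
    proof
      show "Union ` Pow ?Q \<subseteq> saturated D R"
      proof
        fix A assume "A \<in> Union ` Pow ?Q"
        then obtain S where S: "S \<subseteq> ?Q" "A = \<Union>S" by blast
        have "x \<in> A \<longleftrightarrow> y \<in> A" if "(x, y) \<in> R" for x y
        proof -
          have "x \<in> C \<longleftrightarrow> y \<in> C" if "C \<in> S" for C
          proof -
            have "C \<in> ?Q" using S that by blast
            then obtain z where z: "C = linked R `` {z}" by (auto simp: quotient_def)
            have "(x, y) \<in> linked R" using \<open>(x, y) \<in> R\<close> by (rule linked_step)
            then show ?thesis
              unfolding z using linked_trans linked_sym by (metis Image_singleton_iff)
          qed
          then show ?thesis using S by blast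
        qed
        moreover have "A \<subseteq> D" using S sub by blast
        ultimately show "A \<in> saturated D R" by (auto simp: saturated_def)
      qed
      show "saturated D R \<subseteq> Union ` Pow ?Q"
      proof
        fix A assume A: "A \<in> saturated D R"
        have "y \<in> A" if "x \<in> A" "(x, y) \<in> linked R" for x y
          using linked_invariant[OF that(2), of "\<lambda>z. z \<in> A"] A that(1)
          by (auto simp: saturated_def)
        then have "A = \<Union> ((\<lambda>x. linked R `` {x}) ` A)"
          by blast
        moreover have "(\<lambda>x. linked R `` {x}) ` A \<subseteq> ?Q"
          using A by (auto simp: saturated_def quotient_def)
        ultimately show "A \<in> Union ` Pow ?Q" by blast
      qed
    qed
  qed
  moreover have "finite ?Q"
    using assms(1) by (simp add: quotient_def)
  ultimately show ?thesis
    by (metis bij_betw_same_card card_Pow num_components_def)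
qed

lemma finite_saturated: "finite D \<Longrightarrow> finite (saturated D R)"
  by (rule finite_subset[of _ "Pow D"]) (auto simp: saturated_def)

lemma saturated_sym_diff:
  "A \<in> saturated D R \<Longrightarrow> B \<in> saturated D R \<Longrightarrow> sym_diff A B \<in> saturated D R"
  by (auto simp: saturated_def)

lemma sym_diff_cancel: "sym_diff (sym_diff A B) B = A"
  by blast

text \<open>
  If \<open>x\<close> and \<open>y\<close> lie in different components, the symmetric difference with the component of \<open>x\<close>
  exchanges the unions of components that separate \<open>x\<close> from \<open>y\<close> with those that do not.  Hence
  exactly half of the unions survive the new edge.
\<close>

lemma num_components_insert:
  assumes "finite D" "R \<subseteq> D \<times> D" "x \<in> D" "y \<in> D"
  shows "num_components D R
           = num_components D (insert (x, y) R) + (if (x, y) \<in> linked R then 0 else 1)"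
proof -
  let ?I = "saturated D R" and ?J = "saturated D (insert (x, y) R)"
  have J: "?J = {A \<in> ?I. x \<in> A \<longleftrightarrow> y \<in> A}"
    by (auto simp: saturated_def)
  have cJ: "card ?J = 2 ^ num_components D (insert (x, y) R)"
    using assms by (intro card_saturated) auto
  have cI: "card ?I = 2 ^ num_components D R"
    using assms by (intro card_saturated)
  show ?thesis
  proof (cases "(x, y) \<in> linked R")
    case True
    have "x \<in> A \<longleftrightarrow> y \<in> A" if "A \<in> ?I" for A
      using linked_invariant[OF True, of "\<lambda>z. z \<in> A"] that by (auto simp: saturated_def)
    then have "?J = ?I" using J by blast
    then show ?thesis using cI cJ True by simp
  next
    case False
    define K where "K = linked R `` {x}"
    have K: "K \<in> ?I" "x \<in> K" "y \<notin> K"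
      using assms linked_closed[OF assms(2,3)] False
      by (auto simp: K_def saturated_def intro: rtrancl.rtrancl_into_rtrancl)
    have "?I - ?J = (\<lambda>A. sym_diff A K) ` ?J"
    proof
      show "?I - ?J \<subseteq> (\<lambda>A. sym_diff A K) ` ?J"
      proof
        fix A assume A: "A \<in> ?I - ?J"
        then have "sym_diff A K \<in> ?J"
          using saturated_sym_diff[of A D R K] K unfolding J by blast
        then show "A \<in> (\<lambda>A. sym_diff A K) ` ?J"
          by (intro image_eqI[where x = "sym_diff A K"]) blast+
      qed
      show "(\<lambda>A. sym_diff A K) ` ?J \<subseteq> ?I - ?J"
        using saturated_sym_diff[of _ D R K] K unfolding J by blast
    qed
    moreover have "inj_on (\<lambda>A. sym_diff A K) ?J"
      by (rule inj_onI) blast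
    ultimately have "card (?I - ?J) = card ?J"
      by (simp add: card_image)
    moreover have "?J \<subseteq> ?I" "finite ?I"
      using J assms by (auto simp: finite_saturated)
    ultimately have "card ?I = 2 * card ?J"
      by (metis card_Diff_subset card_mono finite_subset le_add_diff_inverse mult_2)
    then have "(2::nat) ^ num_components D R = 2 ^ Suc (num_components D (insert (x, y) R))"
      using cI cJ by simp
    then show ?thesis using False by (simp only: power_inject_exp) simp
  qed
qed

lemma num_components_eq_1_iff:
  assumes "D \<noteq> {}"
  shows "num_components D R = 1 \<longleftrightarrow> (\<forall>x\<in>D. \<forall>y\<in>D. (x, y) \<in> linked R)"
proof
  assume "num_components D R = 1"
  then obtain C where C: "D // linked R = {C}"
    unfolding num_components_def One_nat_def card_1_singleton_iff by blast
  have "linked R `` {x} = C" if "x \<in> D" for x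
    using C that by (auto simp: quotient_def)
  then show "\<forall>x\<in>D. \<forall>y\<in>D. (x, y) \<in> linked R"
    by blast
next
  assume *: "\<forall>x\<in>D. \<forall>y\<in>D. (x, y) \<in> linked R"
  obtain x where x: "x \<in> D" using assms by blast
  have "linked R `` {y} = linked R `` {x}" if "y \<in> D" for y
    using * x that by (meson equiv_class_eq equiv_linked)
  then have "(\<lambda>y. linked R `` {y}) ` D = {linked R `` {x}}"
    using x by blast
  then have "D // linked R = {linked R `` {x}}"
    unfolding quotient_def UNION_singleton_eq_range .
  then show "num_components D R = 1"
    by (simp add: num_components_def)
qed

lemma num_components_pos: "finite D \<Longrightarrow> D \<noteq> {} \<Longrightarrow> num_components D R > 0"
  by (auto simp: num_components_def card_gt_0_iff quotient_def)

lemma card_sym_diff_Int: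
  assumes "finite A" "finite B"
  shows "card (sym_diff A B \<inter> V) + 2 * card (A \<inter> B \<inter> V) = card (A \<inter> V) + card (B \<inter> V)"
proof -
  have "card (A \<inter> V) = card ((A - B) \<inter> V) + card (A \<inter> B \<inter> V)"
    using assms by (subst card_Un_disjoint[symmetric]) (auto intro: arg_cong[where f = card])
  moreover have "card (B \<inter> V) = card ((B - A) \<inter> V) + card (A \<inter> B \<inter> V)"
    using assms by (subst card_Un_disjoint[symmetric]) (auto intro: arg_cong[where f = card])
  moreover have "card (sym_diff A B \<inter> V) = card ((A - B) \<inter> V) + card ((B - A) \<inter> V)"
    using assms by (subst card_Un_disjoint[symmetric]) (auto intro: arg_cong[where f = card])
  ultimately show ?thesis by simp
qed

text \<open>
  Orthogonality of characters for the group of sets with symmetric difference: translation by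
  \<open>B\<close> permutes the summands and changes the sign of each.
\<close>

lemma sum_character_eq_0:
  assumes "\<And>A. A \<in> G \<Longrightarrow> finite A \<and> sym_diff A B \<in> G" "finite B" "odd (card (B \<inter> V))"
  shows "(\<Sum>A\<in>G. (- 1) ^ card (A \<inter> V)) = (0::int)"
proof -
  have "(\<Sum>A\<in>G. (- 1) ^ card (A \<inter> V)) = (\<Sum>A\<in>G. (- 1) ^ card (sym_diff A B \<inter> V) :: int)"
    by (rule sum.reindex_bij_witness[of _ "\<lambda>A. sym_diff A B" "\<lambda>A. sym_diff A B"])
       (simp_all only: sym_diff_cancel assms(1))
  also have "\<dots> = (\<Sum>A\<in>G. - ((- 1) ^ card (A \<inter> V)))"
  proof (rule sum.cong[OF refl])
    fix A assume "A \<in> G"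
    then have "card (sym_diff A B \<inter> V) + 2 * card (A \<inter> B \<inter> V) = card (A \<inter> V) + card (B \<inter> V)"
      using assms by (intro card_sym_diff_Int) auto
    then have "even (card (sym_diff A B \<inter> V)) \<longleftrightarrow> odd (card (A \<inter> V))"
      using assms(3) by presburger
    then show "(- 1) ^ card (sym_diff A B \<inter> V) = - ((- 1) ^ card (A \<inter> V) :: int)"
      by (cases "even (card (A \<inter> V))") auto
  qed
  finally show ?thesis by (simp add: sum_negf)
qed

lemma even_card_involution:
  assumes "finite W" "\<And>x. x \<in> W \<Longrightarrow> f x \<in> W \<and> f x \<noteq> x \<and> f (f x) = x"
  shows "even (card W)"
  using assms
proof (induction W rule: finite_psubset_induct)
  case (psubset W)
  show ?case
  proof (cases "W = {}")
    case False
    then obtain x where x: "x \<in> W" by blast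
    let ?W = "W - {x, f x}"
    have *: "f y \<in> ?W \<and> f y \<noteq> y \<and> f (f y) = y" if "y \<in> ?W" for y
    proof -
      have "f (f y) = y" "f (f x) = x" "f y \<in> W" "f y \<noteq> y" "y \<noteq> x" "y \<noteq> f x"
        using psubset.prems[of x] psubset.prems[of y] x that by auto
      moreover from this have "f y \<noteq> x" "f y \<noteq> f x" by auto
      ultimately show ?thesis by simp
    qed
    have "even (card ?W)"
      using x * by (intro psubset.IH) auto
    moreover have "card W = card ?W + card {x, f x}"
      using psubset.hyps psubset.prems[OF x] x
      by (subst card_Un_disjoint[symmetric]) (auto intro: arg_cong[where f = card])
    moreover have "card {x, f x} = 2"
      using psubset.prems[OF x] by auto
    ultimately show ?thesis by simp
  qed simp
qed

section \<open>Checkerboard colourings from Euler's formula\<close>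

lemma distinct_card_Int: "distinct v \<Longrightarrow> card (set v \<inter> W) = length (filter (\<lambda>x. x \<in> W) v)"
  by (metis Int_commute distinct_length_filter Collect_mem_eq)

text \<open>
  The combinatorial description of a graph on a closed surface: each list is the cyclic order of
  the arc ends at a vertex.  Degrees two and four are those of joints, crossings, holes and the
  outer circle; all that matters is that they are even.
\<close>

locale even_map =
  fixes vs :: "'d list list" and opp :: "'d \<Rightarrow> 'd"
  assumes distinct_darts: "distinct (concat vs)"
    and degrees: "v \<in> set vs \<Longrightarrow> (\<exists>a b. v = [a, b]) \<or> (\<exists>a b c d. v = [a, b, c, d])"
    and opp_closed: "x \<in> set (concat vs) \<Longrightarrow> opp x \<in> set (concat vs)"
    and opp_neq: "x \<in> set (concat vs) \<Longrightarrow> opp x \<noteq> x"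
    and opp_opp: "x \<in> set (concat vs) \<Longrightarrow> opp (opp x) = x"
begin

definition D :: "'d set" where "D = set (concat vs)"
definition edges :: "('d \<times> 'd) set" where "edges = {(x, opp x) | x. x \<in> D}"
definition rot :: "('d \<times> 'd) set" where "rot = (\<Union>v \<in> set vs. set (zip v (rotate1 v)))"

lemma opp: "x \<in> D \<Longrightarrow> opp x \<in> D \<and> opp x \<noteq> x \<and> opp (opp x) = x"
  by (simp only: D_def opp_closed opp_neq opp_opp simp_thms)

lemma finite_D [simp]: "finite D"
  by (simp add: D_def)

lemma D_UN: "D = \<Union> (set ` set vs)"
  by (auto simp: D_def)

lemma vertex_subset: "v \<in> set vs \<Longrightarrow> set v \<subseteq> D"
  by (auto simp: D_def)

lemma vertex_nonempty: "v \<in> set vs \<Longrightarrow> set v \<noteq> {}"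
  using degrees by fastforce

lemma vertex_distinct: "v \<in> set vs \<Longrightarrow> distinct v"
  using distinct_darts by (simp add: distinct_concat_iff)

lemma vertex_disjoint: "v \<in> set vs \<Longrightarrow> w \<in> set vs \<Longrightarrow> x \<in> set v \<Longrightarrow> x \<in> set w \<Longrightarrow> v = w"
  using distinct_darts by (auto simp: distinct_concat_iff)

lemma edges_subset: "edges \<subseteq> D \<times> D"
  using opp by (auto simp: edges_def)

lemma set_zip_rotate1: "(x, y) \<in> set (zip v (rotate1 v)) \<Longrightarrow> x \<in> set v \<and> y \<in> set v"
  by (metis set_rotate1 set_zip_leftD set_zip_rightD)

lemma rot_subset: "rot \<subseteq> D \<times> D"
  using set_zip_rotate1 by (fastforce simp: rot_def D_def)

lemma saturated_finite: "A \<in> saturated D R \<Longrightarrow> finite A"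
  using finite_subset[OF _ finite_D] by (auto simp: saturated_def)

lemma edge_saturated:
  assumes "x \<in> D"
  shows "{x, opp x} \<in> saturated D edges"
proof -
  have "y \<in> {x, opp x} \<longleftrightarrow> opp y \<in> {x, opp x}" if "y \<in> D" for y
    using opp[OF assms] opp[OF that] by (metis insert_iff singletonD)
  then show ?thesis
    using opp[OF assms] assms by (auto simp: saturated_def edges_def)
qed

lemma rot_vertex_iff:
  assumes "v \<in> set vs" "(x, y) \<in> rot"
  shows "x \<in> set v \<longleftrightarrow> y \<in> set v"
proof -
  obtain w where w: "w \<in> set vs" "(x, y) \<in> set (zip w (rotate1 w))"
    using assms(2) by (auto simp: rot_def)
  then have "x \<in> set w" "y \<in> set w"
    using set_zip_rotate1 by fast+
  then show ?thesis
    using vertex_disjoint[OF assms(1) w(1)] by blast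
qed

lemma num_vertices: "num_components D rot = length vs"
proof -
  have "num_components D rot = card (set ` set vs)"
  proof (rule num_components_partition)
    show "\<Union> (set ` set vs) = D"
      by (simp only: D_UN)
    show "C \<noteq> {}" if "C \<in> set ` set vs" for C
      using that vertex_nonempty by blast
    show "x \<in> C \<longleftrightarrow> y \<in> C" if "C \<in> set ` set vs" "(x, y) \<in> rot" for C x y
      using that rot_vertex_iff by blast
    show "(x, y) \<in> linked rot" if C: "C \<in> set ` set vs" "x \<in> C" "y \<in> C" for C x y
    proof -
      obtain v where v: "v \<in> set vs" "C = set v" using C by blast
      then have sub: "set (zip v (rotate1 v)) \<subseteq> rot"
        by (auto simp: rot_def)
      obtain a where a: "\<forall>z\<in>set v. (a, z) \<in> linked rot"
      proof (cases "\<exists>a b. v = [a, b]")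
        case True
        then obtain a b where ab: "v = [a, b]" by blast
        then have "(a, b) \<in> rot" using sub by simp
        then have "(a, b) \<in> linked rot" by (rule linked_step)
        then show thesis using that[of a] ab by simp
      next
        case False
        then obtain a b c d where abcd: "v = [a, b, c, d]"
          using degrees[OF v(1)] by blast
        then have "(a, b) \<in> rot" "(b, c) \<in> rot" "(c, d) \<in> rot" using sub by simp_all
        then have "(a, b) \<in> linked rot" "(b, c) \<in> linked rot" "(c, d) \<in> linked rot"
          by (simp_all only: linked_step)
        then have "(a, b) \<in> linked rot \<and> (a, c) \<in> linked rot \<and> (a, d) \<in> linked rot"
          by (meson linked_trans)
        then show thesis using that[of a] abcd by simp
      qed
      then show ?thesis
        using C v linked_sym linked_trans by metis
    qed
  qed
  also have "\<dots> = card (set vs)"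
    by (intro card_image inj_onI) (metis all_not_in_conv vertex_disjoint vertex_nonempty)
  also have "\<dots> = length vs"
  proof (rule distinct_card)
    have "removeAll [] vs = vs"
      using vertex_nonempty by (intro removeAll_id) auto
    then show "distinct vs"
      using distinct_darts by (simp add: distinct_concat_iff)
  qed
  finally show ?thesis .
qed

lemma num_edges: "num_components D edges = card ((\<lambda>x. {x, opp x}) ` D)"
proof (rule num_components_partition)
  show "\<Union> ((\<lambda>x. {x, opp x}) ` D) = D"
    using opp by blast
  show "(x, y) \<in> linked edges" if C: "C \<in> (\<lambda>x. {x, opp x}) ` D" "x \<in> C" "y \<in> C" for C x y
  proof -
    obtain z where z: "z \<in> D" "C = {z, opp z}" using C by blast
    then have "(z, opp z) \<in> linked edges"
      by (intro linked_step) (auto simp: edges_def)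
    then show ?thesis
      using C z linked_sym[of z "opp z" edges] by auto
  qed
  show "x \<in> C \<longleftrightarrow> y \<in> C" if "C \<in> (\<lambda>x. {x, opp x}) ` D" "(x, y) \<in> edges" for C x y
    using that edge_saturated saturatedD by fast
qed auto

text \<open>
  A set of edges is represented by the set of the ends of its edges.  These are the cycles
  modulo 2: the sets of edges that have an even number of ends at every vertex.
\<close>

definition cycle_space :: "'d set set" where
  "cycle_space = {V \<in> saturated D edges. \<forall>v\<in>set vs. even (card (set v \<inter> V))}"

lemma finite_cycle_space: "finite cycle_space"
  by (simp add: cycle_space_def finite_saturated)

lemma saturated_rot_decompose:
  assumes "A \<in> saturated D rot"
  obtains S where "S \<subseteq> set vs" "A = \<Union> (set ` S)"
proof -
  have const: "x \<in> A \<longleftrightarrow> y \<in> A" if v: "v \<in> set vs" "x \<in> set v" "y \<in> set v" for v x y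
  proof -
    have R: "\<And>x y. (x, y) \<in> set (zip v (rotate1 v)) \<Longrightarrow> x \<in> A \<longleftrightarrow> y \<in> A"
      using assms v by (auto simp: saturated_def rot_def)
    show ?thesis
    proof (cases "\<exists>a b. v = [a, b]")
      case True
      then obtain a b where ab: "v = [a, b]" by blast
      show ?thesis using R[of a b] v ab by auto
    next
      case False
      then obtain a b c d where abcd: "v = [a, b, c, d]"
        using degrees[OF v(1)] by blast
      show ?thesis using R[of a b] R[of b c] R[of c d] v abcd by auto
    qed
  qed
  show thesis
  proof
    show "{v \<in> set vs. set v \<subseteq> A} \<subseteq> set vs" by blast
    have "A \<subseteq> D" using assms by (simp add: saturated_def)
    show "A = \<Union> (set ` {v \<in> set vs. set v \<subseteq> A})"
    proof
      show "A \<subseteq> \<Union> (set ` {v \<in> set vs. set v \<subseteq> A})"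
      proof
        fix x assume x: "x \<in> A"
        then obtain v where v: "v \<in> set vs" "x \<in> set v" using \<open>A \<subseteq> D\<close> by (auto simp: D_def)
        then have "set v \<subseteq> A" using const[OF v(1)] x by blast
        then show "x \<in> \<Union> (set ` {v \<in> set vs. set v \<subseteq> A})" using v by blast
      qed
    qed blast
  qed
qed

lemma cycle_space_even:
  assumes "A \<in> saturated D rot" "V \<in> cycle_space"
  shows "even (card (A \<inter> V))"
proof -
  obtain S where S: "S \<subseteq> set vs" "A = \<Union> (set ` S)"
    using saturated_rot_decompose[OF assms(1)] .
  have "A \<inter> V = (\<Union>v\<in>S. set v \<inter> V)" using S by blast
  also have "card \<dots> = (\<Sum>v\<in>S. card (set v \<inter> V))"
  proof (rule card_UN_disjoint)
    show "finite S" using S finite_subset by blast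
    show "\<forall>v\<in>S. \<forall>w\<in>S. v \<noteq> w \<longrightarrow> (set v \<inter> V) \<inter> (set w \<inter> V) = {}"
      using vertex_disjoint S(1) by blast
  qed auto
  also have "even \<dots>"
    using assms(2) S(1) by (intro dvd_sum) (auto simp: cycle_space_def)
  finally show ?thesis .
qed

text \<open>
  For a set \<open>A\<close> of vertices and a set \<open>V\<close> of edges, the parity of \<open>A \<inter> V\<close> is the pairing of \<open>V\<close> with
  the cut defined by \<open>A\<close>.  This lemma and the next evaluate the double sum of \<open>(-1)\<^sup>|\<^sup>A\<^sup>\<inter>\<^sup>V\<^sup>|\<close> in the two
  possible orders.
\<close>

lemma sum_over_cuts:
  assumes "V \<in> saturated D edges"
  shows "(\<Sum>A\<in>saturated D rot. (- 1) ^ card (A \<inter> V))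
           = (if V \<in> cycle_space then int (card (saturated D rot)) else 0)"
proof (cases "V \<in> cycle_space")
  case True
  then show ?thesis using cycle_space_even by simp
next
  case False
  then obtain v where v: "v \<in> set vs" "odd (card (set v \<inter> V))"
    using assms by (auto simp: cycle_space_def)
  have "set v \<in> saturated D rot"
    using rot_vertex_iff[OF v(1)] vertex_subset[OF v(1)] by (auto simp: saturated_def)
  then have "(\<Sum>A\<in>saturated D rot. (- 1) ^ card (A \<inter> V)) = (0::int)"
    using v by (intro sum_character_eq_0[where B = "set v"])
      (simp_all add: saturated_sym_diff saturated_finite)
  then show ?thesis using False by simp
qed

lemma sum_over_edge_sets:
  assumes "A \<in> saturated D rot"
  shows "(\<Sum>V\<in>saturated D edges. (- 1) ^ card (V \<inter> A))
           = (if A \<in> saturated D (edges \<union> rot) then int (card (saturated D edges)) else 0)"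
proof (cases "A \<in> saturated D (edges \<union> rot)")
  case True
  have "even (card (V \<inter> A))" if "V \<in> saturated D edges" for V
  proof (rule even_card_involution[where f = opp])
    have "V \<inter> A \<subseteq> D" using that by (auto simp: saturated_def)
    then show "finite (V \<inter> A)" using finite_subset finite_D by blast
    show "opp x \<in> V \<inter> A \<and> opp x \<noteq> x \<and> opp (opp x) = x" if x: "x \<in> V \<inter> A" for x
    proof -
      have "x \<in> D" using x \<open>V \<inter> A \<subseteq> D\<close> by blast
      moreover have "(x, opp x) \<in> edges" using \<open>x \<in> D\<close> by (auto simp: edges_def)
      ultimately show ?thesis
        using x opp saturatedD[OF True, of x "opp x"] saturatedD[OF \<open>V \<in> saturated D edges\<close>, of x "opp x"]
        by blast
    qed
  qed
  then show ?thesis using True by simp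
next
  case False
  then obtain y where y: "y \<in> D" "y \<in> A \<longleftrightarrow> opp y \<notin> A"
    using assms by (auto simp: saturated_def edges_def)
  define x where "x = (if y \<in> A then y else opp y)"
  have x: "x \<in> D" "x \<in> A" "opp x \<notin> A"
    using y opp[of y] by (auto simp: x_def)
  have "{x, opp x} \<in> saturated D edges"
    by (rule edge_saturated[OF x(1)])
  moreover have "{x, opp x} \<inter> A = {x}"
    using x by auto
  ultimately have "(\<Sum>V\<in>saturated D edges. (- 1) ^ card (V \<inter> A)) = (0::int)"
    by (intro sum_character_eq_0[where B = "{x, opp x}"])
      (simp_all add: saturated_sym_diff saturated_finite)
  then show ?thesis using False by simp
qed

text \<open>
  The cycles are the orthogonal complement of the cuts.  This is the resulting dimension
  formula, number of edges minus number of vertices plus number of components, in exponential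
  form.
\<close>

lemma card_cycle_space:
  "card (saturated D rot) * card cycle_space
     = card (saturated D (edges \<union> rot)) * card (saturated D edges)"
proof -
  let ?N = "saturated D rot" and ?E = "saturated D edges"
  have "int (card ?N * card cycle_space) = (\<Sum>V\<in>?E. if V \<in> cycle_space then int (card ?N) else 0)"
    by (subst sum.inter_filter[symmetric])
       (auto simp: finite_saturated cycle_space_def)
  also have "\<dots> = (\<Sum>V\<in>?E. \<Sum>A\<in>?N. (- 1) ^ card (A \<inter> V))"
    by (rule sum.cong[OF refl]) (simp add: sum_over_cuts)
  also have "\<dots> = (\<Sum>A\<in>?N. \<Sum>V\<in>?E. (- 1) ^ card (V \<inter> A))"
    by (subst sum.swap) (simp only: Int_commute)
  also have "\<dots> = (\<Sum>A\<in>?N. if A \<in> saturated D (edges \<union> rot) then int (card ?E) else 0)"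
    by (rule sum.cong[OF refl]) (simp add: sum_over_edge_sets)
  also have "\<dots> = int (card {A \<in> ?N. A \<in> saturated D (edges \<union> rot)} * card ?E)"
    by (subst sum.inter_filter[symmetric]) (auto simp: finite_saturated)
  also have "{A \<in> ?N. A \<in> saturated D (edges \<union> rot)} = saturated D (edges \<union> rot)"
    by (auto simp: saturated_def)
  finally show ?thesis by (simp only: of_nat_eq_iff)
qed

text \<open>
  A union \<open>h\<close> of orbits of the face permutation is a set of faces; \<open>x\<close> and \<open>opp x\<close> belong to the
  faces on the two sides of an edge.  So this is the set of the edges with exactly one side in \<open>h\<close>.
\<close>

definition boundary :: "'d set \<Rightarrow> 'd set" where
  "boundary h = {x \<in> D. x \<in> h \<longleftrightarrow> opp x \<notin> h}"

text \<open>
  Rank plus nullity for the boundary map: its fibres are cosets of the kernel, and a set of faces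
  without boundary is a union of components of the graph.
\<close>

lemma card_boundaries:
  "card (saturated D (edges O rot))
     = card (boundary ` saturated D (edges O rot)) * card (saturated D (edges \<union> rot))"
proof -
  let ?F = "saturated D (edges O rot)" and ?K = "saturated D (edges \<union> rot)"
  have K: "?K = {A \<in> ?F. boundary A = {}}"
  proof (rule Set.set_eqI)
    fix A
    have rot_iff: "(\<forall>(x, y)\<in>rot. x \<in> A \<longleftrightarrow> y \<in> A) \<longleftrightarrow> (\<forall>(x, y)\<in>edges O rot. x \<in> A \<longleftrightarrow> y \<in> A)"
      if E: "\<forall>x\<in>D. x \<in> A \<longleftrightarrow> opp x \<in> A"
    proof
      show "\<forall>(x, y)\<in>edges O rot. x \<in> A \<longleftrightarrow> y \<in> A" if "\<forall>(x, y)\<in>rot. x \<in> A \<longleftrightarrow> y \<in> A"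
        using that E by (auto simp: edges_def)
      show "\<forall>(x, y)\<in>rot. x \<in> A \<longleftrightarrow> y \<in> A" if *: "\<forall>(x, y)\<in>edges O rot. x \<in> A \<longleftrightarrow> y \<in> A"
      proof clarify
        fix x y assume xy: "(x, y) \<in> rot"
        then have "x \<in> D" using rot_subset by blast
        then have "(opp x, x) \<in> edges" using opp[of x] by (force simp: edges_def)
        then have "opp x \<in> A \<longleftrightarrow> y \<in> A" using * xy by blast
        then show "x \<in> A \<longleftrightarrow> y \<in> A" using E \<open>x \<in> D\<close> by blast
      qed
    qed
    show "A \<in> ?K \<longleftrightarrow> A \<in> {A \<in> ?F. boundary A = {}}"
    proof (cases "\<forall>x\<in>D. x \<in> A \<longleftrightarrow> opp x \<in> A")
      case True
      have "boundary A = {}" using True by (auto simp: boundary_def)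
      moreover have "\<forall>(x, y)\<in>edges. x \<in> A \<longleftrightarrow> y \<in> A" using True by (auto simp: edges_def)
      ultimately show ?thesis using rot_iff[OF True] by (auto simp: saturated_def)
    next
      case False
      then have "boundary A \<noteq> {}" by (auto simp: boundary_def)
      moreover have "A \<notin> ?K" using False by (auto simp: saturated_def edges_def)
      ultimately show ?thesis by simp
    qed
  qed
  have fib: "card {B \<in> ?F. boundary B = boundary A} = card ?K" if A: "A \<in> ?F" for A
  proof (rule bij_betw_same_card[symmetric], rule bij_betw_byWitness[where f' = "\<lambda>B. sym_diff B A"])
    show "\<forall>B\<in>?K. sym_diff (sym_diff B A) A = B" "\<forall>B\<in>{B \<in> ?F. boundary B = boundary A}. sym_diff (sym_diff B A) A = B"
      by blast+
    have bd: "boundary (sym_diff B A) = sym_diff (boundary B) (boundary A)" for B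
      by (auto simp: boundary_def)
    show "(\<lambda>B. sym_diff B A) ` ?K \<subseteq> {B \<in> ?F. boundary B = boundary A}"
      using saturated_sym_diff[of _ D "edges O rot", OF _ A] unfolding K by (auto simp only: bd)
    show "(\<lambda>B. sym_diff B A) ` {B \<in> ?F. boundary B = boundary A} \<subseteq> ?K"
      using saturated_sym_diff[of _ D "edges O rot", OF _ A] unfolding K by (auto simp only: bd)
  qed
  have "card ?F = (\<Sum>W\<in>boundary ` ?F. card {B \<in> ?F. boundary B = W})"
    using sum.image_gen[of ?F "\<lambda>_. 1::nat" boundary] by (simp add: finite_saturated)
  also have "\<dots> = (\<Sum>W\<in>boundary ` ?F. card ?K)"
    by (rule sum.cong[OF refl]) (use fib in auto)
  finally show ?thesis by simp
qed

lemma boundary_rot: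
  assumes "h \<in> saturated D (edges O rot)" "(x, y) \<in> rot"
  shows "x \<in> boundary h \<longleftrightarrow> (x \<in> h) \<noteq> (y \<in> h)"
proof -
  have "x \<in> D" using assms(2) rot_subset by blast
  then have "(opp x, x) \<in> edges" using opp[of x] by (force simp: edges_def)
  then have "(opp x, y) \<in> edges O rot" using assms(2) by blast
  then have "opp x \<in> h \<longleftrightarrow> y \<in> h" using assms(1) by (auto simp: saturated_def)
  then show ?thesis using \<open>x \<in> D\<close> by (auto simp: boundary_def)
qed

text \<open>
  Around a vertex the consecutive faces change an even number of times between \<open>h\<close> and its
  complement.
\<close>

lemma boundary_in_cycle_space:
  assumes "h \<in> saturated D (edges O rot)"
  shows "boundary h \<in> cycle_space"
proof -
  have "boundary h \<in> saturated D edges"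
    using opp by (auto simp: saturated_def boundary_def edges_def)
  moreover have "even (card (set v \<inter> boundary h))" if v: "v \<in> set vs" for v
  proof -
    have R: "\<And>x y. (x, y) \<in> set (zip v (rotate1 v)) \<Longrightarrow> x \<in> boundary h \<longleftrightarrow> (x \<in> h) \<noteq> (y \<in> h)"
      using boundary_rot[OF assms] v by (auto simp: rot_def)
    show ?thesis
    proof (cases "\<exists>a b. v = [a, b]")
      case True
      then obtain a b where ab: "v = [a, b]" by blast
      show ?thesis
        using distinct_card_Int[OF vertex_distinct[OF v], of "boundary h"] R[of a b] R[of b a] ab by simp
    next
      case False
      then obtain a b c d where abcd: "v = [a, b, c, d]"
        using degrees[OF v(1)] by blast
      show ?thesis
        using distinct_card_Int[OF vertex_distinct[OF v], of "boundary h"] R[of a b] R[of b c] R[of c d] R[of d a] abcd by simp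
    qed
  qed
  ultimately show ?thesis by (simp add: cycle_space_def)
qed

text \<open>
  By Euler's formula the dimensions of the spaces of boundaries and of cycles coincide, so every
  cycle is a boundary.  Since all degrees are even, the set of all edges is a cycle; the faces
  whose boundary it is are the black ones.
\<close>

theorem checkerboard_colouring:
  assumes euler: "length vs + num_components D (edges O rot)
      = card ((\<lambda>x. {x, opp x}) ` D) + 2 * num_components D (edges \<union> rot)"
  obtains c where "\<And>x. x \<in> D \<Longrightarrow> c (opp x) = (\<not> c x)" "\<And>x y. (x, y) \<in> rot \<Longrightarrow> c y = (\<not> c x)"
proof -
  let ?B = "boundary ` saturated D (edges O rot)"
  let ?V = "length vs" and ?E = "card ((\<lambda>x. {x, opp x}) ` D)"
    and ?F = "num_components D (edges O rot)" and ?C = "num_components D (edges \<union> rot)"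
  have V: "card (saturated D rot) = 2 ^ ?V"
    by (simp add: card_saturated rot_subset num_vertices)
  have E: "card (saturated D edges) = 2 ^ ?E"
    by (simp add: card_saturated edges_subset num_edges)
  have C: "card (saturated D (edges \<union> rot)) = 2 ^ ?C"
    by (simp add: card_saturated edges_subset rot_subset)
  have F: "card (saturated D (edges O rot)) = 2 ^ ?F"
    using edges_subset rot_subset by (intro card_saturated) auto
  have "2 ^ (?V + ?F) * card cycle_space = 2 ^ ?F * (2 ^ ?V * card cycle_space)"
    by (simp add: power_add)
  also have "\<dots> = (2 ^ ?C * card ?B) * (2 ^ ?C * 2 ^ ?E)"
    using card_cycle_space card_boundaries unfolding V E C F by (simp add: mult.commute)
  also have "\<dots> = 2 ^ (?E + 2 * ?C) * card ?B"
    by (simp add: power_add mult_2)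
  finally have "card cycle_space = card ?B"
    unfolding euler by simp
  moreover have "?B \<subseteq> cycle_space"
    using boundary_in_cycle_space by blast
  ultimately have "?B = cycle_space"
    using finite_cycle_space by (intro card_subset_eq) auto
  moreover have "D \<in> cycle_space"
  proof -
    have "D \<in> saturated D edges" using edges_subset by (auto simp: saturated_def)
    moreover have "even (card (set v \<inter> D))" if v: "v \<in> set vs" for v
    proof -
      have "set v \<inter> D = set v" using vertex_subset[OF v] by blast
      then show ?thesis using distinct_card[OF vertex_distinct[OF v]] degrees[OF v] by auto
    qed
    ultimately show ?thesis by (simp add: cycle_space_def)
  qed
  ultimately obtain h where h: "h \<in> saturated D (edges O rot)" "boundary h = D" by (metis imageE)
  show thesis
  proof
    show "(opp x \<in> h) = (\<not> x \<in> h)" if "x \<in> D" for x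
      using that h(2) by (auto simp: boundary_def)
    show "(y \<in> h) = (\<not> x \<in> h)" if "(x, y) \<in> rot" for x y
      using boundary_rot[OF h(1) that] h(2) that rot_subset by auto
  qed
qed

end

section \<open>Strands and smoothings in a coloured diagram\<close>

type_synonym 'd quad = "'d \<times> 'd \<times> 'd \<times> 'd"

text \<open>
  The two ways to join four ends, given in cyclic order, by two disjoint strands.  They serve for
  the splittings of a crossing, for the fundamental tangles in a hole and for the closures.
\<close>

fun quad_arcs :: "bool \<Rightarrow> 'd quad \<Rightarrow> ('d \<times> 'd) set" where
  "quad_arcs s (a, b, c, d) = (if s then {(a, b), (c, d)} else {(b, c), (d, a)})"

fun quad_darts :: "'d quad \<Rightarrow> 'd list" where
  "quad_darts (a, b, c, d) = [a, b, c, d]"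

fun alternating :: "('d \<Rightarrow> bool) \<Rightarrow> 'd quad \<Rightarrow> bool" where
  "alternating \<kappa> (a, b, c, d) \<longleftrightarrow> \<kappa> a \<noteq> \<kappa> b \<and> \<kappa> b \<noteq> \<kappa> c \<and> \<kappa> c \<noteq> \<kappa> d"

definition quads_arcs :: "bool list \<Rightarrow> 'd quad list \<Rightarrow> ('d \<times> 'd) set" where
  "quads_arcs bs qs = (\<Union>(b, q) \<in> set (zip bs qs). quad_arcs b q)"

definition quads_darts :: "'d quad list \<Rightarrow> 'd set" where
  "quads_darts qs = set (concat (map quad_darts qs))"

lemma quads_simps [simp]:
  "quads_arcs [] [] = {}" "quads_arcs (b # bs) (q # qs) = quad_arcs b q \<union> quads_arcs bs qs"
  "quads_darts [] = {}" "quads_darts (q # qs) = set (quad_darts q) \<union> quads_darts qs"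
  by (auto simp: quads_arcs_def quads_darts_def)

text \<open>
  A perfect matching of \<open>A\<close> in which partners have different colours; each pair is listed in one
  direction.
\<close>

definition matching :: "('d \<Rightarrow> bool) \<Rightarrow> 'd set \<Rightarrow> ('d \<times> 'd) set \<Rightarrow> bool" where
  "matching \<kappa> A M \<longleftrightarrow>
     Domain (M \<union> M\<inverse>) = A \<and> single_valued (M \<union> M\<inverse>) \<and> (\<forall>(x, y) \<in> M. \<kappa> x \<noteq> \<kappa> y)"

lemma matching_subset: "matching \<kappa> A M \<Longrightarrow> M \<subseteq> A \<times> A"
  by (auto simp: matching_def)

lemma matching_empty: "matching \<kappa> {} {}"
  by (auto simp: matching_def single_valued_def)

lemma matching_Un:
  assumes "matching \<kappa> A M" "matching \<kappa> B N" "A \<inter> B = {}"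
  shows "matching \<kappa> (A \<union> B) (M \<union> N)"
proof -
  have "(M \<union> N) \<union> (M \<union> N)\<inverse> = (M \<union> M\<inverse>) \<union> (N \<union> N\<inverse>)" by blast
  moreover have "single_valued ((M \<union> M\<inverse>) \<union> (N \<union> N\<inverse>))"
    using assms unfolding matching_def single_valued_def by blast
  ultimately show ?thesis
    using assms unfolding matching_def by (auto simp only: Domain_Un_eq)
qed

lemma matching_pair: "a \<noteq> b \<Longrightarrow> \<kappa> a \<noteq> \<kappa> b \<Longrightarrow> matching \<kappa> {a, b} {(a, b)}"
  by (auto simp: matching_def single_valued_def)

lemma matching_quad:
  assumes "distinct (quad_darts q)" "alternating \<kappa> q"
  shows "matching \<kappa> (set (quad_darts q)) (quad_arcs s q)"
proof -
  obtain a b c d where q: "q = (a, b, c, d)" by (cases q)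
  show ?thesis
  proof (cases s)
    case True
    have "matching \<kappa> ({a, b} \<union> {c, d}) ({(a, b)} \<union> {(c, d)})"
      using assms unfolding q by (intro matching_Un matching_pair) auto
    moreover have "{a, b} \<union> {c, d} = {a, b, c, d}" "{(a, b)} \<union> {(c, d)} = {(a, b), (c, d)}"
      by blast+
    ultimately show ?thesis using True q by simp
  next
    case False
    have "matching \<kappa> ({b, c} \<union> {d, a}) ({(b, c)} \<union> {(d, a)})"
      using assms unfolding q by (intro matching_Un matching_pair) auto
    moreover have "{b, c} \<union> {d, a} = {a, b, c, d}" "{(b, c)} \<union> {(d, a)} = {(b, c), (d, a)}"
      by blast+
    ultimately show ?thesis using False q by simp
  qed
qed

lemma matching_quads:
  assumes "length bs = length qs" "distinct (concat (map quad_darts qs))"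
    and "\<And>q. q \<in> set qs \<Longrightarrow> alternating \<kappa> q"
  shows "matching \<kappa> (quads_darts qs) (quads_arcs bs qs)"
  using assms
proof (induction bs qs rule: list_induct2)
  case Nil
  then show ?case by (simp add: matching_empty)
next
  case (Cons b bs q qs)
  have "matching \<kappa> (set (quad_darts q)) (quad_arcs b q)"
    using Cons.prems by (intro matching_quad) auto
  moreover have "matching \<kappa> (quads_darts qs) (quads_arcs bs qs)"
    using Cons.prems by (intro Cons.IH) auto
  moreover have "set (quad_darts q) \<inter> quads_darts qs = {}"
    using Cons.prems by (auto simp: quads_darts_def)
  ultimately show ?case
    by (simp add: matching_Un)
qed

lemma matching_joints:
  assumes "distinct (concat (map (\<lambda>(a, b). [a, b]) js))" "\<And>a b. (a, b) \<in> set js \<Longrightarrow> \<kappa> a \<noteq> \<kappa> b"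
  shows "matching \<kappa> (set (concat (map (\<lambda>(a, b). [a, b]) js))) (set js)"
  using assms
proof (induction js)
  case Nil
  then show ?case by (simp add: matching_empty)
next
  case (Cons j js)
  obtain a b where j: "j = (a, b)" by (cases j)
  have "matching \<kappa> {a, b} {j}"
    using Cons.prems unfolding j by (intro matching_pair) auto
  moreover have "matching \<kappa> (set (concat (map (\<lambda>(a, b). [a, b]) js))) (set js)"
    using Cons.prems by (intro Cons.IH) auto
  moreover have "{a, b} \<inter> set (concat (map (\<lambda>(a, b). [a, b]) js)) = {}"
    using Cons.prems by (auto simp: j)
  ultimately have "matching \<kappa> ({a, b} \<union> set (concat (map (\<lambda>(a, b). [a, b]) js))) ({j} \<union> set js)"
    by (rule matching_Un)
  then show ?case by (simp add: j)
qed

text \<open>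
  The arcs \<open>E\<close> match ends of different colours.  Together with a second coloured matching they
  form a family of curves; ends without a partner in the second matching are the ends of strands.
\<close>

locale coloured_arcs =
  fixes D :: "'d set" and opp :: "'d \<Rightarrow> 'd" and \<kappa> :: "'d \<Rightarrow> bool"
  assumes finite_D: "finite D"
    and opp: "x \<in> D \<Longrightarrow> opp x \<in> D" "x \<in> D \<Longrightarrow> opp (opp x) = x" "x \<in> D \<Longrightarrow> \<kappa> (opp x) \<noteq> \<kappa> x"
begin

definition E :: "('d \<times> 'd) set" where "E = {(x, opp x) | x. x \<in> D}"

text \<open>
  Walk along the curve from \<open>x\<close>.  Every arc is traversed from an end coloured like \<open>x\<close> to an end of
  the other colour, every matched pair in the opposite sense.  As no two steps lead to the same
  point, the component of \<open>x\<close> consists of the points that the walk reaches.  Another strand end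
  coloured like \<open>x\<close> cannot be reached: no arc leads to it because of its colour, and it has no
  partner.
\<close>

lemma equally_coloured_ends_not_linked:
  assumes M: "matching \<kappa> A M"
    and ends: "x \<in> D - A" "y \<in> D - A" "x \<noteq> y" "\<kappa> x = \<kappa> y"
  shows "(x, y) \<notin> linked (E \<union> M)"
proof
  assume xy: "(x, y) \<in> linked (E \<union> M)"
  \<comment> \<open>the steps of the directed walk\<close>
  define S where "S = {(u, opp u) | u. u \<in> D \<and> \<kappa> u = \<kappa> x} \<union> {(u, v). (u, v) \<in> M \<union> M\<inverse> \<and> \<kappa> u \<noteq> \<kappa> x}"
  define K where "K = S\<^sup>* `` {x}"
  have sv: "v = w" if "(u, v) \<in> M \<union> M\<inverse>" "(u, w) \<in> M \<union> M\<inverse>" for u v w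
    using that M unfolding matching_def by (meson single_valuedD)
  have dom: "u \<in> A" "v \<in> A" "\<kappa> u \<noteq> \<kappa> v" if "(u, v) \<in> M \<union> M\<inverse>" for u v
    using that M unfolding matching_def by blast+
  have inj: "u = u'" if "(u, v) \<in> S" "(u', v) \<in> S" for u u' v
  proof (cases "\<kappa> v = \<kappa> x")
    case True
    then have "(u, v) \<in> M \<union> M\<inverse>" "(u', v) \<in> M \<union> M\<inverse>"
      using that opp(3) by (auto simp: S_def)
    then show ?thesis using sv[of v u u'] by blast
  next
    case False
    then have "u \<in> D" "u' \<in> D" "v = opp u" "v = opp u'"
      using that dom(3) by (auto simp: S_def)
    then show ?thesis using opp(2) by metis
  qed
  have no_pred: "(u, z) \<notin> S" if "z \<in> D - A" "\<kappa> z = \<kappa> x" for u z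
    using that opp(3) dom(2) by (auto simp: S_def)
  have step: "u \<in> K \<longleftrightarrow> v \<in> K" if uv: "(u, v) \<in> S" for u v
  proof
    show "v \<in> K" if "u \<in> K"
      using that uv unfolding K_def by (auto intro: rtrancl.rtrancl_into_rtrancl)
    show "u \<in> K" if "v \<in> K"
    proof -
      have "(x, v) \<in> S\<^sup>*" using that by (simp add: K_def)
      moreover have "v \<noteq> x" using no_pred ends(1) uv by blast
      ultimately obtain u' where "(x, u') \<in> S\<^sup>*" "(u', v) \<in> S" by (metis rtranclE)
      then show ?thesis using inj[OF uv] by (auto simp: K_def)
    qed
  qed
  have "(u, v) \<in> S \<or> (v, u) \<in> S" if "(u, v) \<in> E \<union> M" for u v
    using that
  proof
    assume "(u, v) \<in> E"
    then have u: "u \<in> D" "v = opp u" by (auto simp: E_def)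
    show ?thesis
    proof (cases "\<kappa> u = \<kappa> x")
      case False
      then have "\<kappa> v = \<kappa> x" "v \<in> D" "u = opp v" using u opp[of u] by auto
      then show ?thesis by (auto simp: S_def)
    qed (use u in \<open>auto simp: S_def\<close>)
  next
    assume "(u, v) \<in> M"
    then show ?thesis using dom(3)[of u v] by (auto simp: S_def)
  qed
  then have "(x \<in> K) = (y \<in> K)"
    by (intro linked_invariant[OF xy]) (use step in blast)
  then have "(x, y) \<in> S\<^sup>*" by (simp add: K_def)
  then obtain u where "(u, y) \<in> S" using ends(3) by (metis rtranclE)
  then show False using no_pred ends by metis
qed

text \<open>
  A component with the single strand end \<open>x\<close> would have an even number of points, because the
  arcs match all of them, and an odd number, because the second matching leaves out only \<open>x\<close>.
\<close>

lemma end_linked_to_end: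
  assumes M: "matching \<kappa> A M" and "A \<subseteq> D" and x: "x \<in> D - A"
  obtains y where "y \<in> D - A" "y \<noteq> x" "(x, y) \<in> linked (E \<union> M)"
proof (rule ccontr)
  assume neg: "\<not> thesis"
  define K where "K = linked (E \<union> M) `` {x}"
  have sub: "E \<union> M \<subseteq> D \<times> D"
    using matching_subset[OF M] \<open>A \<subseteq> D\<close> opp(1) by (auto simp: E_def)
  have "K \<subseteq> D"
    using linked_closed[OF sub] x unfolding K_def by blast
  then have fin: "finite K" using finite_D finite_subset by blast
  have closed: "v \<in> K" if "u \<in> K" "(u, v) \<in> E \<union> M \<or> (v, u) \<in> E \<union> M" for u v
    using that unfolding K_def by (auto intro: rtrancl.rtrancl_into_rtrancl)
  have "even (card K)"
  proof (rule even_card_involution[OF fin, where f = opp])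
    fix u assume u: "u \<in> K"
    then have "(u, opp u) \<in> E" using \<open>K \<subseteq> D\<close> by (auto simp: E_def)
    then have "opp u \<in> K" using closed u by blast
    moreover have "opp u \<noteq> u" using opp(3)[of u] u \<open>K \<subseteq> D\<close> by auto
    ultimately show "opp u \<in> K \<and> opp u \<noteq> u \<and> opp (opp u) = u"
      using u \<open>K \<subseteq> D\<close> opp(2) by auto
  qed
  moreover have "even (card (K - {x}))"
  proof -
    define f where "f u = (SOME v. (u, v) \<in> M \<union> M\<inverse>)" for u
    have f: "(u, f u) \<in> M \<union> M\<inverse>" if "u \<in> A" for u
      using that M unfolding f_def matching_def by (metis DomainE someI)
    show ?thesis
    proof (rule even_card_involution[where f = f])
      show "finite (K - {x})" using fin by simp
      fix u assume u: "u \<in> K - {x}"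
      then have "u \<in> A" using neg that \<open>K \<subseteq> D\<close> unfolding K_def by blast
      note fu = f[OF this]
      then have fuA: "f u \<in> A" "\<kappa> (f u) \<noteq> \<kappa> u" using M unfolding matching_def by blast+
      have "f u \<in> K" using closed[of u "f u"] fu u by blast
      moreover have "f u \<noteq> x" using fuA x by blast
      moreover have "f (f u) = u"
      proof -
        have "(f u, f (f u)) \<in> M \<union> M\<inverse>" using f fuA by blast
        moreover have "(f u, u) \<in> M \<union> M\<inverse>" using fu by blast
        ultimately show ?thesis using M unfolding matching_def by (meson single_valuedD)
      qed
      ultimately show "f u \<in> K - {x} \<and> f u \<noteq> u \<and> f (f u) = u" using fuA by auto
    qed
  qed
  moreover have "card K = Suc (card (K - {x}))"
  proof -
    have "x \<in> K" by (simp add: K_def)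
    from card_Suc_Diff1[OF fin this] show ?thesis by (rule sym)
  qed
  ultimately show False by simp
qed

text \<open>
  Opposite ends have equal colours, so they are not joined; but every end is joined to another.
\<close>

lemma four_ends_joined_in_adjacent_pairs:
  assumes M: "matching \<kappa> (D - {p, q, r, s}) M"
    and sub: "{p, q, r, s} \<subseteq> D" and dist: "distinct [p, q, r, s]" and alt: "alternating \<kappa> (p, q, r, s)"
  defines "L \<equiv> linked (E \<union> M)"
  obtains "(p, q) \<in> L" "(r, s) \<in> L" "(q, r) \<notin> L" "(s, p) \<notin> L"
    | "(q, r) \<in> L" "(s, p) \<in> L" "(p, q) \<notin> L" "(r, s) \<notin> L"
proof -
  have ends: "D - (D - {p, q, r, s}) = {p, q, r, s}" using sub by blast
  have pr: "(p, r) \<notin> L" and qs: "(q, s) \<notin> L"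
    using equally_coloured_ends_not_linked[OF M, of p r] equally_coloured_ends_not_linked[OF M, of q s]
      sub dist alt unfolding L_def by auto
  have sym: "(y, x) \<in> L" if "(x, y) \<in> L" for x y
    using that unfolding L_def by (rule linked_sym)
  have tr: "(x, z) \<in> L" if "(x, y) \<in> L" "(y, z) \<in> L" for x y z
    using that unfolding L_def by (rule linked_trans)
  have other: "\<exists>y\<in>{p, q, r, s}. y \<noteq> x \<and> (x, y) \<in> L" if "x \<in> {p, q, r, s}" for x
    using end_linked_to_end[OF M, of x] that unfolding ends L_def by blast
  have p: "(p, q) \<in> L \<or> (p, s) \<in> L" using other[of p] pr by auto
  have r: "(r, q) \<in> L \<or> (r, s) \<in> L" using other[of r] pr sym by auto
  show thesis
  proof (cases "(p, q) \<in> L")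
    case True
    then show thesis using that(1) pr qs r sym tr by blast
  next
    case False
    then show thesis using that(2) pr qs p r sym tr by blast
  qed
qed

text \<open>
  Without \<open>v\<close> there are two strands that join the ends of \<open>v\<close> in adjacent pairs.  One smoothing
  closes each of them to a circle of its own, the other makes one circle of both.
\<close>

lemma smoothing_change:
  assumes M: "matching \<kappa> (D - set (quad_darts v)) M"
    and sub: "set (quad_darts v) \<subseteq> D" and dist: "distinct (quad_darts v)" and alt: "alternating \<kappa> v"
  shows "odd (num_components D (E \<union> M \<union> quad_arcs True v)
              + num_components D (E \<union> M \<union> quad_arcs False v))"
proof -
  obtain p q r s where v: "v = (p, q, r, s)" by (cases v)
  let ?R = "E \<union> M"
  have R: "?R \<subseteq> D \<times> D"
    using matching_subset[OF M] opp(1) by (auto simp: E_def)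
  have D: "p \<in> D" "q \<in> D" "r \<in> D" "s \<in> D" using sub by (auto simp: v)
  have mono: "linked ?R \<subseteq> linked (insert x ?R)" for x
    by (rule rtrancl_mono) blast
  note ins = num_components_insert[OF finite_D R] 
  have T: "?R \<union> quad_arcs True v = insert (r, s) (insert (p, q) ?R)"
    and F: "?R \<union> quad_arcs False v = insert (q, r) (insert (s, p) ?R)"
    by (auto simp: v)
  have insT: "num_components D (insert (p, q) ?R) = num_components D (insert (r, s) (insert (p, q) ?R))
      + (if (r, s) \<in> linked (insert (p, q) ?R) then 0 else 1)"
    using R D finite_D by (intro num_components_insert) auto
  have insF: "num_components D (insert (s, p) ?R) = num_components D (insert (q, r) (insert (s, p) ?R))
      + (if (q, r) \<in> linked (insert (s, p) ?R) then 0 else 1)"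
    using R D finite_D by (intro num_components_insert) auto
  have M': "matching \<kappa> (D - {p, q, r, s}) M" using M by (simp add: v)
  have sub': "{p, q, r, s} \<subseteq> D" and dist': "distinct [p, q, r, s]" using sub dist by (simp_all add: v)
  show ?thesis
  proof (rule four_ends_joined_in_adjacent_pairs[OF M' sub' dist'])
    show "alternating \<kappa> (p, q, r, s)" using alt by (simp add: v)
  next
    assume L: "(p, q) \<in> linked ?R" "(r, s) \<in> linked ?R" "(q, r) \<notin> linked ?R" "(s, p) \<notin> linked ?R"
    have "(q, p) \<in> linked (insert (s, p) ?R)" "(s, r) \<in> linked (insert (s, p) ?R)"
      using linked_sym[OF L(1)] linked_sym[OF L(2)] mono by blast+
    moreover have "(p, s) \<in> linked (insert (s, p) ?R)"
      by (intro linked_sym[OF linked_step]) simp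
    ultimately have "(q, r) \<in> linked (insert (s, p) ?R)"
      by (meson linked_trans)
    moreover have "(r, s) \<in> linked (insert (p, q) ?R)" using mono L by blast
    ultimately show ?thesis
      using ins[OF D(1,2)] ins[OF D(4,1)] insT insF L unfolding T F by presburger
  next
    assume L: "(q, r) \<in> linked ?R" "(s, p) \<in> linked ?R" "(p, q) \<notin> linked ?R" "(r, s) \<notin> linked ?R"
    have "(r, q) \<in> linked (insert (p, q) ?R)" "(p, s) \<in> linked (insert (p, q) ?R)"
      using linked_sym[OF L(1)] linked_sym[OF L(2)] mono by blast+
    moreover have "(q, p) \<in> linked (insert (p, q) ?R)"
      by (intro linked_sym[OF linked_step]) simp
    ultimately have "(r, s) \<in> linked (insert (p, q) ?R)"
      by (meson linked_trans)
    moreover have "(q, r) \<in> linked (insert (s, p) ?R)" using mono L by blast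
    ultimately show ?thesis
      using ins[OF D(1,2)] ins[OF D(4,1)] insT insF L unfolding T F by presburger
  qed
qed

lemma smoothing_parity:
  assumes "length bs = length qs" "length bs' = length qs"
    and "matching \<kappa> (D - quads_darts qs) M" "quads_darts qs \<subseteq> D"
    and "distinct (concat (map quad_darts qs))" "\<And>q. q \<in> set qs \<Longrightarrow> alternating \<kappa> q"
  shows "even (num_components D (E \<union> M \<union> quads_arcs bs qs) + count_list bs True)
     \<longleftrightarrow> even (num_components D (E \<union> M \<union> quads_arcs bs' qs) + count_list bs' True)"
  using assms
proof (induction qs arbitrary: bs bs' M)
  case Nil
  then show ?case by simp
next
  case (Cons q qs)
  obtain b cs where b: "bs = b # cs" "length cs = length qs" using Cons.prems(1) by (cases bs) auto
  obtain b' cs' where b': "bs' = b' # cs'" "length cs' = length qs" using Cons.prems(2) by (cases bs') auto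
  have disj: "set (quad_darts q) \<inter> quads_darts qs = {}"
    using Cons.prems(5) by (auto simp: quads_darts_def)
  have dist: "distinct (quad_darts q)" "distinct (concat (map quad_darts qs))"
    using Cons.prems(5) by auto
  have "matching \<kappa> ((D - quads_darts (q # qs)) \<union> set (quad_darts q)) (M \<union> quad_arcs b q)"
    using Cons.prems dist by (intro matching_Un matching_quad) auto
  also have "(D - quads_darts (q # qs)) \<union> set (quad_darts q) = D - quads_darts qs"
    using disj Cons.prems(4) by auto
  finally have "even (num_components D (E \<union> (M \<union> quad_arcs b q) \<union> quads_arcs cs qs) + count_list cs True)
     \<longleftrightarrow> even (num_components D (E \<union> (M \<union> quad_arcs b q) \<union> quads_arcs cs' qs) + count_list cs' True)"
    using Cons.prems b b' dist by (intro Cons.IH) auto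
  then have 1: "even (num_components D (E \<union> M \<union> quads_arcs bs (q # qs)) + count_list bs True)
     \<longleftrightarrow> even (num_components D (E \<union> M \<union> quads_arcs (b # cs') (q # qs)) + count_list (b # cs') True)"
    unfolding b by (auto simp: Un_assoc)
  have "matching \<kappa> ((D - quads_darts (q # qs)) \<union> quads_darts qs) (M \<union> quads_arcs cs' qs)"
    using Cons.prems dist b' by (intro matching_Un matching_quads) auto
  also have "(D - quads_darts (q # qs)) \<union> quads_darts qs = D - set (quad_darts q)"
    using disj Cons.prems(4) by auto
  finally have "odd (num_components D (E \<union> (M \<union> quads_arcs cs' qs) \<union> quad_arcs True q)
              + num_components D (E \<union> (M \<union> quads_arcs cs' qs) \<union> quad_arcs False q))"
    using Cons.prems dist by (intro smoothing_change) auto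
  moreover have "E \<union> (M \<union> quads_arcs cs' qs) \<union> quad_arcs t q = E \<union> M \<union> quads_arcs (t # cs') (q # qs)" for t
    by (simp add: Un_ac)
  ultimately have "odd (num_components D (E \<union> M \<union> quads_arcs (True # cs') (q # qs))
              + num_components D (E \<union> M \<union> quads_arcs (False # cs') (q # qs)))"
    by simp
  then have "even (num_components D (E \<union> M \<union> quads_arcs (b # cs') (q # qs)) + count_list (b # cs') True)
     \<longleftrightarrow> even (num_components D (E \<union> M \<union> quads_arcs (b' # cs') (q # qs)) + count_list (b' # cs') True)"
    by (cases b; cases b') (auto simp del: quads_simps)
  then show ?case
    unfolding 1 b' .
qed

end

section \<open>States of a tangle diagram\<close>

definition map_quad :: "('a \<Rightarrow> 'b) \<Rightarrow> 'a quad \<Rightarrow> 'b quad" where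
  "map_quad f = (\<lambda>(a, b, c, d). (f a, f b, f c, f d))"

lemma inj_map_quad: "inj f \<Longrightarrow> inj (map_quad f)"
  by (auto simp: inj_def map_quad_def)

definition hole_quad :: "(corner \<Rightarrow> 'd) \<Rightarrow> 'd quad" where
  "hole_quad h = (h NW, h SW, h SE, h NE)"

text \<open>
  The order is opposite to that of a hole since the collapsed region lies on the other side of the
  circle.  Hence \<open>quad_arcs True\<close> yields the numerator closure here and the first fundamental
  tangle in a hole.
\<close>

definition outer_quad :: "(corner \<Rightarrow> 'd) \<Rightarrow> 'd quad" where
  "outer_quad h = (h NW, h NE, h SE, h SW)"

abbreviation mate :: "nat \<Rightarrow> corner \<Rightarrow> corner" where
  "mate t \<equiv> opp (fundamental_tangle t)"

lemma mate_simps [simp]: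
  "mate 0 NW = SW" "mate 0 SW = NW" "mate 0 NE = SE" "mate 0 SE = NE"
  "mate (Suc 0) NW = NE" "mate (Suc 0) NE = NW" "mate (Suc 0) SW = SE" "mate (Suc 0) SE = SW"
  by (simp_all add: fundamental_tangle_def)

lemma UNIV_corner: "(UNIV :: corner set) = {NW, NE, SW, SE}"
  using corner.exhaust by blast

lemma all_corners: "(\<forall>p. P p) \<longleftrightarrow> P NW \<and> P NE \<and> P SW \<and> P SE"
  by (metis corner.exhaust)

lemma range_corner: "range h = {h NW, h NE, h SW, h SE}"
  by (auto simp: UNIV_corner)

text \<open>
  Connectedness is tested with predicates that are constant along \<open>R\<close>.  Unlike paths, they can be
  restricted to the parts of a composite diagram and extended from them.
\<close>

definition invariant_on :: "('d \<times> 'd) set \<Rightarrow> ('d \<Rightarrow> bool) \<Rightarrow> bool" where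
  "invariant_on R P \<longleftrightarrow> (\<forall>(x, y) \<in> R. P x = P y)"

lemma invariant_on_Un: "invariant_on (R \<union> S) P \<longleftrightarrow> invariant_on R P \<and> invariant_on S P"
  by (auto simp: invariant_on_def)

lemma invariant_on_UN: "invariant_on (\<Union>x\<in>I. R x) P \<longleftrightarrow> (\<forall>x\<in>I. invariant_on (R x) P)"
  by (auto simp: invariant_on_def)

lemma invariant_on_map_quad:
  "invariant_on (quad_arcs s (map_quad f q)) P \<longleftrightarrow> invariant_on (quad_arcs s q) (P \<circ> f)"
  by (cases q) (auto simp: invariant_on_def map_quad_def)

lemma invariant_on_hole_quad:
  "t < 2 \<Longrightarrow> invariant_on (quad_arcs (t = 0) (hole_quad h)) P \<longleftrightarrow> (\<forall>p. P (h p) = P (h (mate t p)))"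
  by (auto dest!: less_2_cases simp: invariant_on_def hole_quad_def all_corners)

lemma invariant_on_outer_quad:
  "e < 2 \<Longrightarrow> invariant_on (quad_arcs (e = 0) (outer_quad h)) P
     \<longleftrightarrow> (\<forall>p. P (h p) = P (h (mate (1 - e) p)))"
  by (auto dest!: less_2_cases simp: invariant_on_def outer_quad_def all_corners)

lemma linked_invariant_on: "(x, y) \<in> linked R \<Longrightarrow> invariant_on R P \<Longrightarrow> P x = P y"
  by (erule linked_invariant) (auto simp: invariant_on_def)

lemma invariant_on_linked: "invariant_on R (\<lambda>x. (x, y) \<in> linked R)"
  unfolding invariant_on_def
proof clarify
  fix u v assume "(u, v) \<in> R"
  then have uv: "(u, v) \<in> linked R" by (rule linked_step)
  show "(u, y) \<in> linked R \<longleftrightarrow> (v, y) \<in> linked R"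
    using linked_trans[OF uv] linked_trans[OF linked_sym[OF uv]] by blast
qed

definition connected_by :: "'d set \<Rightarrow> ('d \<times> 'd) set \<Rightarrow> bool" where
  "connected_by D R \<longleftrightarrow> (\<forall>x\<in>D. \<forall>y\<in>D. (x, y) \<in> linked R)"

lemma connected_by_iff:
  "connected_by D R \<longleftrightarrow> (\<forall>P. invariant_on R P \<longrightarrow> (\<forall>x\<in>D. \<forall>y\<in>D. P x = P y))"
proof
  assume "connected_by D R"
  then show "\<forall>P. invariant_on R P \<longrightarrow> (\<forall>x\<in>D. \<forall>y\<in>D. P x = P y)"
    unfolding connected_by_def by (meson linked_invariant_on)
next
  assume *: "\<forall>P. invariant_on R P \<longrightarrow> (\<forall>x\<in>D. \<forall>y\<in>D. P x = P y)"
  show "connected_by D R"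
    unfolding connected_by_def
  proof (intro ballI)
    fix x y assume "x \<in> D" "y \<in> D"
    then show "(x, y) \<in> linked R"
      using * invariant_on_linked[of R y] by (metis rtrancl.rtrancl_refl)
  qed
qed

text \<open>
  The conclusion drawn from planarity, in the form in which the states use it.
\<close>

definition checkerboard :: "('d \<Rightarrow> bool) \<Rightarrow> 'd tangle_diagram \<Rightarrow> bool" where
  "checkerboard \<kappa> T \<longleftrightarrow>
     distinct (concat (tangle_vertices T)) \<and>
     (\<forall>x \<in> darts T. opp T x \<in> darts T \<and> opp T (opp T x) = x \<and> \<kappa> (opp T x) \<noteq> \<kappa> x) \<and>
     (\<forall>q \<in> set (crossings T @ map hole_quad (holes T) @ [outer_quad (outer T)]). alternating \<kappa> q) \<and>
     (\<forall>(a, b) \<in> set (joints T). \<kappa> a \<noteq> \<kappa> b)"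

lemma tangle_vertices_quads:
  fixes T :: "'d tangle_diagram"
  shows "tangle_vertices T
     = map quad_darts (crossings T) @ map (\<lambda>(a, b). [a, b]) (joints T)
       @ map quad_darts (map hole_quad (holes T)) @ [quad_darts (outer_quad (outer T))]"
proof -
  have "(\<lambda>(a, b, c, d). [a, b, c, d]) = (quad_darts :: 'd quad \<Rightarrow> 'd list)" by (rule ext) auto
  moreover have "(\<lambda>h. [h NW, h SW, h SE, h NE]) = (quad_darts \<circ> hole_quad :: _ \<Rightarrow> 'd list)"
    by (rule ext) (auto simp: hole_quad_def)
  ultimately show ?thesis
    by (simp add: tangle_vertices_def strand_vertices_def outer_quad_def)
qed

lemma checkerboard_exists:
  assumes "punctured_ball_tangle_diagram n T"
  obtains \<kappa> where "checkerboard \<kappa> T"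
proof -
  have wf: "distinct (concat (tangle_vertices T))"
    "\<And>x. x \<in> darts T \<Longrightarrow> opp T x \<in> darts T \<and> opp T x \<noteq> x \<and> opp T (opp T x) = x" "planar T"
    using assms by (auto simp: punctured_ball_tangle_diagram_def)
  interpret even_map "tangle_vertices T" "opp T"
  proof
    show "distinct (concat (tangle_vertices T))" by (rule wf)
    show "(\<exists>a b. v = [a, b]) \<or> (\<exists>a b c d. v = [a, b, c, d])" if "v \<in> set (tangle_vertices T)" for v
      using that by (auto simp: tangle_vertices_def strand_vertices_def)
  qed (use wf(2) in \<open>simp_all add: darts_def\<close>)
  have D: "D = darts T" "edges = arcs T (darts T)" "rot = next_dart T"
    by (simp_all add: D_def edges_def rot_def darts_def arcs_def next_dart_def)
  obtain \<kappa> where \<kappa>: "\<And>x. x \<in> D \<Longrightarrow> \<kappa> (opp T x) = (\<not> \<kappa> x)" "\<And>x y. (x, y) \<in> rot \<Longrightarrow> \<kappa> y = (\<not> \<kappa> x)"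
    using checkerboard_colouring wf(3) unfolding planar_def D by metis
  have quad: "alternating \<kappa> q" if "quad_darts q \<in> set (tangle_vertices T)" for q
  proof -
    obtain a b c d where q: "q = (a, b, c, d)" by (cases q)
    have "set (zip [a, b, c, d] (rotate1 [a, b, c, d])) \<subseteq> rot"
      using UN_upper[OF that, of "\<lambda>v. set (zip v (rotate1 v))"] unfolding rot_def by (simp add: q)
    then show ?thesis using \<kappa>(2) by (auto simp: q)
  qed
  have pair: "\<kappa> a \<noteq> \<kappa> b" if "[a, b] \<in> set (tangle_vertices T)" for a b
  proof -
    have "set (zip [a, b] (rotate1 [a, b])) \<subseteq> rot"
      using UN_upper[OF that, of "\<lambda>v. set (zip v (rotate1 v))"] unfolding rot_def by simp
    then show ?thesis using \<kappa>(2) by auto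
  qed
  have "checkerboard \<kappa> T"
    unfolding checkerboard_def
  proof (intro conjI)
    show "\<forall>q \<in> set (crossings T @ map hole_quad (holes T) @ [outer_quad (outer T)]). alternating \<kappa> q"
    proof
      fix q assume "q \<in> set (crossings T @ map hole_quad (holes T) @ [outer_quad (outer T)])"
      then have "quad_darts q \<in> set (tangle_vertices T)"
        by (auto simp: tangle_vertices_quads)
      then show "alternating \<kappa> q" by (rule quad)
    qed
    show "\<forall>(a, b) \<in> set (joints T). \<kappa> a \<noteq> \<kappa> b"
    proof clarify
      fix a b assume "(a, b) \<in> set (joints T)" and eq: "\<kappa> a = \<kappa> b"
      then have "[a, b] \<in> set (tangle_vertices T)"
        by (force simp: tangle_vertices_def strand_vertices_def)
      then show False using pair eq by blast
    qed
  qed (use wf \<kappa>(1) in \<open>auto simp: D\<close>)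
  then show thesis by (rule that)
qed

lemma checkerboard_fundamental_tangle: "checkerboard (\<lambda>p. p \<in> {NW, SE}) (fundamental_tangle t)"
proof -
  have "mate t p \<in> {NW, SE} \<longleftrightarrow> p \<notin> {NW, SE}" "mate t (mate t p) = p" for p
    by (cases p; simp add: fundamental_tangle_def)+
  moreover have "darts (fundamental_tangle t) = UNIV"
    by (auto simp: darts_def tangle_vertices_def strand_vertices_def fundamental_tangle_def UNIV_corner)
  moreover have "crossings (fundamental_tangle t) = []" "joints (fundamental_tangle t) = []"
    "holes (fundamental_tangle t) = []" "outer (fundamental_tangle t) = id"
    by (simp_all add: fundamental_tangle_def)
  ultimately show ?thesis
    by (simp add: checkerboard_def tangle_vertices_def strand_vertices_def outer_quad_def)
qed

definition base_arcs :: "'d tangle_diagram \<Rightarrow> 'd quad set \<Rightarrow> ('d \<times> 'd) set" where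
  "base_arcs T \<sigma> = arcs T (darts T) \<union> set (joints T) \<union> (\<Union>q\<in>set (crossings T). quad_arcs (q \<in> \<sigma>) q)"

text \<open>
  The curves of a state: \<open>\<sigma>\<close> contains the crossings with an \<open>A\<close>-type splitting and \<open>is\<close> lists the
  numbers of the fundamental tangles in the holes.  The outer marked points remain ends of strands.
\<close>

definition state_arcs :: "'d tangle_diagram \<Rightarrow> 'd quad set \<Rightarrow> nat list \<Rightarrow> ('d \<times> 'd) set" where
  "state_arcs T \<sigma> is
     = base_arcs T \<sigma> \<union> (\<Union>(i, h)\<in>set (zip is (holes T)). quad_arcs (i = 0) (hole_quad h))"

definition closed_arcs :: "nat \<Rightarrow> 'd tangle_diagram \<Rightarrow> 'd quad set \<Rightarrow> nat list \<Rightarrow> ('d \<times> 'd) set" where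
  "closed_arcs e T \<sigma> is = state_arcs T \<sigma> is \<union> quad_arcs (e = 0) (outer_quad (outer T))"

definition tangle_quads :: "'d tangle_diagram \<Rightarrow> 'd quad list" where
  "tangle_quads T = crossings T @ map hole_quad (holes T)"

definition state_bits :: "'d tangle_diagram \<Rightarrow> 'd quad set \<Rightarrow> nat list \<Rightarrow> bool list" where
  "state_bits T \<sigma> is = map (\<lambda>q. q \<in> \<sigma>) (crossings T) @ map (\<lambda>i. i = 0) is"

lemma state_arcs_quads:
  assumes "length is = length (holes T)"
  shows "state_arcs T \<sigma> is
    = arcs T (darts T) \<union> set (joints T) \<union> quads_arcs (state_bits T \<sigma> is) (tangle_quads T)"
proof -
  have "quads_arcs (state_bits T \<sigma> is) (tangle_quads T)
     = (\<Union>(b, q)\<in>set (zip (map (\<lambda>q. q \<in> \<sigma>) (crossings T)) (crossings T)). quad_arcs b q)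
       \<union> (\<Union>(b, q)\<in>set (zip (map (\<lambda>i. i = 0) is) (map hole_quad (holes T))). quad_arcs b q)"
    by (simp add: quads_arcs_def state_bits_def tangle_quads_def)
  also have "(\<Union>(b, q)\<in>set (zip (map (\<lambda>q. q \<in> \<sigma>) (crossings T)) (crossings T)). quad_arcs b q)
     = (\<Union>q\<in>set (crossings T). quad_arcs (q \<in> \<sigma>) q)"
    by (simp only: zip_map1 zip_same_conv_map set_map image_image map_map) auto
  also have "(\<Union>(b, q)\<in>set (zip (map (\<lambda>i. i = 0) is) (map hole_quad (holes T))). quad_arcs b q)
     = (\<Union>(i, h)\<in>set (zip is (holes T)). quad_arcs (i = 0) (hole_quad h))"
    by (simp only: zip_map_map set_map image_image) (auto simp: case_prod_unfold)
  finally show ?thesis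
    by (simp add: state_arcs_def base_arcs_def Un_assoc)
qed

lemma range_subset_hole: "h \<in> set (holes T) \<Longrightarrow> h p \<in> darts T"
  by (cases p) (force simp: darts_def tangle_vertices_def)+

lemma outer_in_darts [simp]: "outer T p \<in> darts T"
  by (cases p) (auto simp: darts_def tangle_vertices_def)

lemma finite_darts [simp]: "finite (darts T)"
  by (simp add: darts_def)

lemma concat_vertices:
  "concat (tangle_vertices T)
     = concat (map quad_darts (crossings T)) @ concat (map (\<lambda>(a, b). [a, b]) (joints T))
       @ concat (map quad_darts (map hole_quad (holes T))) @ quad_darts (outer_quad (outer T))"
  by (simp add: tangle_vertices_quads)

lemma coloured_arcs_checkerboard: "checkerboard \<kappa> T \<Longrightarrow> coloured_arcs (darts T) (opp T) \<kappa>"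
  by unfold_locales (auto simp: checkerboard_def)

lemma coloured_arcs_E: "checkerboard \<kappa> T \<Longrightarrow> coloured_arcs.E (darts T) (opp T) = arcs T (darts T)"
  by (subst coloured_arcs.E_def[OF coloured_arcs_checkerboard]) (auto simp: arcs_def)

lemma joints_matching:
  assumes "checkerboard \<kappa> T"
  shows "matching \<kappa> (set (concat (map (\<lambda>(a, b). [a, b]) (joints T)))) (set (joints T))"
  using assms by (intro matching_joints) (auto simp: checkerboard_def concat_vertices)

lemma state_matching:
  assumes T: "checkerboard \<kappa> T" and "length is = length (holes T)"
  shows "matching \<kappa> (darts T - set (quad_darts (outer_quad (outer T))))
           (set (joints T) \<union> quads_arcs (state_bits T \<sigma> is) (tangle_quads T))"
proof -
  let ?J = "set (concat (map (\<lambda>(a, b). [a, b]) (joints T)))"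
  have dist: "distinct (concat (tangle_vertices T))" using T by (simp add: checkerboard_def)
  have "matching \<kappa> (quads_darts (tangle_quads T)) (quads_arcs (state_bits T \<sigma> is) (tangle_quads T))"
  proof (rule matching_quads)
    show "length (state_bits T \<sigma> is) = length (tangle_quads T)"
      using assms(2) by (simp add: state_bits_def tangle_quads_def)
    show "distinct (concat (map quad_darts (tangle_quads T)))"
      using dist unfolding concat_vertices tangle_quads_def map_append concat_append distinct_append set_append by blast
    show "alternating \<kappa> q" if "q \<in> set (tangle_quads T)" for q
      using T that by (auto simp: checkerboard_def tangle_quads_def)
  qed
  moreover have "?J \<inter> quads_darts (tangle_quads T) = {}"
    using dist unfolding concat_vertices tangle_quads_def quads_darts_def map_append concat_append distinct_append set_append by blast
  ultimately have "matching \<kappa> (?J \<union> quads_darts (tangle_quads T))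
           (set (joints T) \<union> quads_arcs (state_bits T \<sigma> is) (tangle_quads T))"
    using joints_matching[OF T] by (intro matching_Un)
  also have "?J \<union> quads_darts (tangle_quads T) = darts T - set (quad_darts (outer_quad (outer T)))"
  proof -
    have "darts T = ?J \<union> quads_darts (tangle_quads T) \<union> set (quad_darts (outer_quad (outer T)))"
      unfolding darts_def concat_vertices quads_darts_def tangle_quads_def map_append concat_append distinct_append set_append by blast
    moreover have "(?J \<union> quads_darts (tangle_quads T)) \<inter> set (quad_darts (outer_quad (outer T))) = {}"
      using dist unfolding concat_vertices quads_darts_def tangle_quads_def map_append concat_append distinct_append set_append by blast
    ultimately show ?thesis by blast
  qed
  finally show ?thesis .
qed

text \<open>
  The strands between the outer marked points run as in fundamental tangle number \<open>t\<close>.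
\<close>

definition strands_type :: "nat \<Rightarrow> 'd tangle_diagram \<Rightarrow> 'd quad set \<Rightarrow> nat list \<Rightarrow> bool" where
  "strands_type t T \<sigma> is \<longleftrightarrow>
     t < 2 \<and> (\<forall>p p'. (outer T p, outer T p') \<in> linked (state_arcs T \<sigma> is) \<longleftrightarrow> p' \<in> {p, mate t p})"

lemma strands_type_exists:
  assumes T: "checkerboard \<kappa> T" and len: "length is = length (holes T)"
  obtains t where "strands_type t T \<sigma> is"
proof -
  interpret coloured_arcs "darts T" "opp T" \<kappa>
    by (rule coloured_arcs_checkerboard[OF T])
  let ?M = "set (joints T) \<union> quads_arcs (state_bits T \<sigma> is) (tangle_quads T)"
  have S: "state_arcs T \<sigma> is = E \<union> ?M"
    unfolding coloured_arcs_E[OF T] state_arcs_quads[OF len] by blast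
  let ?L = "linked (state_arcs T \<sigma> is)"
  have sym: "(y, x) \<in> ?L" if "(x, y) \<in> ?L" for x y
    using that by (rule linked_sym)
  have tr: "(x, z) \<in> ?L" if "(x, y) \<in> ?L" "(y, z) \<in> ?L" for x y z
    using that by (rule linked_trans)
  have refl: "(x, x) \<in> ?L" for x by simp
  have M: "matching \<kappa> (darts T - {outer T NW, outer T NE, outer T SE, outer T SW}) ?M"
    using state_matching[OF T len] by (simp add: outer_quad_def)
  have sub: "{outer T NW, outer T NE, outer T SE, outer T SW} \<subseteq> darts T" by simp
  have "distinct (quad_darts (outer_quad (outer T)))"
    using T by (simp add: checkerboard_def concat_vertices)
  then have dist: "distinct [outer T NW, outer T NE, outer T SE, outer T SW]"
    by (simp add: outer_quad_def)
  have alt: "alternating \<kappa> (outer T NW, outer T NE, outer T SE, outer T SW)"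
    using T by (simp add: checkerboard_def outer_quad_def)
  show thesis
  proof (rule four_ends_joined_in_adjacent_pairs[OF M sub dist alt, folded S])
    assume L: "(outer T NW, outer T NE) \<in> ?L" "(outer T SE, outer T SW) \<in> ?L"
      "(outer T NE, outer T SE) \<notin> ?L" "(outer T SW, outer T NW) \<notin> ?L"
    then have "(outer T NW, outer T SE) \<notin> ?L" "(outer T NE, outer T SW) \<notin> ?L"
      by (meson sym tr)+
    then have "strands_type 1 T \<sigma> is"
      using L sym refl unfolding strands_type_def all_corners by auto
    then show thesis by (rule that)
  next
    assume L: "(outer T NE, outer T SE) \<in> ?L" "(outer T SW, outer T NW) \<in> ?L"
      "(outer T NW, outer T NE) \<notin> ?L" "(outer T SE, outer T SW) \<notin> ?L"
    then have "(outer T NW, outer T SE) \<notin> ?L" "(outer T NE, outer T SW) \<notin> ?L"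
      by (meson sym tr)+
    then have "strands_type 0 T \<sigma> is"
      using L sym refl unfolding strands_type_def all_corners by auto
    then show thesis by (rule that)
  qed
qed

text \<open>
  After closure number \<open>e\<close> the state is a single circle.
\<close>

definition closed_connected :: "nat \<Rightarrow> 'd tangle_diagram \<Rightarrow> 'd quad set \<Rightarrow> nat list \<Rightarrow> bool" where
  "closed_connected e T \<sigma> is \<longleftrightarrow> connected_by (darts T) (closed_arcs e T \<sigma> is)"

text \<open>
  The closure that repeats the pairs already joined by the two strands closes them to two
  different circles; the points joined to \<open>NW\<close> form one of them.
\<close>

lemma closed_connected_type:
  assumes "closed_connected i T \<sigma> is" "i < 2" "strands_type t T \<sigma> is"
  shows "i = t"
proof (rule ccontr)
  assume "i \<noteq> t"
  have t: "t < 2" using assms(3) by (simp add: strands_type_def)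
  then have it: "1 - i = t" "1 - t = i" using assms(2) \<open>i \<noteq> t\<close> by auto
  let ?P = "\<lambda>x. (x, outer T NW) \<in> linked (state_arcs T \<sigma> is)"
  have L: "?P (outer T p) \<longleftrightarrow> NW \<in> {p, mate t p}" for p
    using assms(3) by (simp add: strands_type_def)
  have "invariant_on (closed_arcs i T \<sigma> is) ?P"
    unfolding closed_arcs_def invariant_on_Un invariant_on_outer_quad[OF assms(2)] it L
    using invariant_on_linked less_2_cases[OF t] by (auto simp: all_corners)
  then have "\<forall>x\<in>darts T. \<forall>y\<in>darts T. ?P x = ?P y"
    using assms(1) unfolding closed_connected_def connected_by_iff by blast
  then have "?P (outer T NW) = ?P (outer T (mate (1 - t) NW))"
    using outer_in_darts by blast
  then show False
    unfolding L using less_2_cases[OF t] by auto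
qed

section \<open>States of a composite diagram\<close>

lemma invariant_on_arcs: "invariant_on (arcs L D) P \<longleftrightarrow> (\<forall>x\<in>D. P x = P (opp L x))"
  by (auto simp: invariant_on_def arcs_def)

lemma set_concat_pairs: "set (concat (map (\<lambda>(a, b). [a, b]) js)) = Field (set js)"
proof (induction js)
  case (Cons j js)
  then show ?case by (cases j) (simp del: set_concat)
qed simp

lemma darts_eq:
  fixes T :: "'d tangle_diagram"
  shows "darts T = (\<Union>q\<in>set (crossings T). set (quad_darts q)) \<union> Field (set (joints T))
     \<union> (\<Union>h\<in>set (holes T). range h) \<union> range (outer T)"
proof -
  show ?thesis
    unfolding darts_def concat_vertices set_append set_concat_pairs
    by (auto simp: range_corner hole_quad_def outer_quad_def)
qed

abbreviation part :: "nat \<Rightarrow> 'b \<Rightarrow> 'a + nat \<times> 'b" where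
  "part j x \<equiv> Inr (j, x)"

lemma compose_simps:
  "crossings (compose T Xs) = map (map_quad Inl) (crossings T)
     @ concat (map (\<lambda>j. map (map_quad (part j)) (crossings (Xs ! j))) [0..<length Xs])"
  "opp (compose T Xs) (Inl x) = Inl (opp T x)"
  "opp (compose T Xs) (part j y) = part j (opp (Xs ! j) y)"
  "holes (compose T Xs) = concat (map (\<lambda>j. map (\<lambda>h. part j \<circ> h) (holes (Xs ! j))) [0..<length Xs])"
  "outer (compose T Xs) = Inl \<circ> outer T"
  by (simp_all add: compose_def map_quad_def comp_def)

lemma set_crossings_compose:
  "set (crossings (compose T Xs)) = map_quad Inl ` set (crossings T)
     \<union> (\<Union>j<length Xs. map_quad (part j) ` set (crossings (Xs ! j)))"
  by (simp add: compose_simps atLeast0LessThan)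

lemma set_joints_compose:
  "set (joints (compose T Xs)) = map_prod Inl Inl ` set (joints T)
     \<union> (\<Union>j<length Xs. map_prod (part j) (part j) ` set (joints (Xs ! j)))
     \<union> (\<Union>j<length Xs. range (\<lambda>p. (Inl ((holes T ! j) p), part j (outer (Xs ! j) p))))"
  by (auto simp: compose_def map_prod_def range_corner)

lemma map_quad_darts: "set (quad_darts (map_quad f q)) = f ` set (quad_darts q)"
  by (cases q) (simp add: map_quad_def)

lemma set_conv_nth_UN: "(\<Union>h\<in>set hs. f h) = (\<Union>j<length hs. f (hs ! j))"
  by (force simp: set_conv_nth)

lemma Field_map_prod: "Field (map_prod f f ` A) = f ` Field A"
  by (force simp: Field_def)

lemma Field_UN: "Field (\<Union>j\<in>I. A j) = (\<Union>j\<in>I. Field (A j))"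
  by (auto simp: Field_def)

lemma Field_range: "Field (range (\<lambda>p. (f p, g p))) = range f \<union> range g"
  by (auto simp: Field_def)

lemma darts_compose:
  assumes "length Xs = length (holes T)"
  shows "darts (compose T Xs) = Inl ` darts T \<union> (\<Union>j<length Xs. part j ` darts (Xs ! j))"
proof -
  have C: "(\<Union>q\<in>set (crossings (compose T Xs)). set (quad_darts q))
     = Inl ` (\<Union>q\<in>set (crossings T). set (quad_darts q))
       \<union> (\<Union>j<length Xs. part j ` (\<Union>q\<in>set (crossings (Xs ! j)). set (quad_darts q)))"
    by (simp only: set_crossings_compose UN_Un UN_UN_flatten image_UN map_quad_darts image_image) blast
  have J: "Field (set (joints (compose T Xs)))
     = Inl ` Field (set (joints T))
       \<union> (\<Union>j<length Xs. part j ` Field (set (joints (Xs ! j))))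
       \<union> (\<Union>j<length Xs. Inl ` range (holes T ! j)) \<union> (\<Union>j<length Xs. part j ` range (outer (Xs ! j)))"
    by (simp add: set_joints_compose Field_map_prod Field_UN Field_range UN_Un_distrib image_image Un_assoc)
  have H: "(\<Union>h\<in>set (holes (compose T Xs)). range h)
     = (\<Union>j<length Xs. part j ` (\<Union>h\<in>set (holes (Xs ! j)). range h))"
    by (simp add: compose_simps image_UN atLeast0LessThan image_comp) blast
  have HT: "(\<Union>h\<in>set (holes T). range h) = (\<Union>j<length Xs. range (holes T ! j))"
    unfolding assms by (rule set_conv_nth_UN)
  have O: "range (outer (compose T Xs)) = Inl ` range (outer T)"
    by (simp add: compose_simps image_comp)
  show ?thesis
    unfolding darts_eq C J H HT O by (simp only: image_Un UN_Un_distrib image_UN) blast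
qed

lemma set_zip_concat:
  assumes "list_all2 (\<lambda>xs ys. length xs = length ys) xss yss"
  shows "set (zip (concat xss) (concat yss)) = (\<Union>j<length xss. set (zip (xss ! j) (yss ! j)))"
  using assms
proof (induction rule: list_all2_induct)
  case Nil
  then show ?case by simp
next
  case (Cons xs xss ys yss)
  have "(\<Union>j<length (xs # xss). set (zip ((xs # xss) ! j) ((ys # yss) ! j)))
     = set (zip xs ys) \<union> (\<Union>j<length xss. set (zip (xss ! j) (yss ! j)))"
    by (simp add: lessThan_Suc_eq_insert_0 image_image)
  then show ?case
    using Cons by simp
qed

lemma hole_quad_comp: "hole_quad (f \<circ> h) = map_quad f (hole_quad h)"
  by (simp add: hole_quad_def map_quad_def)

lemma outer_quad_comp: "outer_quad (f \<circ> h) = map_quad f (outer_quad h)"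
  by (simp add: outer_quad_def map_quad_def)

lemma invariant_on_compose:
  assumes len: "length Xs = length (holes T)" "length \<alpha>s = length Xs"
    and holes: "\<forall>j<length Xs. length (\<alpha>s ! j) = length (holes (Xs ! j))"
  shows "invariant_on (closed_arcs e (compose T Xs) \<sigma> (concat \<alpha>s)) P \<longleftrightarrow>
     invariant_on (base_arcs T (map_quad Inl -` \<sigma>) \<union> quad_arcs (e = 0) (outer_quad (outer T))) (P \<circ> Inl)
     \<and> (\<forall>j<length Xs. invariant_on (state_arcs (Xs ! j) (map_quad (part j) -` \<sigma>) (\<alpha>s ! j)) (P \<circ> part j))
     \<and> (\<forall>j<length Xs. \<forall>p. P (Inl ((holes T ! j) p)) = P (part j (outer (Xs ! j) p)))"
proof -
  let ?U = "compose T Xs"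
  have arcs: "invariant_on (arcs ?U (darts ?U)) P \<longleftrightarrow> invariant_on (arcs T (darts T)) (P \<circ> Inl)
      \<and> (\<forall>j<length Xs. invariant_on (arcs (Xs ! j) (darts (Xs ! j))) (P \<circ> part j))"
    unfolding invariant_on_arcs darts_compose[OF len(1)]
    by (simp add: ball_Un compose_simps) blast
  have joints: "invariant_on (set (joints ?U)) P \<longleftrightarrow> invariant_on (set (joints T)) (P \<circ> Inl)
      \<and> (\<forall>j<length Xs. invariant_on (set (joints (Xs ! j))) (P \<circ> part j))
      \<and> (\<forall>j<length Xs. \<forall>p. P (Inl ((holes T ! j) p)) = P (part j (outer (Xs ! j) p)))"
    unfolding set_joints_compose invariant_on_Un invariant_on_UN
    by (simp add: invariant_on_def case_prod_unfold) blast
  have crossings: "invariant_on (\<Union>q\<in>set (crossings ?U). quad_arcs (q \<in> \<sigma>) q) P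
      \<longleftrightarrow> invariant_on (\<Union>q\<in>set (crossings T). quad_arcs (q \<in> map_quad Inl -` \<sigma>) q) (P \<circ> Inl)
      \<and> (\<forall>j<length Xs. invariant_on
            (\<Union>q\<in>set (crossings (Xs ! j)). quad_arcs (q \<in> map_quad (part j) -` \<sigma>) q) (P \<circ> part j))"
    unfolding set_crossings_compose invariant_on_UN
    by (simp add: ball_Un invariant_on_map_quad) blast
  have "list_all2 (\<lambda>xs ys. length xs = length ys) \<alpha>s
      (map (\<lambda>j. map (\<lambda>h. part j \<circ> h) (holes (Xs ! j))) [0..<length Xs])"
    using len holes by (simp add: list_all2_conv_all_nth)
  then have zip: "set (zip (concat \<alpha>s) (holes ?U))
      = (\<Union>j<length Xs. (\<lambda>(i, h). (i, part j \<circ> h)) ` set (zip (\<alpha>s ! j) (holes (Xs ! j))))"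
    unfolding compose_simps by (subst set_zip_concat) (auto simp: len(2) zip_map2)
  have holes': "invariant_on (\<Union>(i, h)\<in>set (zip (concat \<alpha>s) (holes ?U)). quad_arcs (i = 0) (hole_quad h)) P
      \<longleftrightarrow> (\<forall>j<length Xs. invariant_on
           (\<Union>(i, h)\<in>set (zip (\<alpha>s ! j) (holes (Xs ! j))). quad_arcs (i = 0) (hole_quad h)) (P \<circ> part j))"
    unfolding zip invariant_on_UN
    by (simp add: case_prod_unfold hole_quad_comp invariant_on_map_quad) blast
  have outer: "invariant_on (quad_arcs (e = 0) (outer_quad (outer ?U))) P
      \<longleftrightarrow> invariant_on (quad_arcs (e = 0) (outer_quad (outer T))) (P \<circ> Inl)"
    by (simp only: compose_simps outer_quad_comp invariant_on_map_quad)
  show ?thesis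
    unfolding closed_arcs_def state_arcs_def base_arcs_def invariant_on_Un
      arcs joints crossings holes' outer by blast
qed

lemma invariant_on_closed:
  assumes "\<And>i. i \<in> set is \<Longrightarrow> i < 2" "length is = length (holes T)"
  shows "invariant_on (closed_arcs e T \<sigma> is) P \<longleftrightarrow>
     invariant_on (base_arcs T \<sigma> \<union> quad_arcs (e = 0) (outer_quad (outer T))) P
     \<and> (\<forall>j<length (holes T). \<forall>p. P ((holes T ! j) p) = P ((holes T ! j) (mate (is ! j) p)))"
proof -
  have "invariant_on (\<Union>(i, h)\<in>set (zip is (holes T)). quad_arcs (i = 0) (hole_quad h)) P
      \<longleftrightarrow> (\<forall>j<length (holes T). invariant_on (quad_arcs (is ! j = 0) (hole_quad (holes T ! j))) P)"
    using assms(2) unfolding invariant_on_UN by (auto simp: set_zip)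
  also have "\<dots> \<longleftrightarrow> (\<forall>j<length (holes T). \<forall>p. P ((holes T ! j) p) = P ((holes T ! j) (mate (is ! j) p)))"
    using assms by (simp add: invariant_on_hole_quad)
  finally show ?thesis
    unfolding closed_arcs_def state_arcs_def invariant_on_Un by blast
qed

lemma mates_connect_corners:
  assumes "t < 2" "\<And>p. f p = f (mate t p)" "\<And>p. f p = f (mate (1 - t) p)"
  shows "f p = f p'"
proof -
  have "f q = f NW" for q
    using less_2_cases[OF assms(1)] assms(2)[of NW] assms(3)[of NW] assms(2)[of SE] assms(3)[of SE]
    by (cases q) auto
  then show ?thesis by metis
qed

text \<open>
  From outside, a part with strands of type \<open>t\<close> acts like fundamental tangle number \<open>t\<close>.  A predicate
  that is constant along the curves of the filled diagram \<open>T\<close> extends along the strands into the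
  parts; one for a closed part extends to the composite by the value that it has at all four
  marked points.
\<close>

lemma closed_connected_compose:
  fixes T :: "'a tangle_diagram" and Xs :: "'b tangle_diagram list"
  assumes len: "length Xs = length (holes T)" "length \<alpha>s = length Xs"
    and holes: "\<forall>j<length Xs. length (\<alpha>s ! j) = length (holes (Xs ! j))"
    and type: "length ts = length Xs"
      "\<And>j. j < length Xs \<Longrightarrow> strands_type (ts ! j) (Xs ! j) (map_quad (part j) -` \<sigma>) (\<alpha>s ! j)"
  shows "closed_connected e (compose T Xs) \<sigma> (concat \<alpha>s) \<longleftrightarrow>
     closed_connected e T (map_quad Inl -` \<sigma>) ts
     \<and> (\<forall>j<length Xs. closed_connected (ts ! j) (Xs ! j) (map_quad (part j) -` \<sigma>) (\<alpha>s ! j))"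
proof -
  let ?U = "compose T Xs" and ?n = "length Xs"
  let ?\<tau> = "map_quad Inl -` \<sigma>" and ?\<rho> = "\<lambda>j. map_quad (part j) -` \<sigma>"
  let ?L = "\<lambda>j. linked (state_arcs (Xs ! j) (?\<rho> j) (\<alpha>s ! j))"
  have t2: "ts ! j < 2" if "j < ?n" for j
    using type(2)[OF that] by (simp add: strands_type_def)
  have t2': "i < 2" if "i \<in> set ts" for i
    using that t2 type(1) by (auto simp: in_set_conv_nth)
  have L: "(outer (Xs ! j) p, outer (Xs ! j) p') \<in> ?L j \<longleftrightarrow> p' \<in> {p, mate (ts ! j) p}" if "j < ?n" for j p p'
    using type(2)[OF that] by (simp add: strands_type_def)
  note inv_U = invariant_on_compose[OF len holes, of e \<sigma>]
  have inv_T: "invariant_on (closed_arcs e T ?\<tau> ts) P \<longleftrightarrow>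
     invariant_on (base_arcs T ?\<tau> \<union> quad_arcs (e = 0) (outer_quad (outer T))) P
     \<and> (\<forall>j<?n. \<forall>p. P ((holes T ! j) p) = P ((holes T ! j) (mate (ts ! j) p)))" for P
    using invariant_on_closed[of ts T e ?\<tau> P] t2' type(1) len(1) by simp
  have inv_X: "invariant_on (closed_arcs (ts ! j) (Xs ! j) (?\<rho> j) (\<alpha>s ! j)) P \<longleftrightarrow>
     invariant_on (state_arcs (Xs ! j) (?\<rho> j) (\<alpha>s ! j)) P
     \<and> (\<forall>p. P (outer (Xs ! j) p) = P (outer (Xs ! j) (mate (1 - ts ! j) p)))" if "j < ?n" for j P
    unfolding closed_arcs_def invariant_on_Un invariant_on_outer_quad[OF t2[OF that]] ..
  have mate: "P (outer (Xs ! j) p) = P (outer (Xs ! j) (mate (ts ! j) p))"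
    if "invariant_on (state_arcs (Xs ! j) (?\<rho> j) (\<alpha>s ! j)) P" "j < ?n" for P j p
  proof (rule linked_invariant_on[OF _ that(1)])
    show "(outer (Xs ! j) p, outer (Xs ! j) (mate (ts ! j) p)) \<in> ?L j"
      unfolding L[OF that(2)] by blast
  qed
  note darts = darts_compose[OF len(1)]
  show ?thesis
  proof (intro iffI conjI allI impI)
    assume "closed_connected e T ?\<tau> ts
       \<and> (\<forall>j<?n. closed_connected (ts ! j) (Xs ! j) (?\<rho> j) (\<alpha>s ! j))"
    then have cT: "closed_connected e T ?\<tau> ts"
      and cX: "\<And>j. j < ?n \<Longrightarrow> closed_connected (ts ! j) (Xs ! j) (?\<rho> j) (\<alpha>s ! j)"
      by simp_all
    have T: "P x = P y"
      if "invariant_on (closed_arcs e T ?\<tau> ts) P" "x \<in> darts T" "y \<in> darts T" for P x y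
      using cT that unfolding closed_connected_def connected_by_iff by metis
    have X: "P x = P y"
      if "j < ?n" "invariant_on (closed_arcs (ts ! j) (Xs ! j) (?\<rho> j) (\<alpha>s ! j)) P"
        "x \<in> darts (Xs ! j)" "y \<in> darts (Xs ! j)" for j P x y
      using cX[OF that(1)] that(2-) unfolding closed_connected_def connected_by_iff by metis
    show "closed_connected e ?U \<sigma> (concat \<alpha>s)"
      unfolding closed_connected_def connected_by_iff
    proof (intro allI impI)
      fix P assume P: "invariant_on (closed_arcs e ?U \<sigma> (concat \<alpha>s)) P"
      define v where "v = P (Inl (outer T NW))"
      have glue: "P (Inl ((holes T ! j) p)) = P (part j (outer (Xs ! j) p))" if "j < ?n" for j p
        using P that unfolding inv_U by blast
      have state: "invariant_on (state_arcs (Xs ! j) (?\<rho> j) (\<alpha>s ! j)) (P \<circ> part j)" if "j < ?n" for j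
        using P that unfolding inv_U by blast
      have base: "invariant_on (base_arcs T ?\<tau> \<union> quad_arcs (e = 0) (outer_quad (outer T))) (P \<circ> Inl)"
        using P unfolding inv_U by blast
      have "(P \<circ> Inl) ((holes T ! j) p) = (P \<circ> Inl) ((holes T ! j) (mate (ts ! j) p))" if "j < ?n" for j p
        using mate[OF state[OF that] that, of p] glue[OF that] unfolding comp_apply by metis
      with base have "invariant_on (closed_arcs e T ?\<tau> ts) (P \<circ> Inl)"
        unfolding inv_T by blast
      from T[OF this] have Tv: "P (Inl x) = v" if "x \<in> darts T" for x
        using that unfolding v_def by (metis comp_apply outer_in_darts)
      have Ov: "P (part j (outer (Xs ! j) p)) = v" if "j < ?n" for j p
      proof -
        have "(holes T ! j) p \<in> darts T"
          using that len(1) by (intro range_subset_hole) simp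
        then show ?thesis using Tv glue[OF that] by metis
      qed
      have Xv: "P (part j x) = v" if "j < ?n" "x \<in> darts (Xs ! j)" for j x
      proof -
        have "invariant_on (closed_arcs (ts ! j) (Xs ! j) (?\<rho> j) (\<alpha>s ! j)) (P \<circ> part j)"
          unfolding inv_X[OF that(1)] using state[OF that(1)] Ov[OF that(1)] by simp
        from X[OF that(1) this that(2) outer_in_darts]
        have "(P \<circ> part j) x = (P \<circ> part j) (outer (Xs ! j) NW)" .
        then show ?thesis using Ov[OF that(1)] by simp
      qed
      have "P x = v" if "x \<in> darts ?U" for x
        using that Tv Xv unfolding darts by auto
      then show "\<forall>x\<in>darts ?U. \<forall>y\<in>darts ?U. P x = P y"
        by simp
    qed
  next
    assume "closed_connected e ?U \<sigma> (concat \<alpha>s)"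
    then have U: "P x = P y"
      if "invariant_on (closed_arcs e ?U \<sigma> (concat \<alpha>s)) P" "x \<in> darts ?U" "y \<in> darts ?U" for P x y
      using that unfolding closed_connected_def connected_by_iff by metis
    show "closed_connected e T ?\<tau> ts"
      unfolding closed_connected_def connected_by_iff
    proof (intro allI impI)
      fix P assume P: "invariant_on (closed_arcs e T ?\<tau> ts) P"
      \<comment> \<open>\<open>Q\<close> follows the strands from the holes into the parts and is false on closed curves there.\<close>
      define Q where "Q z = (case z of Inl x \<Rightarrow> P x
        | Inr (j, y) \<Rightarrow> \<exists>p. (y, outer (Xs ! j) p) \<in> ?L j \<and> P ((holes T ! j) p))" for z
      have "invariant_on (closed_arcs e ?U \<sigma> (concat \<alpha>s)) Q"
        unfolding inv_U
      proof (intro conjI allI impI)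
        have "Q \<circ> Inl = P" by (auto simp: Q_def)
        then show "invariant_on (base_arcs T ?\<tau> \<union> quad_arcs (e = 0) (outer_quad (outer T))) (Q \<circ> Inl)"
          using P unfolding inv_T by simp
      next
        fix j assume j: "j < ?n"
        show "invariant_on (state_arcs (Xs ! j) (?\<rho> j) (\<alpha>s ! j)) (Q \<circ> part j)"
          unfolding invariant_on_def
        proof clarify
          fix x y assume "(x, y) \<in> state_arcs (Xs ! j) (?\<rho> j) (\<alpha>s ! j)"
          then have "(x, z) \<in> ?L j \<longleftrightarrow> (y, z) \<in> ?L j" for z
            using invariant_on_linked[of "state_arcs (Xs ! j) (?\<rho> j) (\<alpha>s ! j)" z]
            unfolding invariant_on_def by blast
          then show "(Q \<circ> part j) x = (Q \<circ> part j) y" by (simp add: Q_def)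
        qed
        fix p
        have "P ((holes T ! j) p) = P ((holes T ! j) (mate (ts ! j) p))"
          using P j unfolding inv_T by blast
        then show "Q (Inl ((holes T ! j) p)) = Q (part j (outer (Xs ! j) p))"
          using L[OF j] by (auto simp: Q_def)
      qed
      note const = U[OF this]
      show "\<forall>x\<in>darts T. \<forall>y\<in>darts T. P x = P y"
      proof (intro ballI)
        fix x y assume "x \<in> darts T" "y \<in> darts T"
        then have "Q (Inl x) = Q (Inl y)"
          by (intro const) (simp_all add: darts)
        then show "P x = P y" by (simp add: Q_def)
      qed
    qed
    fix j assume j: "j < ?n"
    show "closed_connected (ts ! j) (Xs ! j) (?\<rho> j) (\<alpha>s ! j)"
      unfolding closed_connected_def connected_by_iff
    proof (intro allI impI)
      fix P assume P: "invariant_on (closed_arcs (ts ! j) (Xs ! j) (?\<rho> j) (\<alpha>s ! j)) P"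
      define v where "v = P (outer (Xs ! j) NW)"
      have v: "P (outer (Xs ! j) p) = v" for p
      proof -
        have "invariant_on (state_arcs (Xs ! j) (?\<rho> j) (\<alpha>s ! j)) P"
          using P unfolding inv_X[OF j] by blast
        note inner = mate[OF this j]
        have outer: "P (outer (Xs ! j) p) = P (outer (Xs ! j) (mate (1 - ts ! j) p))" for p
          using P unfolding inv_X[OF j] by blast
        show ?thesis
          unfolding v_def
          by (rule mates_connect_corners[where f = "\<lambda>p. P (outer (Xs ! j) p)", OF t2[OF j] inner outer])
      qed
      define Q where "Q z = (case z of Inl x \<Rightarrow> v | Inr (j', y) \<Rightarrow> if j' = j then P y else v)"
        for z :: "'a + nat \<times> 'b"
      have "invariant_on (closed_arcs e ?U \<sigma> (concat \<alpha>s)) Q"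
        unfolding inv_U
      proof (intro conjI allI impI)
        show "invariant_on (base_arcs T ?\<tau> \<union> quad_arcs (e = 0) (outer_quad (outer T))) (Q \<circ> Inl)"
          by (simp add: invariant_on_def Q_def)
        fix j'
        show "invariant_on (state_arcs (Xs ! j') (?\<rho> j') (\<alpha>s ! j')) (Q \<circ> part j')"
        proof (cases "j' = j")
          case True
          then have "Q \<circ> part j' = P" by (auto simp: Q_def)
          then show ?thesis using P True unfolding inv_X[OF j] by simp
        qed (simp add: invariant_on_def Q_def)
        show "Q (Inl ((holes T ! j') p)) = Q (part j' (outer (Xs ! j') p))" for p
          using v by (simp add: Q_def)
      qed
      note const = U[OF this]
      show "\<forall>x\<in>darts (Xs ! j). \<forall>y\<in>darts (Xs ! j). P x = P y"
      proof (intro ballI)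
        fix x y assume "x \<in> darts (Xs ! j)" "y \<in> darts (Xs ! j)"
        then have "Q (part j x) = Q (part j y)"
          using j by (intro const) (auto simp: darts)
        then show "P x = P y" by (simp add: Q_def)
      qed
    qed
  qed
qed

section \<open>State sums and brackets\<close>

lemma bracket_A_nonzero [simp]: "bracket_A \<noteq> 0"
  by (simp add: bracket_A_def)

lemma bracket_A_power_2: "bracket_A ^ 2 = \<i>"
proof -
  have "bracket_A ^ 2 = exp (\<i> * of_real (pi / 2))"
    unfolding bracket_A_def exp_double[symmetric] by simp
  also have "\<dots> = \<i>"
    by (simp add: exp_eq_polar)
  finally show ?thesis .
qed

lemma loop_value: "- (bracket_A powi 2) - bracket_A powi (- 2) = 0"
proof -
  have "bracket_A powi 2 = \<i>"
    using bracket_A_power_2 by (simp add: power_int_def)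
  moreover have "bracket_A powi (- 2) = - \<i>"
    using bracket_A_power_2 by (simp add: power_int_minus)
  ultimately show ?thesis by simp
qed

definition state_weight :: "'q set \<Rightarrow> 'q set \<Rightarrow> complex" where
  "state_weight C \<sigma> = bracket_A powi (int (card \<sigma>) - int (card (C - \<sigma>)))"

lemma state_weight_prod:
  assumes "finite C" "\<sigma> \<subseteq> C"
  shows "state_weight C \<sigma> = (\<Prod>q\<in>C. if q \<in> \<sigma> then bracket_A else inverse bracket_A)"
proof -
  have "(\<Prod>q\<in>C. if q \<in> \<sigma> then bracket_A else inverse bracket_A)
      = (\<Prod>q\<in>C \<inter> {q. q \<in> \<sigma>}. bracket_A) * (\<Prod>q\<in>C \<inter> - {q. q \<in> \<sigma>}. inverse bracket_A)"
    using assms(1) by (rule prod.If_cases)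
  also have "C \<inter> {q. q \<in> \<sigma>} = \<sigma>" using assms(2) by blast
  also have "C \<inter> - {q. q \<in> \<sigma>} = C - \<sigma>" by blast
  also have "(\<Prod>q\<in>\<sigma>. bracket_A) * (\<Prod>q\<in>C - \<sigma>. inverse bracket_A) = state_weight C \<sigma>"
    by (simp add: state_weight_def power_int_diff power_inverse divide_inverse)
  finally show ?thesis by simp
qed

text \<open>
  The bracket of the link diagram obtained from \<open>T\<close> with fundamental tangles \<open>is\<close> in the holes and
  closure \<open>e\<close>; states with more than one circle have weight zero.
\<close>

definition state_sum :: "'d tangle_diagram \<Rightarrow> nat \<Rightarrow> nat list \<Rightarrow> complex" where
  "state_sum T e is = (\<Sum>\<sigma>\<in>Pow (set (crossings T)).
     state_weight (set (crossings T)) \<sigma> * of_bool (closed_connected e T \<sigma> is))"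

lemma binary_dict_iff: "is \<in> set (dict (replicate n 2)) \<longleftrightarrow> length is = n \<and> (\<forall>i\<in>set is. i < 2)"
  by (auto simp: set_dict list_all2_conv_all_nth all_set_conv_all_nth)

lemma map_quad_eq_iff:
  "inj f \<Longrightarrow> map_quad f q \<in> map_quad f ` S \<longleftrightarrow> q \<in> S"
  by (simp add: inj_image_mem_iff inj_map_quad)

lemma inj_part: "inj (part j)"
  by (simp add: inj_def)

lemma map_quad_Inl_neq_part: "map_quad Inl q \<noteq> map_quad (part j) q'"
  by (cases q; cases q') (simp add: map_quad_def)

lemma map_quad_part_neq: "i \<noteq> j \<Longrightarrow> map_quad (part i) q \<noteq> map_quad (part j) q'"
  by (cases q; cases q') (simp add: map_quad_def)

text \<open>
  The union of a state of the outer diagram and states of the parts.  Applied to the sets of all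
  crossings it gives the crossings of the composite.
\<close>

definition join_states :: "nat \<Rightarrow> 'a quad set \<Rightarrow> (nat \<Rightarrow> 'b quad set) \<Rightarrow> ('a + nat \<times> 'b) quad set" where
  "join_states n \<tau> g = map_quad Inl ` \<tau> \<union> (\<Union>j<n. map_quad (part j) ` g j)"

lemma vimage_join_states:
  fixes \<tau> :: "'a quad set" and g :: "nat \<Rightarrow> 'b quad set"
  shows "map_quad Inl -` join_states n \<tau> g = \<tau>"
  "j < n \<Longrightarrow> map_quad (part j) -` join_states n \<tau> g = g j"
proof -
  show "map_quad Inl -` join_states n \<tau> g = \<tau>"
  proof (rule Set.set_eqI)
    fix q :: "'a quad"
    have "map_quad Inl q \<notin> map_quad (part j) ` g j" for j
      using map_quad_Inl_neq_part by (metis imageE)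
    moreover have "(map_quad Inl q :: ('a + nat \<times> 'b) quad) \<in> map_quad Inl ` \<tau> \<longleftrightarrow> q \<in> \<tau>"
      by (rule map_quad_eq_iff[OF inj_Inl])
    ultimately show "q \<in> map_quad Inl -` join_states n \<tau> g \<longleftrightarrow> q \<in> \<tau>"
      by (simp add: join_states_def)
  qed
  show "map_quad (part j) -` join_states n \<tau> g = g j" if "j < n"
  proof (rule Set.set_eqI)
    fix q :: "'b quad"
    have "map_quad (part j) q \<in> map_quad (part j') ` g j' \<longleftrightarrow> j' = j \<and> q \<in> g j" for j'
    proof (cases "j' = j")
      case False
      then have "map_quad (part j) q \<notin> map_quad (part j') ` g j'"
        using map_quad_part_neq by (metis imageE)
      then show ?thesis using False by blast
    qed (simp add: map_quad_eq_iff[OF inj_part])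
    moreover have "map_quad (part j) q \<notin> map_quad Inl ` \<tau>"
      using map_quad_Inl_neq_part by (metis imageE)
    ultimately show "q \<in> map_quad (part j) -` join_states n \<tau> g \<longleftrightarrow> q \<in> g j"
      using that by (auto simp: join_states_def)
  qed
qed

lemma join_states_iff:
  "map_quad Inl q \<in> join_states n \<tau> g \<longleftrightarrow> q \<in> \<tau>"
  "j < n \<Longrightarrow> map_quad (part j) q' \<in> join_states n \<tau> g \<longleftrightarrow> q' \<in> g j"
  using vimage_join_states(1)[of n \<tau> g] vimage_join_states(2)[of j n \<tau> g] by blast+

lemma join_states_mono:
  "\<tau> \<subseteq> C \<Longrightarrow> (\<And>j. j < n \<Longrightarrow> g j \<subseteq> B j) \<Longrightarrow> join_states n \<tau> g \<subseteq> join_states n C B"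
  unfolding join_states_def by (intro Un_mono image_mono UN_mono) auto

lemma state_weight_join:
  fixes C \<tau> :: "'a quad set" and B g :: "nat \<Rightarrow> 'b quad set"
  assumes "finite C" "\<And>j. j < n \<Longrightarrow> finite (B j)" "\<tau> \<subseteq> C" "\<And>j. j < n \<Longrightarrow> g j \<subseteq> B j"
  shows "state_weight (join_states n C B) (join_states n \<tau> g)
           = state_weight C \<tau> * (\<Prod>j<n. state_weight (B j) (g j))"
proof -
  let ?S = "join_states n \<tau> g"
  define w where "w q = (if q \<in> ?S then bracket_A else inverse bracket_A)" for q
  have "?S \<subseteq> join_states n C B"
    using assms(3,4) by (rule join_states_mono)
  moreover have "finite (join_states n C B)"
    using assms(1,2) by (auto simp: join_states_def)
  ultimately have "state_weight (join_states n C B) ?S = (\<Prod>q\<in>join_states n C B. w q)"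
    by (simp add: state_weight_prod w_def)
  also have "\<dots> = (\<Prod>q\<in>map_quad Inl ` C. w q) * (\<Prod>q\<in>(\<Union>j<n. map_quad (part j) ` B j). w q)"
    unfolding join_states_def
  proof (rule prod.union_disjoint)
    have "x \<notin> (\<Union>j<n. map_quad (part j) ` B j)" if x: "x \<in> map_quad Inl ` C" for x :: "('a + nat \<times> 'b) quad"
    proof
      assume "x \<in> (\<Union>j<n. map_quad (part j) ` B j)"
      then obtain j q' where "x = map_quad (part j) q'" by blast
      moreover obtain q where "x = map_quad Inl q" using x by blast
      ultimately show False using map_quad_Inl_neq_part by metis
    qed
    then show "map_quad Inl ` C \<inter> (\<Union>j<n. map_quad (part j) ` B j) = {}"
      by blast
  qed (use assms in auto)
  also have "(\<Prod>q\<in>map_quad Inl ` C. w q) = (\<Prod>q\<in>C. w (map_quad Inl q))"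
    by (rule prod.reindex_cong[OF inj_on_subset[OF inj_map_quad[OF inj_Inl]]]) auto
  also have "\<dots> = state_weight C \<tau>"
    using assms by (simp add: state_weight_prod w_def join_states_iff)
  also have "(\<Prod>q\<in>(\<Union>j<n. map_quad (part j) ` B j). w q) = (\<Prod>j<n. \<Prod>q\<in>map_quad (part j) ` B j. w q)"
  proof (rule prod.UNION_disjoint)
    have disj: "x \<notin> map_quad (part j) ` B j" if "i \<noteq> j" and x: "x \<in> map_quad (part i) ` B i"
      for i j and x :: "('a + nat \<times> 'b) quad"
    proof
      assume "x \<in> map_quad (part j) ` B j"
      then obtain q' where "x = map_quad (part j) q'" by blast
      moreover obtain q where "x = map_quad (part i) q" using x by blast
      ultimately show False using map_quad_part_neq[OF \<open>i \<noteq> j\<close>] by metis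
    qed
    show "\<forall>i\<in>{..<n}. \<forall>j\<in>{..<n}. i \<noteq> j \<longrightarrow>
        map_quad (part i) ` B i \<inter> map_quad (part j) ` B j = ({} :: ('a + nat \<times> 'b) quad set)"
    proof (intro ballI impI)
      fix i j :: nat assume "i \<noteq> j"
      show "map_quad (part i) ` B i \<inter> map_quad (part j) ` B j = ({} :: ('a + nat \<times> 'b) quad set)"
      proof (rule equals0I)
        fix x :: "('a + nat \<times> 'b) quad"
        assume "x \<in> map_quad (part i) ` B i \<inter> map_quad (part j) ` B j"
        with disj[OF \<open>i \<noteq> j\<close> IntD1[OF this]] IntD2[OF this] show False
          by (elim notE)
      qed
    qed
  qed (use assms in auto)
  also have "\<dots> = (\<Prod>j<n. state_weight (B j) (g j))"
  proof (rule prod.cong[OF refl])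
    fix j assume j: "j \<in> {..<n}"
    have "(\<Prod>q\<in>map_quad (part j) ` B j. w q) = (\<Prod>q\<in>B j. w (map_quad (part j) q))"
      by (rule prod.reindex_cong[OF inj_on_subset[OF inj_map_quad[OF inj_part]]]) auto
    also have "\<dots> = state_weight (B j) (g j)"
      using assms j by (simp add: state_weight_prod w_def join_states_iff)
    finally show "(\<Prod>q\<in>map_quad (part j) ` B j. w q) = state_weight (B j) (g j)" .
  qed
  finally show ?thesis .
qed

lemma sum_over_composite_states:
  fixes C :: "'a quad set" and B :: "nat \<Rightarrow> 'b quad set"
  shows "(\<Sum>\<sigma>\<in>Pow (join_states n C B). f \<sigma>)
     = (\<Sum>\<tau>\<in>Pow C. \<Sum>g\<in>PiE {..<n} (\<lambda>j. Pow (B j)). f (join_states n \<tau> g))"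
proof -
  let ?G = "PiE {..<n} (\<lambda>j. Pow (B j))"
  have "(\<Sum>\<sigma>\<in>Pow (join_states n C B). f \<sigma>)
     = (\<Sum>(\<tau>, g)\<in>Pow C \<times> ?G. f (join_states n \<tau> g))"
  proof (rule sum.reindex_bij_witness[where i = "\<lambda>(\<tau>, g). join_states n \<tau> g"
        and j = "\<lambda>\<sigma>. (map_quad Inl -` \<sigma>, \<lambda>j\<in>{..<n}. map_quad (part j) -` \<sigma>)"])
    fix \<sigma> assume \<sigma>: "\<sigma> \<in> Pow (join_states n C B)"
    have "q \<in> \<sigma> \<longleftrightarrow> q \<in> join_states n (map_quad Inl -` \<sigma>) (\<lambda>j\<in>{..<n}. map_quad (part j) -` \<sigma>)" for q
      using \<sigma> by (fastforce simp: join_states_def)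
    then have eq: "join_states n (map_quad Inl -` \<sigma>) (\<lambda>j\<in>{..<n}. map_quad (part j) -` \<sigma>) = \<sigma>"
      by blast
    then show "(case (map_quad Inl -` \<sigma>, \<lambda>j\<in>{..<n}. map_quad (part j) -` \<sigma>) of
        (\<tau>, g) \<Rightarrow> join_states n \<tau> g) = \<sigma>" by simp
    show "(case (map_quad Inl -` \<sigma>, \<lambda>j\<in>{..<n}. map_quad (part j) -` \<sigma>) of
        (\<tau>, g) \<Rightarrow> f (join_states n \<tau> g)) = f \<sigma>" using eq by simp
    have "map_quad Inl -` \<sigma> \<subseteq> C"
      using \<sigma> vimage_join_states(1)[of n C B] by blast
    moreover have "map_quad (part j) -` \<sigma> \<subseteq> B j" if "j < n" for j
      using \<sigma> vimage_join_states(2)[OF that, of C B] by blast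
    ultimately show "(map_quad Inl -` \<sigma>, \<lambda>j\<in>{..<n}. map_quad (part j) -` \<sigma>) \<in> Pow C \<times> ?G"
      by (simp add: restrict_PiE_iff)
  next
    fix x assume x: "x \<in> Pow C \<times> ?G"
    obtain \<tau> g where \<tau>g: "x = (\<tau>, g)" by (cases x)
    then have "(\<lambda>j\<in>{..<n}. g j) = g" using x by (auto intro: PiE_restrict)
    then have "(\<lambda>j\<in>{..<n}. map_quad (part j) -` join_states n \<tau> g) = g"
      by (simp add: vimage_join_states cong: restrict_cong)
    then show "(map_quad Inl -` (case x of (\<tau>, g) \<Rightarrow> join_states n \<tau> g),
        \<lambda>j\<in>{..<n}. map_quad (part j) -` (case x of (\<tau>, g) \<Rightarrow> join_states n \<tau> g)) = x"
      by (simp add: \<tau>g vimage_join_states)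
    show "(case x of (\<tau>, g) \<Rightarrow> join_states n \<tau> g) \<in> Pow (join_states n C B)"
    proof -
      have "join_states n \<tau> g \<subseteq> join_states n C B"
        using x by (intro join_states_mono) (auto simp: \<tau>g PiE_def Pi_def)
      then show ?thesis by (simp add: \<tau>g)
    qed
  qed
  then show ?thesis by (simp add: sum.cartesian_product)
qed

text \<open>
  At most one word gives a non-zero summand, namely the word of the types of the strands in the
  parts.
\<close>

lemma of_bool_connected_compose:
  assumes len: "length Xs = length (holes T)" "length \<alpha>s = length Xs"
    and holes: "\<forall>j<length Xs. length (\<alpha>s ! j) = length (holes (Xs ! j))"
    and cb: "\<forall>j<length Xs. \<exists>\<kappa>. checkerboard \<kappa> (Xs ! j)"
  shows "(of_bool (closed_connected e (compose T Xs) \<sigma> (concat \<alpha>s)) :: complex)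
     = (\<Sum>is\<in>set (dict (replicate (length Xs) 2)). of_bool (closed_connected e T (map_quad Inl -` \<sigma>) is)
          * (\<Prod>j<length Xs. of_bool (closed_connected (is ! j) (Xs ! j) (map_quad (part j) -` \<sigma>) (\<alpha>s ! j))))"
proof -
  let ?n = "length Xs" and ?I = "set (dict (replicate (length Xs) 2))"
  let ?f = "\<lambda>is. of_bool (closed_connected e T (map_quad Inl -` \<sigma>) is)
          * (\<Prod>j<?n. of_bool (closed_connected (is ! j) (Xs ! j) (map_quad (part j) -` \<sigma>) (\<alpha>s ! j))) :: complex"
  have "\<exists>t. strands_type t (Xs ! j) (map_quad (part j) -` \<sigma>) (\<alpha>s ! j)" if "j < ?n" for j
    using cb holes that strands_type_exists by metis
  then obtain t where t: "\<And>j. j < ?n \<Longrightarrow> strands_type (t j) (Xs ! j) (map_quad (part j) -` \<sigma>) (\<alpha>s ! j)"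
    by metis
  define ts where "ts = map t [0..<?n]"
  have ts: "length ts = ?n" "\<And>j. j < ?n \<Longrightarrow> strands_type (ts ! j) (Xs ! j) (map_quad (part j) -` \<sigma>) (\<alpha>s ! j)"
    using t by (simp_all add: ts_def)
  then have "ts \<in> ?I"
    unfolding binary_dict_iff strands_type_def by (auto simp: in_set_conv_nth)
  have other: "?f is = 0" if "is \<in> ?I - {ts}" for "is"
  proof -
    have "is \<noteq> ts" "length is = ?n" "\<forall>j<?n. is ! j < 2"
      using that unfolding binary_dict_iff Diff_iff by auto
    then obtain j where j: "j < ?n" "is ! j \<noteq> ts ! j" "is ! j < 2"
      using ts(1) by (metis nth_equalityI)
    then have "\<not> closed_connected (is ! j) (Xs ! j) (map_quad (part j) -` \<sigma>) (\<alpha>s ! j)"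
      using closed_connected_type ts(2) by metis
    then have "(\<Prod>j<?n. of_bool (closed_connected (is ! j) (Xs ! j) (map_quad (part j) -` \<sigma>) (\<alpha>s ! j))) = (0::complex)"
      using j(1) by (intro prod_zero) auto
    then show ?thesis by simp
  qed
  have "(\<Sum>is\<in>?I. ?f is) = ?f ts + (\<Sum>is\<in>?I - {ts}. ?f is)"
    using \<open>ts \<in> ?I\<close> by (intro sum.remove) auto
  also have "(\<Sum>is\<in>?I - {ts}. ?f is) = 0"
    using other by (rule sum.neutral[OF ballI])
  also have "?f ts = of_bool (closed_connected e T (map_quad Inl -` \<sigma>) ts
      \<and> (\<forall>j<?n. closed_connected (ts ! j) (Xs ! j) (map_quad (part j) -` \<sigma>) (\<alpha>s ! j)))"
    by (auto simp: prod_zero_iff intro!: prod.neutral)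
  also have "\<dots> = of_bool (closed_connected e (compose T Xs) \<sigma> (concat \<alpha>s))"
    by (simp only: closed_connected_compose[OF len holes ts])
  finally show ?thesis by simp
qed

text \<open>
  Weights are multiplicative, so the sum over the states of the composite factors once the types
  of the parts are fixed.
\<close>

theorem state_sum_compose:
  assumes len: "length Xs = length (holes T)" "length \<alpha>s = length Xs"
    and holes: "\<forall>j<length Xs. length (\<alpha>s ! j) = length (holes (Xs ! j))"
    and cb: "\<forall>j<length Xs. \<exists>\<kappa>. checkerboard \<kappa> (Xs ! j)"
  shows "state_sum (compose T Xs) e (concat \<alpha>s)
     = (\<Sum>is\<in>set (dict (replicate (length Xs) 2)).
          state_sum T e is * (\<Prod>j<length Xs. state_sum (Xs ! j) (is ! j) (\<alpha>s ! j)))"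
proof -
  let ?n = "length Xs" and ?I = "set (dict (replicate (length Xs) 2))"
  let ?C = "set (crossings T)" and ?B = "\<lambda>j. set (crossings (Xs ! j))"
  let ?G = "PiE {..<?n} (\<lambda>j. Pow (?B j))"
  let ?a = "\<lambda>\<tau> is. state_weight ?C \<tau> * of_bool (closed_connected e T \<tau> is)"
  let ?b = "\<lambda>is j \<rho>. state_weight (?B j) \<rho> * of_bool (closed_connected (is ! j) (Xs ! j) \<rho> (\<alpha>s ! j))"
  have C: "set (crossings (compose T Xs)) = join_states ?n ?C ?B"
    by (simp add: set_crossings_compose join_states_def)
  have term_eq: "state_weight (join_states ?n ?C ?B) (join_states ?n \<tau> g)
        * of_bool (closed_connected e (compose T Xs) (join_states ?n \<tau> g) (concat \<alpha>s))
      = (\<Sum>is\<in>?I. ?a \<tau> is * (\<Prod>j<?n. ?b is j (g j)))" if "\<tau> \<in> Pow ?C" "g \<in> ?G" for \<tau> g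
  proof -
    have w: "state_weight (join_states ?n ?C ?B) (join_states ?n \<tau> g)
        = state_weight ?C \<tau> * (\<Prod>j<?n. state_weight (?B j) (g j))"
      using that by (intro state_weight_join) auto
    have c: "of_bool (closed_connected e (compose T Xs) (join_states ?n \<tau> g) (concat \<alpha>s))
      = (\<Sum>is\<in>?I. of_bool (closed_connected e T \<tau> is)
          * (\<Prod>j<?n. of_bool (closed_connected (is ! j) (Xs ! j) (g j) (\<alpha>s ! j))) :: complex)"
      unfolding of_bool_connected_compose[OF len holes cb] vimage_join_states(1)
      by (intro sum.cong prod.cong arg_cong2[where f = "(*)"] refl) (simp add: vimage_join_states)
    show ?thesis
      unfolding w c sum_distrib_left
      by (rule sum.cong[OF refl]) (simp add: prod.distrib mult_ac)
  qed
  have "state_sum (compose T Xs) e (concat \<alpha>s) = (\<Sum>\<tau>\<in>Pow ?C. \<Sum>g\<in>?G.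
        state_weight (join_states ?n ?C ?B) (join_states ?n \<tau> g)
        * of_bool (closed_connected e (compose T Xs) (join_states ?n \<tau> g) (concat \<alpha>s)))"
    unfolding state_sum_def C by (rule sum_over_composite_states)
  also have "\<dots> = (\<Sum>\<tau>\<in>Pow ?C. \<Sum>g\<in>?G. \<Sum>is\<in>?I. ?a \<tau> is * (\<Prod>j<?n. ?b is j (g j)))"
    using term_eq by (intro sum.cong[OF refl])
  also have "\<dots> = (\<Sum>\<tau>\<in>Pow ?C. \<Sum>is\<in>?I. \<Sum>g\<in>?G. ?a \<tau> is * (\<Prod>j<?n. ?b is j (g j)))"
    by (intro sum.cong[OF refl] sum.swap)
  also have "\<dots> = (\<Sum>is\<in>?I. \<Sum>\<tau>\<in>Pow ?C. \<Sum>g\<in>?G. ?a \<tau> is * (\<Prod>j<?n. ?b is j (g j)))"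
    by (rule sum.swap)
  also have "\<dots> = (\<Sum>is\<in>?I. (\<Sum>\<tau>\<in>Pow ?C. ?a \<tau> is) * (\<Sum>g\<in>?G. \<Prod>j<?n. ?b is j (g j)))"
    by (simp only: sum_product)
  also have "\<dots> = (\<Sum>is\<in>?I. state_sum T e is * (\<Prod>j<?n. state_sum (Xs ! j) (is ! j) (\<alpha>s ! j)))"
    unfolding state_sum_def
    by (intro sum.cong[OF refl] arg_cong2[where f = "(*)"] refl prod_sum_PiE[symmetric]) auto
  finally show ?thesis .
qed

lemma link_darts_eq:
  fixes L :: "('d, 'm) link_diagram_scheme"
  shows "link_darts L = (\<Union>q\<in>set (crossings L). set (quad_darts q)) \<union> Field (set (joints L))"
proof -
  have Q: "(\<lambda>(a, b, c, d). [a, b, c, d]) = (quad_darts :: 'd quad \<Rightarrow> 'd list)" by (rule ext) auto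
  show ?thesis
    unfolding link_darts_def strand_vertices_def Q concat_append set_append set_concat_pairs
    by simp
qed

lemma bracket_closure:
  assumes "holes U = []" "e < 2"
  shows "bracket (closure e U) = state_sum U e []"
proof -
  have outer: "Field (set (joints (closure e U))) = range (outer U) \<union> Field (set (joints U))"
    by (auto simp: closure_def range_corner)
  have D: "link_darts (closure e U) = darts U"
    unfolding link_darts_eq darts_eq outer using assms(1) by (auto simp: closure_def)
  have "(- (bracket_A powi 2) - bracket_A powi (- 2)) ^ (num_circles (closure e U) \<sigma> - 1)
      = of_bool (closed_connected e U \<sigma> [])" for \<sigma>
  proof -
    let ?R = "arcs (closure e U) (darts U) \<union> splitting_arcs (closure e U) \<sigma>"
    have S: "splitting_arcs (closure e U) \<sigma>
        = (\<Union>q\<in>set (crossings U). quad_arcs (q \<in> \<sigma>) q) \<union> set (joints (closure e U))"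
      unfolding splitting_arcs_def
      by (intro arg_cong2[where f = "(\<union>)"] SUP_cong) (auto simp: closure_def)
    have A: "arcs (closure e U) (darts U) = arcs U (darts U)"
      by (simp add: arcs_def closure_def)
    have J: "invariant_on (set (joints (closure e U))) P
        \<longleftrightarrow> invariant_on (quad_arcs (e = 0) (outer_quad (outer U))) P \<and> invariant_on (set (joints U)) P" for P
      by (auto simp: invariant_on_def closure_def outer_quad_def)
    have "invariant_on ?R P \<longleftrightarrow> invariant_on (closed_arcs e U \<sigma> []) P" for P
      unfolding S A closed_arcs_def state_arcs_def base_arcs_def invariant_on_Un J
      by (auto simp: invariant_on_def)
    then have "connected_by (darts U) ?R \<longleftrightarrow> closed_connected e U \<sigma> []"
      by (simp add: closed_connected_def connected_by_iff)
    moreover have ne: "darts U \<noteq> {}" using outer_in_darts by blast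
    ultimately have "num_circles (closure e U) \<sigma> = 1 \<longleftrightarrow> closed_connected e U \<sigma> []"
      unfolding num_circles_def D num_components_eq_1_iff[OF ne] connected_by_def by blast
    moreover have "num_circles (closure e U) \<sigma> > 0"
      unfolding num_circles_def D using ne by (intro num_components_pos) auto
    ultimately show ?thesis
      unfolding loop_value by (cases "num_circles (closure e U) \<sigma> = 1") auto
  qed
  then show ?thesis
    by (simp add: bracket_def state_sum_def state_weight_def closure_def)
qed

lemma state_sum_fundamental_tangle:
  assumes "a < 2" "i < 2"
  shows "state_sum (fundamental_tangle a) i [] = of_bool (a = i)"
proof -
  have D: "darts (fundamental_tangle a) = UNIV"
    by (auto simp: darts_eq fundamental_tangle_def)
  have inv: "invariant_on (closed_arcs i (fundamental_tangle a) {} []) P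
      \<longleftrightarrow> (\<forall>p. P p = P (mate a p)) \<and> (\<forall>p. P p = P (mate (1 - i) p))" for P
  proof -
    have "invariant_on (state_arcs (fundamental_tangle a) {} []) P \<longleftrightarrow> (\<forall>p. P p = P (mate a p))"
      unfolding state_arcs_def base_arcs_def D invariant_on_Un invariant_on_arcs
      by (simp add: invariant_on_def fundamental_tangle_def)
    moreover have "outer (fundamental_tangle a) = id" by (simp add: fundamental_tangle_def)
    ultimately show ?thesis
      unfolding closed_arcs_def invariant_on_Un invariant_on_outer_quad[OF assms(2)] by simp
  qed
  have "closed_connected i (fundamental_tangle a) {} [] \<longleftrightarrow> a = i"
  proof
    assume "a = i"
    then show "closed_connected i (fundamental_tangle a) {} []"
      unfolding closed_connected_def connected_by_iff inv
      using mates_connect_corners[OF assms(2)] by blast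
  next
    assume c: "closed_connected i (fundamental_tangle a) {} []"
    show "a = i"
    proof (rule ccontr)
      assume "a \<noteq> i"
      then have "invariant_on (closed_arcs i (fundamental_tangle a) {} []) (\<lambda>p. p \<in> {NW, mate a NW})"
        unfolding inv using less_2_cases[OF assms(1)] less_2_cases[OF assms(2)]
        by (auto simp: all_corners)
      with c have "\<forall>x. \<forall>y. (x \<in> {NW, mate a NW}) = (y \<in> {NW, mate a NW})"
        unfolding closed_connected_def connected_by_iff D by blast
      then have "SE \<in> {NW, mate a NW}" by blast
      then show False using less_2_cases[OF assms(1)] by auto
    qed
  qed
  moreover have "crossings (fundamental_tangle a) = []" by (simp add: fundamental_tangle_def)
  ultimately show ?thesis
    by (simp add: state_sum_def state_weight_def)
qed

text \<open>
  The gluing formula for fundamental tangles as parts, whose state sums are Kronecker deltas.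
\<close>

theorem bracket_filled:
  assumes \<alpha>: "\<alpha> \<in> set (dict (replicate n 2))" and n: "length (holes T) = n" and e: "e < 2"
  shows "bracket (closure e (compose T (map fundamental_tangle \<alpha>))) = state_sum T e \<alpha>"
proof -
  let ?Xs = "map fundamental_tangle \<alpha>" and ?I = "set (dict (replicate n 2))"
  have len: "length \<alpha> = n" and \<alpha>2: "\<And>j. j < n \<Longrightarrow> \<alpha> ! j < 2" using \<alpha> by (auto simp: binary_dict_iff)
  have fund_holes: "holes (fundamental_tangle i) = []" for i by (simp add: fundamental_tangle_def)
  have "bracket (closure e (compose T ?Xs)) = state_sum (compose T ?Xs) e []"
    using e by (intro bracket_closure) (simp_all add: compose_simps fund_holes)
  also have "\<dots> = state_sum (compose T ?Xs) e (concat (replicate n []))"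
    by (simp add: concat_replicate_trivial)
  also have "\<dots> = (\<Sum>is\<in>?I. state_sum T e is * (\<Prod>j<n. state_sum (?Xs ! j) (is ! j) (replicate n [] ! j)))"
    using len n checkerboard_fundamental_tangle
    by (subst state_sum_compose) (auto simp: fund_holes)
  also have "\<dots> = (\<Sum>is\<in>?I. if is = \<alpha> then state_sum T e \<alpha> else 0)"
  proof (rule sum.cong[OF refl])
    fix "is" assume I: "is \<in> ?I"
    have "(\<Prod>j<n. state_sum (?Xs ! j) (is ! j) (replicate n [] ! j)) = (\<Prod>j<n. of_bool (\<alpha> ! j = is ! j))"
      using I \<alpha>2 len by (intro prod.cong refl) (auto simp: state_sum_fundamental_tangle binary_dict_iff)
    also have "\<dots> = of_bool (\<forall>j<n. \<alpha> ! j = is ! j)"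
      by (auto simp: prod_zero_iff intro!: prod.neutral)
    also have "(\<forall>j<n. \<alpha> ! j = is ! j) \<longleftrightarrow> is = \<alpha>"
      using I len by (auto simp: binary_dict_iff list_eq_iff_nth_eq)
    finally show "state_sum T e is * (\<Prod>j<n. state_sum (?Xs ! j) (is ! j) (replicate n [] ! j))
        = (if is = \<alpha> then state_sum T e \<alpha> else 0)" by simp
  qed
  also have "\<dots> = state_sum T e \<alpha>"
    using \<alpha> by simp
  finally show ?thesis .
qed

section \<open>Dictionary order of concatenated words\<close>

lemma dict_Nil: "dict [] = [[]]"
  by (simp add: dict_def)

lemma dict_Cons: "dict (m # ms) = concat (map (\<lambda>x. map ((#) x) (dict ms)) [0..<m])"
  by (simp add: dict_def)

lemma length_dict: "length (dict ms) = prod_list ms"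
  by (induction ms) (simp_all add: dict_Nil dict_Cons length_concat comp_def sum_list_triv)

lemma distinct_dict: "distinct (dict ms)"
  unfolding dict_def by (intro distinct_product_lists) auto

lemma concat_concat_map: "concat (concat xsss) = concat (map concat xsss)"
  by (induction xsss) simp_all

lemma dict_append: "dict (ms @ ns) = concat (map (\<lambda>xs. map ((@) xs) (dict ns)) (dict ms))"
proof -
  have "(@) [] = (\<lambda>ys::nat list. ys)" and "\<And>x xs. (@) (x # xs) = (\<lambda>ys::nat list. x # xs @ ys)"
    by (rule ext, simp)+
  then show ?thesis
    by (induction ms) (simp_all add: dict_Nil dict_Cons map_concat comp_def concat_concat_map)
qed

text \<open>
  The dictionary order of concatenated words agrees with the dictionary order of the tuples of
  positions of the factors.
\<close>

lemma dict_concat: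
  "dict (concat mss)
     = map (\<lambda>xs. concat (map2 (\<lambda>ms x. dict ms ! x) mss xs)) (dict (map prod_list mss))"
proof (induction mss)
  case Nil
  then show ?case by (simp add: dict_Nil)
next
  case (Cons ms mss)
  let ?D = "dict (map prod_list mss)"
    and ?c = "\<lambda>xs. concat (map2 (\<lambda>ms x. dict ms ! x) mss xs)"
  have nth: "map ((!) (dict ms)) [0..<prod_list ms] = dict ms"
    using map_nth[of "dict ms"] by (simp add: length_dict)
  have "dict (concat (ms # mss)) = concat (map (\<lambda>xs. map ((@) xs) (dict (concat mss))) (dict ms))"
    by (simp add: dict_append)
  also have "\<dots> = concat (map (\<lambda>xs. map ((@) xs) (dict (concat mss))) (map ((!) (dict ms)) [0..<prod_list ms]))"
    by (simp only: nth)
  also have "\<dots> = concat (map (\<lambda>x. map (\<lambda>xs. dict ms ! x @ ?c xs) ?D) [0..<prod_list ms])"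
    by (simp add: Cons.IH comp_def)
  also have "\<dots> = map (\<lambda>xs. concat (map2 (\<lambda>ms x. dict ms ! x) (ms # mss) xs)) (dict (map prod_list (ms # mss)))"
    by (simp add: dict_Cons map_concat comp_def)
  finally show ?case .
qed

lemma concat_replicates: "concat (map (\<lambda>j. replicate (k j) x) [0..<n]) = replicate (\<Sum>j<n. k j) x"
  by (induction n) (simp_all add: replicate_add)

lemma prod_list_powers: "prod_list (map (\<lambda>j. (a::nat) ^ k j) [0..<n]) = a ^ (\<Sum>j<n. k j)"
  by (induction n) (simp_all add: power_add)

text \<open>
  Column \<open>l\<close> of the composite corresponds to the columns \<open>d ! j\<close> of the parts.
\<close>

lemma dict_binary_blocks:
  assumes "l < 2 ^ (\<Sum>j<n. k j)"
  defines "d \<equiv> dict (map (\<lambda>j. 2 ^ k j) [0..<n]) ! l"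
  shows "dict (replicate (\<Sum>j<n. k j) 2) ! l
           = concat (map (\<lambda>j. dict (replicate (k j) 2) ! (d ! j)) [0..<n])"
    and "\<And>j. j < n \<Longrightarrow> d ! j < 2 ^ k j"
proof -
  let ?mss = "map (\<lambda>j. replicate (k j) (2::nat)) [0..<n]"
  have P: "map prod_list ?mss = map (\<lambda>j. 2 ^ k j) [0..<n]"
    by simp
  have "d \<in> set (dict (map (\<lambda>j. 2 ^ k j) [0..<n]))"
    unfolding d_def using assms(1) by (intro nth_mem) (simp add: length_dict prod_list_powers)
  then have d: "list_all2 (<) d (map (\<lambda>j. 2 ^ k j) [0..<n])"
    unfolding set_dict by simp
  then have len: "length d = n"
    using list_all2_lengthD by fastforce
  show "d ! j < 2 ^ k j" if "j < n" for j
    using list_all2_nthD2[OF d, of j] that by simp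
  have "dict (replicate (\<Sum>j<n. k j) 2) ! l = dict (concat ?mss) ! l"
    by (simp only: concat_replicates)
  also have "\<dots> = concat (map2 (\<lambda>ms x. dict ms ! x) ?mss d)"
    unfolding dict_concat P d_def
    using assms(1) by (intro nth_map) (simp add: length_dict prod_list_powers)
  also have "map2 (\<lambda>ms x. dict ms ! x) ?mss d = map (\<lambda>j. dict (replicate (k j) 2) ! (d ! j)) [0..<n]"
    by (rule nth_equalityI) (simp_all add: len)
  finally show "dict (replicate (\<Sum>j<n. k j) 2) ! l
           = concat (map (\<lambda>j. dict (replicate (k j) 2) ! (d ! j)) [0..<n])" .
qed

lemma length_dict_binary [simp]: "length (dict (replicate n 2)) = 2 ^ n"
  by (simp add: length_dict)

lemma dict_binary_nth: "l < 2 ^ n \<Longrightarrow> dict (replicate n 2) ! l \<in> set (dict (replicate n 2))"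
  by (intro nth_mem) simp

lemma sum_over_dict: "(\<Sum>is\<in>set (dict (replicate n 2)). f is) = (\<Sum>i<2 ^ n. f (dict (replicate n 2) ! i))"
proof -
  have "bij_betw ((!) (dict (replicate n 2))) {..<2 ^ n} (set (dict (replicate n 2)))"
    by (rule bij_betw_nth) (simp_all add: distinct_dict)
  then show ?thesis
    by (rule sum.reindex_bij_betw[symmetric])
qed

section \<open>Integrality of the invariant\<close>

lemma count_list_map_True: "count_list (map P xs) True = length (filter P xs)"
  by (induction xs) auto

lemma count_list_binary:
  "\<forall>i\<in>set is. i < (2::nat) \<Longrightarrow> length (filter (\<lambda>i. i = 0) is) + count_list is 1 = length is"
  by (induction "is") auto

lemma checkerboard_distinct_crossings:
  assumes "checkerboard \<kappa> T"
  shows "distinct (crossings T)"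
proof -
  have "distinct (concat (map quad_darts (crossings T)))"
    using assms by (simp add: checkerboard_def concat_vertices)
  moreover have "removeAll [] (map quad_darts (crossings T)) = map quad_darts (crossings T)"
    by (intro removeAll_id) auto
  ultimately have "distinct (map quad_darts (crossings T))"
    by (simp add: distinct_concat_iff)
  then show ?thesis by (simp add: distinct_map)
qed

text \<open>
  Apply the parity law for smoothings to all crossings, holes and the outer circle at once.  A
  one-circle state is compared with the reference state in which every smoothing is \<open>True\<close>; the
  second fundamental tangles and the denominator closure are the smoothings \<open>False\<close>.
\<close>

lemma one_circle_parity:
  assumes T: "checkerboard \<kappa> T"
  obtains p where "\<And>\<sigma> is e. \<sigma> \<subseteq> set (crossings T) \<Longrightarrow> is \<in> set (dict (replicate (length (holes T)) 2)) \<Longrightarrow>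
    e < 2 \<Longrightarrow> closed_connected e T \<sigma> is \<Longrightarrow> even (card \<sigma> + count_list is 1 + e + p)"
proof -
  interpret coloured_arcs "darts T" "opp T" \<kappa>
    by (rule coloured_arcs_checkerboard[OF T])
  let ?qs = "tangle_quads T @ [outer_quad (outer T)]" and ?J = "set (joints T)"
  define N where "N bs = num_components (darts T) (E \<union> ?J \<union> quads_arcs bs ?qs) + count_list bs True" for bs
  define bs0 where "bs0 = replicate (length ?qs) True"
  have dist: "distinct (concat (tangle_vertices T))" using T by (simp add: checkerboard_def)
  let ?Jd = "set (concat (map (\<lambda>(a, b). [a, b]) (joints T)))"
  have "?Jd = darts T - quads_darts ?qs"
  proof -
    have "darts T = ?Jd \<union> quads_darts ?qs"
      unfolding darts_def concat_vertices quads_darts_def tangle_quads_def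
        map_append concat_append list.map concat.simps append_Nil2 set_append by blast
    moreover have "?Jd \<inter> quads_darts ?qs = {}"
      using dist unfolding concat_vertices quads_darts_def tangle_quads_def
        map_append concat_append list.map concat.simps append_Nil2 distinct_append set_append by blast
    ultimately show ?thesis by blast
  qed
  then have J: "matching \<kappa> (darts T - quads_darts ?qs) ?J"
    using joints_matching[OF T] by simp
  have parity: "even (N bs) \<longleftrightarrow> even (N bs0)" if "length bs = length ?qs" for bs
    unfolding N_def
  proof (rule smoothing_parity)
    show "quads_darts ?qs \<subseteq> darts T"
      unfolding darts_def concat_vertices quads_darts_def tangle_quads_def
        map_append concat_append set_append by auto
    show "distinct (concat (map quad_darts ?qs))"
      using dist unfolding concat_vertices tangle_quads_def map_append concat_append by auto
    show "alternating \<kappa> q" if "q \<in> set ?qs" for q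
      using T that by (auto simp: checkerboard_def tangle_quads_def)
  qed (use J that in \<open>simp_all add: bs0_def\<close>)
  show thesis
  proof
    fix \<sigma> "is" and e :: nat
    assume \<sigma>: "\<sigma> \<subseteq> set (crossings T)" and "is": "is \<in> set (dict (replicate (length (holes T)) 2))"
      and e: "e < 2" and conn: "closed_connected e T \<sigma> is"
    define bs where "bs = state_bits T \<sigma> is @ [e = 0]"
    have len: "length is = length (holes T)" and is2: "\<forall>i\<in>set is. i < 2"
      using "is" by (simp_all add: binary_dict_iff)
    have lbs: "length (state_bits T \<sigma> is) = length (tangle_quads T)"
      using len by (simp add: state_bits_def tangle_quads_def)
    have "closed_arcs e T \<sigma> is = E \<union> ?J \<union> quads_arcs bs ?qs"
      unfolding closed_arcs_def state_arcs_quads[OF len] coloured_arcs_E[OF T] bs_def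
      using lbs by (simp add: quads_arcs_def Un_ac)
    moreover have "num_components (darts T) (closed_arcs e T \<sigma> is) = 1"
    proof -
      have ne: "darts T \<noteq> {}" using outer_in_darts by blast
      show ?thesis
        using conn unfolding closed_connected_def connected_by_def num_components_eq_1_iff[OF ne] .
    qed
    ultimately have "N bs = 1 + count_list bs True"
      by (simp add: N_def)
    moreover have "count_list bs True
        = card \<sigma> + length (filter (\<lambda>i. i = 0) is) + (if e = 0 then 1 else 0)"
    proof -
      have "length (filter (\<lambda>q. q \<in> \<sigma>) (crossings T)) = card ({q. q \<in> \<sigma>} \<inter> set (crossings T))"
        by (rule distinct_length_filter[OF checkerboard_distinct_crossings[OF T]])
      also have "{q. q \<in> \<sigma>} \<inter> set (crossings T) = \<sigma>" using \<sigma> by blast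
      finally show ?thesis
        by (simp add: bs_def state_bits_def count_list_map_True)
    qed
    moreover have "length (filter (\<lambda>i. i = 0) is) + count_list is 1 = length (holes T)"
      using count_list_binary[OF is2] len by simp
    moreover have "even (N bs) \<longleftrightarrow> even (N bs0)"
      using lbs by (intro parity) (simp add: bs_def)
    moreover have "e = 0 \<or> e = 1" using e by auto
    ultimately show "even (card \<sigma> + count_list is 1 + e + (N bs0 + length (holes T)))"
      by (elim disjE) (simp_all, presburger+)
  qed
qed

lemma state_weight_normalized:
  assumes "finite C" "\<sigma> \<subseteq> C"
  shows "bracket_A ^ card C * state_weight C \<sigma> = \<i> ^ card \<sigma>"
proof -
  have fin: "finite \<sigma>" using assms finite_subset by blast
  have "card C = card \<sigma> + card (C - \<sigma>)"
    using assms fin by (metis card_Diff_subset card_mono le_add_diff_inverse)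
  then have "bracket_A ^ card C * state_weight C \<sigma>
      = bracket_A ^ card \<sigma> * bracket_A ^ card \<sigma>"
    by (simp add: state_weight_def power_int_diff power_add)
  also have "\<dots> = (bracket_A ^ 2) ^ card \<sigma>"
    by (simp only: power2_eq_square power_mult_distrib)
  finally show ?thesis
    unfolding bracket_A_power_2 .
qed

text \<open>
  The product is a sign times an even power of \<open>\<i>\<close>.
\<close>

lemma unit_product_integral:
  assumes "even (s + t + e + p)"
  shows "(- \<i>) ^ t * \<i> ^ e * (- \<i>) ^ p * \<i> ^ s \<in> \<int>"
proof -
  obtain q where q: "s + t + e + p = 2 * q" using assms by blast
  have "(- \<i>) ^ t * \<i> ^ e * (- \<i>) ^ p * \<i> ^ s = (- 1) ^ (t + p) * \<i> ^ (s + t + e + p)"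
    by (simp add: power_minus[of \<i>] power_add)
  also have "\<dots> = (- 1) ^ (t + p) * (- 1) ^ q"
    unfolding q by (simp add: power_mult)
  finally show ?thesis by simp
qed

text \<open>
  The factor \<open>z\<close> compensates the number of crossings by a power of \<open>A\<close> and the common parity \<open>p\<close> of
  the one-circle states by \<open>(-\<i>)\<^sup>p\<close>.
\<close>

lemma integral_normalization:
  assumes T: "checkerboard \<kappa> T"
  obtains z where "z ^ 8 = 1"
    "\<And>is e. is \<in> set (dict (replicate (length (holes T)) 2)) \<Longrightarrow> e < 2 \<Longrightarrow>
       (- \<i>) ^ count_list is 1 * \<i> ^ e * z * state_sum T e is \<in> \<int>"
proof -
  let ?C = "set (crossings T)"
  obtain p where p: "\<And>\<sigma> is e. \<sigma> \<subseteq> ?C \<Longrightarrow> is \<in> set (dict (replicate (length (holes T)) 2)) \<Longrightarrow>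
    e < 2 \<Longrightarrow> closed_connected e T \<sigma> is \<Longrightarrow> even (card \<sigma> + count_list is 1 + e + p)"
    using one_circle_parity[OF T] by blast
  define z where "z = bracket_A ^ card ?C * (- \<i>) ^ p"
  show thesis
  proof
    have "bracket_A ^ 8 = (bracket_A ^ 2) ^ 4" by (simp flip: power_mult)
    also have "\<dots> = (\<i> ^ 2) ^ 2" unfolding bracket_A_power_2 by (simp flip: power_mult)
    finally have A8: "bracket_A ^ 8 = 1" by simp
    have "(- \<i>) ^ 8 = ((- \<i>) ^ 2) ^ 4" by (simp flip: power_mult)
    then have i8: "(- \<i>) ^ 8 = 1" by simp
    have "z ^ 8 = (bracket_A ^ 8) ^ card ?C * ((- \<i>) ^ 8) ^ p"
      unfolding z_def power_mult_distrib by (simp only: power_mult[symmetric] mult.commute)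
    then show "z ^ 8 = 1" unfolding A8 i8 by simp
    fix "is" and e :: nat
    assume "is": "is \<in> set (dict (replicate (length (holes T)) 2))" and e: "e < 2"
    let ?t = "count_list is 1"
    have "(- \<i>) ^ ?t * \<i> ^ e * z * state_sum T e is
        = (\<Sum>\<sigma>\<in>Pow ?C. (- \<i>) ^ ?t * \<i> ^ e * (- \<i>) ^ p * (bracket_A ^ card ?C * state_weight ?C \<sigma>)
             * of_bool (closed_connected e T \<sigma> is))"
      unfolding state_sum_def z_def sum_distrib_left by (intro sum.cong refl) (simp only: mult_ac)
    also have "\<dots> = (\<Sum>\<sigma>\<in>Pow ?C. (- \<i>) ^ ?t * \<i> ^ e * (- \<i>) ^ p * \<i> ^ card \<sigma>
             * of_bool (closed_connected e T \<sigma> is))"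
      by (intro sum.cong refl) (simp add: state_weight_normalized)
    also have "\<dots> \<in> \<int>"
    proof (rule Ints_sum)
      fix \<sigma> assume "\<sigma> \<in> Pow ?C"
      then show "(- \<i>) ^ ?t * \<i> ^ e * (- \<i>) ^ p * \<i> ^ card \<sigma> * of_bool (closed_connected e T \<sigma> is) \<in> \<int>"
        using p[OF _ "is" e] unit_product_integral
        by (cases "closed_connected e T \<sigma> is") simp_all
    qed
    finally show "(- \<i>) ^ ?t * \<i> ^ e * z * state_sum T e is \<in> \<int>" .
  qed
qed

lemma dim_invariant_mat [simp]:
  "dim_row (invariant_mat n T z) = 2" "dim_col (invariant_mat n T z) = 2 ^ n"
  by (simp_all add: invariant_mat_def)

lemma invariant_mat_index:
  assumes "length (holes T) = n" "e < 2" "l < 2 ^ n"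
  shows "invariant_mat n T z $$ (e, l)
     = (- \<i>) ^ count_list (dict (replicate n 2) ! l) 1 * \<i> ^ e * z * state_sum T e (dict (replicate n 2) ! l)"
  using assms less_2_cases[OF assms(2)] bracket_filled[OF dict_binary_nth[OF assms(3)] assms(1,2)]
  by (auto simp: invariant_mat_def Let_def)

lemma invariant_nonempty:
  assumes "punctured_ball_tangle_diagram n T"
  obtains M where "M \<in> invariant n T"
proof -
  have n: "length (holes T) = n" using assms by (simp add: punctured_ball_tangle_diagram_def)
  obtain \<kappa> where "checkerboard \<kappa> T" using checkerboard_exists[OF assms] .
  then obtain z where z: "z ^ 8 = 1"
    "\<And>is e. is \<in> set (dict (replicate n 2)) \<Longrightarrow> e < 2 \<Longrightarrow>
       (- \<i>) ^ count_list is 1 * \<i> ^ e * z * state_sum T e is \<in> \<int>"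
    using integral_normalization[of \<kappa> T] unfolding n by blast
  have "\<exists>m. of_int m = invariant_mat n T z $$ (e, l)" if "e < 2" "l < 2 ^ n" for e l
    using z(2)[OF dict_binary_nth[OF that(2)] that(1)]
    unfolding invariant_mat_index[OF n that] by (metis Ints_cases)
  then obtain m where m: "\<And>e l. e < 2 \<Longrightarrow> l < 2 ^ n \<Longrightarrow> of_int (m e l) = invariant_mat n T z $$ (e, l)"
    by metis
  have "map_mat of_int (mat 2 (2 ^ n) (\<lambda>(e, l). m e l)) = invariant_mat n T z"
    by (rule eq_matI) (simp_all add: m)
  then have "mat 2 (2 ^ n) (\<lambda>(e, l). m e l) \<in> invariant n T"
    using z(1) unfolding invariant_def by blast
  then show thesis by (rule that)
qed

lemma invariant_mat_scale:
  "e < 2 \<Longrightarrow> l < 2 ^ n \<Longrightarrow> invariant_mat n T (c * z) $$ (e, l) = c * invariant_mat n T z $$ (e, l)"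
  by (simp add: invariant_mat_def Let_def)

lemma invariant_carrier:
  assumes "M \<in> invariant n T"
  shows "M \<in> carrier_mat 2 (2 ^ n)"
proof -
  obtain z where "map_mat of_int M = invariant_mat n T z"
    using assms by (auto simp: invariant_def)
  from arg_cong[OF this, of dim_row] arg_cong[OF this, of dim_col] show ?thesis
    by (intro carrier_matI) simp_all
qed

text \<open>
  If \<open>M\<close> has a non-zero entry, the quotient of two admissible factors is a rational number and an
  eighth root of unity, hence \<open>1\<close> or \<open>-1\<close>.
\<close>

lemma invariant_eq_pm_class:
  assumes M: "M \<in> invariant n T"
  shows "invariant n T = pm_class M"
proof
  obtain z0 where z0: "z0 ^ 8 = 1" "map_mat of_int M = invariant_mat n T z0"
    using M by (auto simp: invariant_def)
  have dim: "dim_row M = 2" "dim_col M = 2 ^ n"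
    using invariant_carrier[OF M] by auto
  have Me: "invariant_mat n T z0 $$ (e, l) = of_int (M $$ (e, l))" if "e < 2" "l < 2 ^ n" for e l
    using that dim by (simp flip: z0(2))
  have "map_mat of_int (- M) = invariant_mat n T (- 1 * z0)"
  proof (rule eq_matI)
    fix e l assume "e < dim_row (invariant_mat n T (- 1 * z0))" "l < dim_col (invariant_mat n T (- 1 * z0))"
    then have "e < 2" "l < 2 ^ n" by simp_all
    then show "map_mat of_int (- M) $$ (e, l) = invariant_mat n T (- 1 * z0) $$ (e, l)"
      unfolding invariant_mat_scale[OF \<open>e < 2\<close> \<open>l < 2 ^ n\<close>] by (simp add: Me dim)
  qed (simp_all add: dim)
  moreover have "(- 1 * z0) ^ 8 = 1" using z0(1) by simp
  ultimately have "- M \<in> invariant n T" unfolding invariant_def by blast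
  then show "pm_class M \<subseteq> invariant n T"
    using M by (simp add: pm_class_def)
  show "invariant n T \<subseteq> pm_class M"
  proof
    fix M' assume M': "M' \<in> invariant n T"
    then obtain z where z: "z ^ 8 = 1" "map_mat of_int M' = invariant_mat n T z"
      by (auto simp: invariant_def)
    have dim': "dim_row M' = 2" "dim_col M' = 2 ^ n"
      using invariant_carrier[OF M'] by auto
    define u where "u = z / z0"
    have "z0 \<noteq> 0" using z0(1) by auto
    then have u: "z = u * z0" "u ^ 8 = 1" using z0 z by (auto simp: u_def power_divide)
    have ent: "of_int (M' $$ (e, l)) = u * of_int (M $$ (e, l))" if "e < 2" "l < 2 ^ n" for e l
    proof -
      have "of_int (M' $$ (e, l)) = invariant_mat n T z $$ (e, l)"
        using that dim' by (simp flip: z(2))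
      then show ?thesis
        unfolding u(1) invariant_mat_scale[OF that] Me[OF that] .
    qed
    show "M' \<in> pm_class M"
    proof (cases "\<exists>e l. e < 2 \<and> l < 2 ^ n \<and> M $$ (e, l) \<noteq> 0")
      case False
      then have "M' = M"
        using ent by (intro eq_matI) (simp_all add: dim dim')
      then show ?thesis by (simp add: pm_class_def)
    next
      case True
      then obtain e l where el: "e < 2" "l < 2 ^ n" "M $$ (e, l) \<noteq> 0" by blast
      define r :: real where "r = of_int (M' $$ (e, l)) / of_int (M $$ (e, l))"
      have ur: "u = of_real r"
        using ent[OF el(1,2)] el(3) by (simp add: r_def field_simps)
      have "r ^ 8 = 1"
        using u(2) unfolding ur by (metis of_real_eq_1_iff of_real_power)
      then have "\<bar>r\<bar> ^ 8 = 1 ^ 8" by simp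
      then have "\<bar>r\<bar> = 1" by (rule power_eq_imp_eq_base) auto
      then have "r = 1 \<or> r = - 1" by linarith
      then show ?thesis
      proof
        assume "r = 1"
        then have "M' = M"
          using ent ur by (intro eq_matI) (simp_all add: dim dim')
        then show ?thesis by (simp add: pm_class_def)
      next
        assume "r = - 1"
        then have "M' $$ (e, l) = - (M $$ (e, l))" if "e < 2" "l < 2 ^ n" for e l
          using ent[OF that] ur by (simp flip: of_int_minus)
        then have "M' = - M"
          by (intro eq_matI) (simp_all add: dim dim')
        then show ?thesis by (simp add: pm_class_def)
      qed
    qed
  qed
qed

section \<open>The composition formula\<close>

lemma eta_carrier: "eta n k b \<in> carrier_mat (2 ^ n) (2 ^ (\<Sum>j<n. k j))"
  by (simp add: eta_def mat_of_rows_def)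

lemma eta_index:
  assumes "\<And>j. j < n \<Longrightarrow> b j \<in> carrier_mat 2 (2 ^ k j)" "i < 2 ^ n" "l < 2 ^ (\<Sum>j<n. k j)"
  shows "eta n k b $$ (i, l) = (\<Prod>j<n. b j $$ (dict (replicate n 2) ! i ! j, dict (map (\<lambda>j. 2 ^ k j) [0..<n]) ! l ! j))"
proof -
  have "dict (replicate n 2) ! i ! j < 2" if "j < n" for j
    using dict_binary_nth[OF assms(2)] that by (auto simp: binary_dict_iff)
  then have "row (b j) (dict (replicate n 2) ! i ! j) $ (dict (map (\<lambda>j. 2 ^ k j) [0..<n]) ! l ! j)
      = b j $$ (dict (replicate n 2) ! i ! j, dict (map (\<lambda>j. 2 ^ k j) [0..<n]) ! l ! j)" if "j < n" for j
    using assms(1)[OF that] dict_binary_blocks(2)[OF assms(3) that] that by auto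
  then show ?thesis
    using assms(2,3) by (simp add: eta_def mat_of_rows_index xi_def prod_list_powers)
qed

lemma power_count_list:
  "\<forall>i\<in>set is. i < (2::nat) \<Longrightarrow> (\<Prod>j<length is. \<i> ^ (is ! j)) = \<i> ^ count_list is 1"
proof (induction "is" rule: rev_induct)
  case (snoc i "is")
  have "(\<Prod>j<length is. \<i> ^ ((is @ [i]) ! j)) = (\<Prod>j<length is. \<i> ^ (is ! j))"
    by (intro prod.cong) (auto simp: nth_append)
  moreover have "i = 0 \<or> i = 1" using snoc.prems by auto
  ultimately show ?case
    using snoc by auto
qed simp

lemma count_list_concat: "count_list (concat (map f [0..<n])) x = (\<Sum>j<n. count_list (f j) x)"
  by (induction n) auto

theorem theorem3p2:
  fixes n :: nat and k :: "nat \<Rightarrow> nat"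
    and T :: "'a tangle_diagram" and X :: "nat \<Rightarrow> 'b tangle_diagram"
    and b :: "nat \<Rightarrow> int mat"
  assumes "n \<ge> 1"
    and "punctured_ball_tangle_diagram n T"
    and "\<And>j. j < n \<Longrightarrow> punctured_ball_tangle_diagram (k j) (X j)"
    and "\<And>j. j < n \<Longrightarrow> b j \<in> carrier_mat 2 (2 ^ k j)"
    and "\<And>j. j < n \<Longrightarrow> invariant (k j) (X j) = pm_class (b j)"
  shows "invariant (\<Sum>j<n. k j) (compose T (map X [0..<n]))
           = pm_mult (invariant n T) (pm_class (eta n k b))"
proof -
  let ?K = "\<Sum>j<n. k j" and ?Xs = "map X [0..<n]"
  let ?U = "compose T ?Xs" and ?\<eta> = "eta n k b"
  have holes: "length (holes T) = n" "\<And>j. j < n \<Longrightarrow> length (holes (X j)) = k j"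
    using assms(2,3) by (simp_all add: punctured_ball_tangle_diagram_def)
  have holes_U: "length (holes ?U) = ?K"
    using holes(2) by (simp add: compose_simps length_concat comp_def sum_list_sum_nth atLeast0LessThan)
  have colour: "\<exists>\<kappa>. checkerboard \<kappa> (X j)" if "j < n" for j
    using checkerboard_exists[OF assms(3)[OF that]] by blast
  obtain M where M: "M \<in> invariant n T"
    using invariant_nonempty[OF assms(2)] .
  then obtain zT where zT: "zT ^ 8 = 1" "map_mat of_int M = invariant_mat n T zT"
    by (auto simp: invariant_def)
  note M_dim = invariant_carrier[OF M]
  have "\<exists>z. z ^ 8 = 1 \<and> map_mat of_int (b j) = invariant_mat (k j) (X j) z" if "j < n" for j
  proof -
    have "b j \<in> invariant (k j) (X j)" using assms(5)[OF that] by (simp add: pm_class_def)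
    then show ?thesis by (simp add: invariant_def)
  qed
  then obtain z where z: "\<And>j. j < n \<Longrightarrow> z j ^ 8 = 1"
    "\<And>j. j < n \<Longrightarrow> map_mat of_int (b j) = invariant_mat (k j) (X j) (z j)"
    by metis
  define zU where "zU = zT * (\<Prod>j<n. z j)"
  have "zU ^ 8 = 1"
    using zT(1) z(1) by (simp add: zU_def power_mult_distrib prod_power_distrib)
  moreover have "map_mat of_int (M * ?\<eta>) = invariant_mat ?K ?U zU"
  proof (rule eq_matI)
    fix e l assume "e < dim_row (invariant_mat ?K ?U zU)" "l < dim_col (invariant_mat ?K ?U zU)"
    then have e: "e < 2" and l: "l < 2 ^ ?K" by simp_all
    define d where "d = dict (map (\<lambda>j. 2 ^ k j) [0..<n]) ! l"
    define \<alpha> where "\<alpha> j = dict (replicate (k j) 2) ! (d ! j)" for j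
    define w where "w i = dict (replicate n 2) ! i" for i
    have d: "d ! j < 2 ^ k j" if "j < n" for j
      using dict_binary_blocks(2)[OF l that] by (simp add: d_def)
    have \<alpha>: "length (\<alpha> j) = k j" if "j < n" for j
      using dict_binary_nth[OF d[OF that]] by (simp add: \<alpha>_def binary_dict_iff)
    have blocks: "dict (replicate ?K 2) ! l = concat (map \<alpha> [0..<n])"
      using dict_binary_blocks(1)[OF l] by (simp add: d_def \<alpha>_def[abs_def])
    have w: "length (w i) = n" "\<forall>x\<in>set (w i). x < 2" "\<And>j. j < n \<Longrightarrow> w i ! j < 2" if "i < 2 ^ n" for i
      using dict_binary_nth[OF that] by (auto simp: w_def binary_dict_iff)
    have M_entry: "of_int (M $$ (e, i)) = (- \<i>) ^ count_list (w i) 1 * \<i> ^ e * zT * state_sum T e (w i)"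
      if "i < 2 ^ n" for i
    proof -
      have "of_int (M $$ (e, i)) = invariant_mat n T zT $$ (e, i)"
        using M_dim e that by (simp flip: zT(2))
      then show ?thesis
        by (simp only: invariant_mat_index[OF holes(1) e that] w_def)
    qed
    have b_entry: "of_int (b j $$ (x, d ! j)) = (- \<i>) ^ count_list (\<alpha> j) 1 * \<i> ^ x * z j * state_sum (X j) x (\<alpha> j)"
      if "j < n" "x < 2" for j x
    proof -
      have "of_int (b j $$ (x, d ! j)) = invariant_mat (k j) (X j) (z j) $$ (x, d ! j)"
        using assms(4)[OF that(1)] that d[OF that(1)] by (simp flip: z(2))
      then show ?thesis
        by (simp only: invariant_mat_index[OF holes(2)[OF that(1)] that(2) d[OF that(1)]] \<alpha>_def)
    qed
    \<comment> \<open>The powers of \<open>-\<i>\<close> and \<open>\<i>\<close> that depend on the word \<open>w i\<close> cancel, so the summation over \<open>i\<close>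
      sees only state sums.\<close>
    have term_eq: "of_int (M $$ (e, i) * ?\<eta> $$ (i, l))
        = (- \<i>) ^ count_list (concat (map \<alpha> [0..<n])) 1 * \<i> ^ e * zU
          * (state_sum T e (w i) * (\<Prod>j<n. state_sum (X j) (w i ! j) (\<alpha> j)))" if i: "i < 2 ^ n" for i
    proof -
      have "of_int (?\<eta> $$ (i, l)) = (\<Prod>j<n. of_int (b j $$ (w i ! j, d ! j)) :: complex)"
        using eta_index[of n b k i l] assms(4) i l by (simp add: w_def d_def)
      also have "\<dots> = (\<Prod>j<n. (- \<i>) ^ count_list (\<alpha> j) 1 * \<i> ^ (w i ! j) * z j * state_sum (X j) (w i ! j) (\<alpha> j))"
        using b_entry w(3)[OF i] by (intro prod.cong refl) simp
      also have "\<dots> = (- \<i>) ^ count_list (concat (map \<alpha> [0..<n])) 1 * \<i> ^ count_list (w i) 1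
          * (\<Prod>j<n. z j) * (\<Prod>j<n. state_sum (X j) (w i ! j) (\<alpha> j))"
        using power_count_list[OF w(2)[OF i]] w(1)[OF i]
        by (simp add: prod.distrib count_list_concat power_sum)
      finally have \<eta>: "of_int (?\<eta> $$ (i, l)) = \<dots>" .
      have "(- \<i>) ^ count_list (w i) 1 * \<i> ^ count_list (w i) 1 = (1::complex)"
        by (simp flip: power_mult_distrib)
      then show ?thesis
        unfolding of_int_mult M_entry[OF i] \<eta> zU_def by (simp add: mult_ac)
    qed
    have "map_mat of_int (M * ?\<eta>) $$ (e, l) = of_int ((M * ?\<eta>) $$ (e, l))"
      using M_dim eta_carrier[of n k b] e l by (intro index_map_mat) auto
    also have "(M * ?\<eta>) $$ (e, l) = (\<Sum>i<2 ^ n. M $$ (e, i) * ?\<eta> $$ (i, l))"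
      using M_dim eta_carrier[of n k b] e l
      by (auto simp: scalar_prod_def atLeast0LessThan intro!: sum.cong)
    also have "of_int \<dots> = (\<Sum>i<2 ^ n. of_int (M $$ (e, i) * ?\<eta> $$ (i, l)) :: complex)"
      by simp
    also have "\<dots> = (- \<i>) ^ count_list (concat (map \<alpha> [0..<n])) 1 * \<i> ^ e * zU
          * (\<Sum>i<2 ^ n. state_sum T e (w i) * (\<Prod>j<n. state_sum (X j) (w i ! j) (\<alpha> j)))"
      unfolding sum_distrib_left by (intro sum.cong refl) (rule term_eq, simp)
    also have "(\<Sum>i<2 ^ n. state_sum T e (w i) * (\<Prod>j<n. state_sum (X j) (w i ! j) (\<alpha> j)))
        = state_sum ?U e (concat (map \<alpha> [0..<n]))"
    proof -
      have "state_sum ?U e (concat (map \<alpha> [0..<n])) = (\<Sum>is\<in>set (dict (replicate (length ?Xs) 2)).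
          state_sum T e is * (\<Prod>j<length ?Xs. state_sum (?Xs ! j) (is ! j) (map \<alpha> [0..<n] ! j)))"
        using holes \<alpha> colour by (intro state_sum_compose) simp_all
      also have "\<dots> = (\<Sum>is\<in>set (dict (replicate n 2)).
          state_sum T e is * (\<Prod>j<n. state_sum (X j) (is ! j) (\<alpha> j)))"
        by simp
      finally show ?thesis
        by (simp only: sum_over_dict w_def)
    qed
    also have "(- \<i>) ^ count_list (concat (map \<alpha> [0..<n])) 1 * \<i> ^ e * zU
        * state_sum ?U e (concat (map \<alpha> [0..<n])) = invariant_mat ?K ?U zU $$ (e, l)"
      by (simp only: invariant_mat_index[OF holes_U e l] blocks)
    finally show "map_mat of_int (M * ?\<eta>) $$ (e, l) = invariant_mat ?K ?U zU $$ (e, l)" .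
  qed (use M_dim eta_carrier[of n k b] in auto)
  ultimately have "M * ?\<eta> \<in> invariant ?K ?U"
    unfolding invariant_def by blast
  then have "invariant ?K ?U = pm_class (M * ?\<eta>)"
    by (rule invariant_eq_pm_class)
  also have "\<dots> = pm_mult (pm_class M) (pm_class ?\<eta>)"
    by (rule pm_mult_class[OF M_dim eta_carrier, symmetric])
  also have "pm_class M = invariant n T"
    by (rule invariant_eq_pm_class[OF M, symmetric])
  finally show ?thesis .
qed

end
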